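(* Let $m\ge 2$ and $G=\mathrm{SO}(2,2m)$, realized as in the context. Let $B\colon\mathbb{R}^{2m-2}\to\mathbb{R}^{2m-2}$ be a linear transformation that has no real eigenvalue. Let $$\mathfrak{h}_B=\left\{\begin{pmatrix} t&0&x&\eta&0\\ &t&B(x)&0&-\eta\\ &&\cdots\end{pmatrix} \;:\; x\in\mathbb{R}^{2m-2},\ t,\eta\in\mathbb{R}\right\}$$ (only the first two rows of the elements of $\mathfrak a+\mathfrak n$ are displayed; they determine the matrix), let $H_B$ be the corresponding closed, connected subgroup of $G$, and let $\Gamma$ be a co-compact lattice in $\mathrm{SO}(1,2m)$. Then: (1) the subgroup $\Gamma$ acts properly on $\mathrm{SO}(2,2m)/H_B$; (2) the quotient $\Gamma\backslash \mathrm{SO}(2,2m)/H_B$ is compact; and (3) $H_B$ is conjugate via $\mathrm{O}(2,2m)$ to a subgroup of $\mathrm{SU}(1,m)$ if and only if for some $a,b\in\mathbb{R}$ (with $b\ne 0$), the matrix of $B$ with respect to some orthonormal basis of $\mathbb{R}^{2m-2}$ is a block diagonal matrix each of whose blocks is $\begin{pmatrix} a&b\\ -b&a\end{pmatrix}$. Furthermore, by varying $B$ (over linear transformations of $\mathbb{R}^{2m-2}$ with no real eigenvalue), one can obtain uncountably many pairwise nonconjugate subgroups $H_B$ of $G$.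
   Context: For $n\ge 3$, $\mathrm{O}(2,n)$ is the group of linear isometries of the quadratic form $2v_1v_{n+2}+2v_2v_{n+1}+\sum_{i=3}^n v_i^2$ on $\mathbb{R}^{n+2}$, and $\mathrm{SO}(2,n)$ is its subgroup of elements of determinant $1$. Let $A$ be the subgroup of diagonal matrices in $\mathrm{SO}(2,n)$ with all diagonal entries positive, and $N$ the subgroup of upper-triangular matrices in $\mathrm{SO}(2,n)$ with only $1$'s on the diagonal. The Lie algebra of $AN$ is $$\mathfrak a+\mathfrak n=\left\{\begin{pmatrix} t_1&\phi&x&\eta&0\\ &t_2&y&0&-\eta\\ &&0&-y^T&-x^T\\ &&&-t_2&-\phi\\ &&&&-t_1\end{pmatrix}: t_1,t_2,\phi,\eta\in\mathbb{R},\ x,y\in\mathbb{R}^{n-2}\right\},$$ where $x,y$ are row vectors; the first two rows of an element determine the whole matrix. $\mathrm{SO}(1,n)$ is realized as the stabilizer in $\mathrm{SO}(2,n)$ of the vector $(0,1,0,\dots,0,-1,0)$. $\mathrm{SU}(1,m)$ is embedded in $\mathrm{SO}(2,2m)$ in the standard way: identify $\mathbb{R}^{2m+2}$ with $\mathbb{C}^{m+1}$ carrying a Hermitian form $h$ with one negative and $m$ positive squares such that $h(v,v)$ is the given quadratic form, and take the complex-linear isometries of $h$ of complex determinant $1$ (this is well defined up to conjugation in $\mathrm{O}(2,2m)$). A discrete group $\Gamma$ acts properly on a space $X$ if $\{\gamma\in\Gamma:\gamma C\cap C\neq\emptyset\}$ is finite for every compact $C\subset X$. Here $\Gamma\subset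 G$ acts on $G/H$ by left translation. *)

theory Defs
  imports "HOL-Analysis.Analysis" "HOL-Algebra.Coset" "HOL-Algebra.Generated_Groups"
begin

section \<open>Quotients of topological groups\<close>

definition quotient_topology :: "'a topology \<Rightarrow> ('a \<Rightarrow> 'b) \<Rightarrow> 'b topology" where
  "quotient_topology X f =
     topology (\<lambda>U. U \<subseteq> f ` topspace X \<and> openin X {x \<in> topspace X. f x \<in> U})"

lemma openin_quotient_topology:
  "openin (quotient_topology X f) U \<longleftrightarrow>
     U \<subseteq> f ` topspace X \<and> openin X {x \<in> topspace X. f x \<in> U}"
proof -
  have 1: "{x \<in> topspace X. f x \<in> S \<inter> T} = {x \<in> topspace X. f x \<in> S} \<inter> {x \<in> topspace X. f x \<in> T}"
    for S T by auto
  have 2: "{x \<in> topspace X. f x \<in> \<Union>K} = (\<Union>S\<in>K. {x \<in> topspace X. f x \<in> S})" for K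
    by auto
  have "istopology (\<lambda>U. U \<subseteq> f ` topspace X \<and> openin X {x \<in> topspace X. f x \<in> U})"
    unfolding istopology_def 1 2 by blast
  then show ?thesis
    by (simp add: quotient_topology_def topology_inverse')
qed

lemma quotient_map_quotient_topology:
  "quotient_map X (quotient_topology X f) f"
proof -
  have "openin (quotient_topology X f) (f ` topspace X)"
    by (simp add: openin_quotient_topology conj_commute cong: conj_cong)
  then have "f ` topspace X \<subseteq> topspace (quotient_topology X f)"
    by (rule openin_subset)
  moreover have "topspace (quotient_topology X f) \<subseteq> f ` topspace X"
    using openin_topspace[of "quotient_topology X f"] unfolding openin_quotient_topology by blast
  ultimately have "topspace (quotient_topology X f) = f ` topspace X"
    by blast
  then show ?thesis
    by (auto simp: quotient_map_def openin_quotient_topology)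
qed

definition left_coset_space ::
    "('a::topological_space, 'b) monoid_scheme \<Rightarrow> 'a set \<Rightarrow> 'a set topology" where
  "left_coset_space G H = quotient_topology (top_of_set (carrier G)) (\<lambda>g. g <#\<^bsub>G\<^esub> H)"

definition double_coset_space ::
    "('a::topological_space, 'b) monoid_scheme \<Rightarrow> 'a set \<Rightarrow> 'a set \<Rightarrow> 'a set topology" where
  "double_coset_space G \<Gamma> H =
     quotient_topology (top_of_set (carrier G)) (\<lambda>g. \<Gamma> <#>\<^bsub>G\<^esub> (g <#\<^bsub>G\<^esub> H))"

definition acts_properly :: "'g set \<Rightarrow> ('g \<Rightarrow> 'x \<Rightarrow> 'x) \<Rightarrow> 'x topology \<Rightarrow> bool" where
  "acts_properly \<Gamma> act X \<longleftrightarrow>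
     (\<forall>C. compactin X C \<longrightarrow> finite {\<gamma> \<in> \<Gamma>. act \<gamma> ` C \<inter> C \<noteq> {}})"

text \<open>A discrete subgroup with compact quotient automatically has finite covolume.\<close>

definition cocompact_lattice ::
    "('a::topological_space, 'b) monoid_scheme \<Rightarrow> 'a set \<Rightarrow> bool" where
  "cocompact_lattice G \<Gamma> \<longleftrightarrow>
     subgroup \<Gamma> G \<and> discrete \<Gamma> \<and> compact_space (left_coset_space G \<Gamma>)"

definition conjugate_by :: "('a, 'b) monoid_scheme \<Rightarrow> 'a \<Rightarrow> 'a set \<Rightarrow> 'a set" where
  "conjugate_by G g H = (\<lambda>h. g \<otimes>\<^bsub>G\<^esub> h \<otimes>\<^bsub>G\<^esub> inv\<^bsub>G\<^esub> g) ` H"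

definition conjugate_in :: "('a, 'b) monoid_scheme \<Rightarrow> 'a set \<Rightarrow> 'a set \<Rightarrow> bool" where
  "conjugate_in G H K \<longleftrightarrow> (\<exists>g \<in> carrier G. conjugate_by G g H = K)"


section \<open>The groups $\mathrm{O}(2,n)$, $\mathrm{SO}(2,n)$ and $\mathrm{SO}(1,n)$\<close>

text \<open>
  Indices of the coordinates of $\mathbf{R}^{n+2}$, where $n - 2$ is the cardinality of the
  index type of the middle coordinates: First, Second, Penult and Last stand for
  $1$, $2$, $n+1$ and $n+2$, and Mid for $3, \dots, n$.
\<close>

datatype 'n coord = First | Second | Mid 'n | Penult | Last

lemma UNIV_coord: "(UNIV :: 'n coord set) = {First, Second, Penult, Last} \<union> range Mid"
proof -
  have "x \<in> {First, Second, Penult, Last} \<union> range Mid" for x :: "'n coord"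
    by (cases x) auto
  then show ?thesis by blast
qed

instance coord :: (finite) finite
  by standard (simp add: UNIV_coord)

lemma sum_coord:
  fixes f :: "'n::finite coord \<Rightarrow> 'b::comm_monoid_add"
  shows "sum f UNIV = f First + (f Second + (f Penult + (f Last + (\<Sum>i\<in>UNIV. f (Mid i)))))"
proof -
  have "sum f UNIV = sum f {First, Second, Penult, Last} + sum f (range Mid)"
    unfolding UNIV_coord by (rule sum.union_disjoint) auto
  also have "sum f (range Mid) = (\<Sum>i\<in>UNIV. f (Mid i))"
    by (subst sum.reindex) (auto simp: inj_def)
  finally show ?thesis by (simp add: add.assoc)
qed

lemma card_coord: "CARD('n::finite coord) = CARD('n) + 4"
  using sum_coord[of "\<lambda>_::'n coord. 1::nat"] by simp

type_synonym 'n vec2n = "real ^ 'n coord"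
type_synonym 'n mat2n = "real ^ 'n coord ^ 'n coord"

definition quad_form :: "'n::finite vec2n \<Rightarrow> real" where
  "quad_form v = 2 * (v $ First) * (v $ Last) + 2 * (v $ Second) * (v $ Penult)
                 + (\<Sum>i\<in>UNIV. (v $ Mid i)\<^sup>2)"

definition O2n :: "'n::finite mat2n monoid" where
  "O2n = \<lparr>carrier = {g. \<forall>v. quad_form (g *v v) = quad_form v}, mult = (**), one = mat 1\<rparr>"

definition SO2n :: "'n::finite mat2n monoid" where
  "SO2n = O2n\<lparr>carrier := {g \<in> carrier O2n. det g = 1}\<rparr>"

definition SO1n :: "'n::finite mat2n monoid" where
  "SO1n = SO2n\<lparr>carrier :=
     {g \<in> carrier SO2n. g *v (axis Second 1 - axis Penult 1) = axis Second 1 - axis Penult 1}\<rparr>"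

lemma isometry_invertible:
  fixes g :: "'n::finite mat2n"
  assumes g: "\<And>v. quad_form (g *v v) = quad_form v"
  shows "invertible g"
proof -
  define b :: "'n vec2n \<Rightarrow> 'n vec2n \<Rightarrow> real"
    where "b v w = quad_form (v + w) - quad_form v - quad_form w" for v w
  have b: "b v w = 2 * (v $ First * w $ Last + v $ Last * w $ First
      + v $ Second * w $ Penult + v $ Penult * w $ Second
      + (\<Sum>i\<in>UNIV. v $ Mid i * w $ Mid i))" for v w
    by (simp add: b_def quad_form_def algebra_simps power2_sum sum.distrib sum_distrib_left)
  have "v = 0" if "g *v v = 0" for v
  proof -
    have z: "b v w = 0" for w
    proof -
      have "b v w = b (g *v v) (g *v w)"
        using g[of v] g[of w] g[of "v + w"] by (simp add: b_def matrix_vector_right_distrib)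
      then show ?thesis using that by (simp add: b)
    qed
    have "v $ k = 0" for k
    proof (cases k)
      case First then show ?thesis using z[of "axis Last 1"] by (simp add: b axis_def)
    next
      case Second then show ?thesis using z[of "axis Penult 1"] by (simp add: b axis_def)
    next
      case (Mid i) then show ?thesis
        using z[of "axis (Mid i) 1"] by (simp add: b axis_def if_distrib cong: if_cong)
    next
      case Penult then show ?thesis using z[of "axis Second 1"] by (simp add: b axis_def)
    next
      case Last then show ?thesis using z[of "axis First 1"] by (simp add: b axis_def)
    qed
    then show ?thesis by (simp add: vec_eq_iff)
  qed
  then have "\<exists>B. B ** g = mat 1"
    using matrix_left_invertible_ker[of g] by blast
  then show ?thesis by (simp add: invertible_left_inverse)
qed

lemma group_O2n: "group (O2n :: 'n::finite mat2n monoid)"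
proof (rule groupI)
  fix g :: "'n mat2n"
  assume "g \<in> carrier O2n"
  then have g: "quad_form (g *v v) = quad_form v" for v by (simp add: O2n_def)
  obtain k where k: "g ** k = mat 1" "k ** g = mat 1"
    using isometry_invertible[of g] g unfolding invertible_def by blast
  have "quad_form (k *v v) = quad_form v" for v
    using g[of "k *v v"] k by (simp add: matrix_vector_mul_assoc)
  with k show "\<exists>y\<in>carrier O2n. y \<otimes>\<^bsub>O2n\<^esub> g = \<one>\<^bsub>O2n\<^esub>"
    by (auto simp: O2n_def)
qed (auto simp: O2n_def matrix_mul_assoc matrix_vector_mul_assoc[symmetric])

lemma subgroup_SO2n: "subgroup (carrier SO2n) (O2n :: 'n::finite mat2n monoid)"
proof -
  interpret group "O2n :: 'n mat2n monoid" by (rule group_O2n)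
  show ?thesis
  proof (rule subgroupI)
    fix g :: "'n mat2n"
    assume "g \<in> carrier SO2n"
    then have g: "g \<in> carrier O2n" "det g = 1" by (auto simp: SO2n_def)
    then have "det (inv\<^bsub>O2n\<^esub> g ** g) = 1"
      using l_inv[of g] by (simp add: O2n_def)
    with g show "inv\<^bsub>O2n\<^esub> g \<in> carrier SO2n"
      by (simp add: SO2n_def det_mul)
  next
    show "carrier SO2n \<noteq> ({} :: 'n mat2n set)"
      using one_closed by (auto simp: SO2n_def O2n_def intro!: exI[of _ "mat 1"])
  next
    fix g h :: "'n mat2n"
    assume "g \<in> carrier SO2n" "h \<in> carrier SO2n"
    then show "g \<otimes>\<^bsub>O2n\<^esub> h \<in> carrier SO2n"
      by (auto simp: SO2n_def O2n_def det_mul matrix_vector_mul_assoc[symmetric])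
  qed (auto simp: SO2n_def)
qed

lemma group_SO2n: "group (SO2n :: 'n::finite mat2n monoid)"
proof -
  have "SO2n = (O2n :: 'n mat2n monoid)\<lparr>carrier := carrier SO2n\<rparr>"
    by (simp add: SO2n_def)
  then show ?thesis
    by (rule ssubst) (rule subgroup.subgroup_is_group[OF subgroup_SO2n group_O2n])
qed


section \<open>The subgroups $H_B$\<close>

definition matrix_exp :: "real ^ 'k ^ 'k \<Rightarrow> real ^ 'k::finite ^ 'k" where
  "matrix_exp A = (\<Sum>k. (1 / fact k) *\<^sub>R (((**) A ^^ k) (mat 1)))"

definition an_matrix ::
    "real \<Rightarrow> real \<Rightarrow> real \<Rightarrow> real ^ 'n::finite \<Rightarrow> real ^ 'n \<Rightarrow> real \<Rightarrow> 'n mat2n" where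
  "an_matrix t1 t2 \<phi> x y \<eta> = (\<chi> i j.
     case i of
       First \<Rightarrow> (case j of First \<Rightarrow> t1 | Second \<Rightarrow> \<phi> | Mid k \<Rightarrow> x $ k | Penult \<Rightarrow> \<eta> | Last \<Rightarrow> 0)
     | Second \<Rightarrow> (case j of First \<Rightarrow> 0 | Second \<Rightarrow> t2 | Mid k \<Rightarrow> y $ k | Penult \<Rightarrow> 0 | Last \<Rightarrow> - \<eta>)
     | Mid k \<Rightarrow> (case j of Penult \<Rightarrow> - (y $ k) | Last \<Rightarrow> - (x $ k) | _ \<Rightarrow> 0)
     | Penult \<Rightarrow> (case j of Penult \<Rightarrow> - t2 | Last \<Rightarrow> - \<phi> | _ \<Rightarrow> 0)
     | Last \<Rightarrow> (case j of Last \<Rightarrow> - t1 | _ \<Rightarrow> 0))"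

definition h_alg :: "(real ^ 'n \<Rightarrow> real ^ 'n) \<Rightarrow> 'n::finite mat2n set" where
  "h_alg B = {an_matrix t t 0 x (B x) \<eta> | t x \<eta>. True}"

text \<open>
  The connected Lie subgroup with a given Lie algebra is the subgroup generated by the image of
  the Lie algebra under the exponential map. Here it is closed, as is every connected Lie subgroup
  of the simply connected, completely solvable group $AN$.
\<close>

definition H_sub :: "(real ^ 'n \<Rightarrow> real ^ 'n) \<Rightarrow> 'n::finite mat2n set" where
  "H_sub B = generate SO2n (matrix_exp ` h_alg B)"

definition no_real_eigenvalue :: "('v::real_vector \<Rightarrow> 'v) \<Rightarrow> bool" where
  "no_real_eigenvalue B \<longleftrightarrow> \<not> (\<exists>c v. v \<noteq> 0 \<and> B v = c *\<^sub>R v)"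


section \<open>Embeddings of $\mathrm{SU}(1,m)$\<close>

text \<open>
  With $m$ the cardinality of the type parameter, this is the Hermitian form
  $-z_0 \overline{w_0} + z_1 \overline{w_1} + \dots + z_m \overline{w_m}$ on $\mathbf{C}^{m+1}$.
\<close>

definition herm_form :: "complex ^ 'k::finite option \<Rightarrow> complex ^ 'k option \<Rightarrow> complex" where
  "herm_form z w = - (z $ None) * cnj (w $ None) + (\<Sum>k\<in>UNIV. z $ Some k * cnj (w $ Some k))"

definition hermitian_identification ::
    "('n::finite vec2n \<Rightarrow> complex ^ 'k::finite option) \<Rightarrow> bool" where
  "hermitian_identification \<Phi> \<longleftrightarrow>
     linear \<Phi> \<and> bij \<Phi> \<and> (\<forall>v. herm_form (\<Phi> v) (\<Phi> v) = of_real (quad_form v))"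

lemma hermitian_identification_exists:
  assumes "CARD('k::finite) = m" "CARD('n::finite) = 2 * m - 2" "m \<ge> 1"
  shows "\<exists>\<Phi> :: 'n vec2n \<Rightarrow> complex ^ 'k option. hermitian_identification \<Phi>"
proof -
  obtain k0 :: 'k where True by simp
  have "card ((UNIV - {k0}) \<times> (UNIV :: bool set)) = card (UNIV :: 'n set)"
    using assms by (simp add: card_cartesian_product card_Diff_singleton)
  then obtain f :: "'k \<times> bool \<Rightarrow> 'n"
    where f: "bij_betw f ((UNIV - {k0}) \<times> UNIV) UNIV"
    using finite_same_card_bij[of "(UNIV - {k0}) \<times> (UNIV :: bool set)" "UNIV :: 'n set"] by auto
  define f' where "f' = inv_into ((UNIV - {k0}) \<times> UNIV) f"
  have f': "f (f' i) = i" "fst (f' i) \<noteq> k0" for i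
    using f_inv_into_f[of i f "(UNIV - {k0}) \<times> UNIV"] inv_into_into[of i f "(UNIV - {k0}) \<times> UNIV"] f
    by (auto simp: f'_def bij_betw_def)
  have f'f: "f' (f (k, c)) = (k, c)" if "k \<noteq> k0" for k c
    using bij_betw_inv_into_left[OF f, of "(k, c)"] that by (simp add: f'_def)
  define s :: real where "s = 1 / sqrt 2"
  have s: "s * s = 1 / 2" by (simp add: s_def)
  then have s2: "s * (s * x) = x / 2" for x :: real
    by (simp add: mult.assoc[symmetric])
  define \<Phi> :: "'n vec2n \<Rightarrow> complex ^ 'k option" where
    "\<Phi> v = (\<chi> j. case j of
        None \<Rightarrow> Complex (s * (v $ First - v $ Last)) (s * (v $ Second - v $ Penult))
      | Some k \<Rightarrow> if k = k0 then Complex (s * (v $ First + v $ Last)) (s * (v $ Second + v $ Penult))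
          else Complex (v $ Mid (f (k, True))) (v $ Mid (f (k, False))))" for v
  define \<Psi> :: "complex ^ 'k option \<Rightarrow> 'n vec2n" where
    "\<Psi> z = (\<chi> i. case i of
        First \<Rightarrow> s * (Re (z $ Some k0) + Re (z $ None))
      | Second \<Rightarrow> s * (Im (z $ Some k0) + Im (z $ None))
      | Penult \<Rightarrow> s * (Im (z $ Some k0) - Im (z $ None))
      | Last \<Rightarrow> s * (Re (z $ Some k0) - Re (z $ None))
      | Mid i \<Rightarrow> (if snd (f' i) then Re (z $ Some (fst (f' i))) else Im (z $ Some (fst (f' i)))))" for z
  have "linear \<Phi>"
    by (rule linearI)
      (auto simp: \<Phi>_def vec_eq_iff complex_eq_iff algebra_simps split: option.split)
  moreover have "\<Phi> (\<Psi> z) = z" for z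
    by (auto simp: \<Phi>_def \<Psi>_def vec_eq_iff complex_eq_iff f'f algebra_simps s2 split: option.split)
  moreover have "\<Psi> (\<Phi> v) = v" for v
  proof -
    have "v $ Mid (f (fst (f' i), snd (f' i))) = v $ Mid i" for i
      by (simp add: f')
    then have "v $ Mid (f (fst (f' i), True)) = v $ Mid i" if "snd (f' i)" for i
      using that by metis
    moreover have "v $ Mid (f (fst (f' i), False)) = v $ Mid i" if "\<not> snd (f' i)" for i
      using that f'(1)[of i] by (metis prod.collapse)
    ultimately show ?thesis
      by (auto simp: \<Phi>_def \<Psi>_def vec_eq_iff f' algebra_simps s2 split: coord.split)
  qed
  moreover have "herm_form (\<Phi> v) (\<Phi> v) = of_real (quad_form v)" for v
  proof -
    have sq: "Complex a b * cnj (Complex a b) = of_real (a\<^sup>2 + b\<^sup>2)" for a b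
      by (simp add: complex_mult_cnj)
    have "(\<Sum>i\<in>UNIV. (v $ Mid i)\<^sup>2) = (\<Sum>p\<in>(UNIV - {k0}) \<times> UNIV. (v $ Mid (f p))\<^sup>2)"
      using sum.reindex_bij_betw[OF f, of "\<lambda>i. (v $ Mid i)\<^sup>2"] by simp
    also have "\<dots> = (\<Sum>k\<in>UNIV - {k0}. \<Sum>c\<in>UNIV. (v $ Mid (f (k, c)))\<^sup>2)"
      by (simp add: sum.cartesian_product)
    finally have mid: "(\<Sum>i\<in>UNIV. (v $ Mid i)\<^sup>2) =
        (\<Sum>k\<in>UNIV - {k0}. (v $ Mid (f (k, True)))\<^sup>2 + (v $ Mid (f (k, False)))\<^sup>2)"
      by (simp add: UNIV_bool add.commute)
    have "(\<Sum>k\<in>UNIV. \<Phi> v $ Some k * cnj (\<Phi> v $ Some k)) =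
        \<Phi> v $ Some k0 * cnj (\<Phi> v $ Some k0)
        + (\<Sum>k\<in>UNIV - {k0}. \<Phi> v $ Some k * cnj (\<Phi> v $ Some k))"
      by (subst sum.remove[of _ k0]) auto
    also have "(\<Sum>k\<in>UNIV - {k0}. \<Phi> v $ Some k * cnj (\<Phi> v $ Some k)) =
        of_real (\<Sum>i\<in>UNIV. (v $ Mid i)\<^sup>2)"
      unfolding mid of_real_sum by (rule sum.cong) (auto simp: \<Phi>_def sq simp del: complex_cnj)
    also have "\<Phi> v $ Some k0 * cnj (\<Phi> v $ Some k0) =
        of_real ((s * (v $ First + v $ Last))\<^sup>2 + (s * (v $ Second + v $ Penult))\<^sup>2)"
      by (simp add: \<Phi>_def sq del: complex_cnj)
    finally have some: "(\<Sum>k\<in>UNIV. \<Phi> v $ Some k * cnj (\<Phi> v $ Some k)) =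
        of_real ((s * (v $ First + v $ Last))\<^sup>2 + (s * (v $ Second + v $ Penult))\<^sup>2
          + (\<Sum>i\<in>UNIV. (v $ Mid i)\<^sup>2))" by simp
    have none: "\<Phi> v $ None * cnj (\<Phi> v $ None) =
        of_real ((s * (v $ First - v $ Last))\<^sup>2 + (s * (v $ Second - v $ Penult))\<^sup>2)"
      by (simp add: \<Phi>_def sq del: complex_cnj)
    have "quad_form v = - ((s * (v $ First - v $ Last))\<^sup>2 + (s * (v $ Second - v $ Penult))\<^sup>2)
        + ((s * (v $ First + v $ Last))\<^sup>2 + (s * (v $ Second + v $ Penult))\<^sup>2
          + (\<Sum>i\<in>UNIV. (v $ Mid i)\<^sup>2))"
      by (simp add: quad_form_def power_mult_distrib power2_eq_square s algebra_simps s2)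
    then show ?thesis
      unfolding herm_form_def mult_minus_left some none by simp
  qed
  ultimately have "hermitian_identification \<Phi>"
    unfolding hermitian_identification_def by (metis bijI')
  then show ?thesis by blast
qed

definition SU1m :: "('n::finite vec2n \<Rightarrow> complex ^ 'k::finite option) \<Rightarrow> 'n mat2n set" where
  "SU1m \<Phi> = {g. \<exists>U :: complex ^ 'k option ^ 'k option.
     (\<forall>z w. herm_form (U *v z) (U *v w) = herm_form z w) \<and> det U = 1 \<and>
     (\<forall>v. \<Phi> (g *v v) = U *v \<Phi> v)}"


section \<open>Block diagonal matrices\<close>

text \<open>
  Row and column indices start from 0. The basis is indexed by \<open>{..<d}\<close>, and the \<open>j\<close>-th column of
  its matrix consists of the coordinates of the image of the \<open>j\<close>-th basis vector.
\<close>

definition orthonormal_basis :: "nat \<Rightarrow> (nat \<Rightarrow> 'v::euclidean_space) \<Rightarrow> bool" where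
  "orthonormal_basis d e \<longleftrightarrow>
     (\<forall>i<d. \<forall>j<d. e i \<bullet> e j = (if i = j then 1 else 0)) \<and> span (e ` {..<d}) = UNIV"

definition matrix_wrt_basis ::
    "nat \<Rightarrow> (nat \<Rightarrow> 'v::real_vector) \<Rightarrow> ('v \<Rightarrow> 'v) \<Rightarrow> (nat \<Rightarrow> nat \<Rightarrow> real) \<Rightarrow> bool" where
  "matrix_wrt_basis d e B M \<longleftrightarrow> (\<forall>j<d. B (e j) = (\<Sum>i<d. M i j *\<^sub>R e i))"

definition rot_block :: "real \<Rightarrow> real \<Rightarrow> nat \<Rightarrow> nat \<Rightarrow> real" where
  "rot_block a b i j = [[a, b], [- b, a]] ! i ! j"

definition block_diagonal :: "(nat \<Rightarrow> nat \<Rightarrow> real) \<Rightarrow> nat \<Rightarrow> nat \<Rightarrow> real" where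
  "block_diagonal P i j = (if i div 2 = j div 2 then P (i mod 2) (j mod 2) else 0)"

end

theory Submission
  imports Defs
begin

text \<open>
  Let \<open>n = 2 m\<close>, write \<open>q\<close> for the quadratic form and \<open>w\<close> for the vector whose stabilizer is
  $\mathrm{SO}(1,n)$, so that \<open>q w = -2\<close>.

  Parts (1) and (2) hold because $H_B$ acts properly, and with compact orbit space, on the quadric
  \<open>S = {v. q v = -2}\<close>. Indeed, if \<open>\<gamma> g1 = g2 h\<close> with \<open>\<gamma>\<close> in $\mathrm{SO}(1,n)$ and \<open>h\<close> in
  $H_B$, then \<open>h\<close> moves the point \<open>inverse g1 w\<close> of \<open>S\<close> to \<open>inverse g2 w\<close>; so bounded \<open>g1\<close> and
  \<open>g2\<close> leave only boundedly many \<open>h\<close> and hence only boundedly many \<open>\<gamma>\<close>, and a bounded part of a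
  discrete group is finite. Write a vector as \<open>(v1, v2, z, v4, v5)\<close> with \<open>z\<close> the middle
  coordinates. An element of $H_B$ is a product of a dilation by \<open>r\<close>, which divides \<open>(v4, v5)\<close> by
  \<open>r\<close>, and a unipotent matrix with parameters \<open>x\<close> and \<open>\<eta>\<close>, which fixes \<open>(v4, v5)\<close>, subtracts
  \<open>v4 B x + v5 x\<close> from \<open>z\<close>, and, through \<open>\<eta>\<close>, moves \<open>(v1, v2)\<close> in the direction \<open>(v4, -v5)\<close>.
  On \<open>S\<close> the pair \<open>(v4, v5)\<close> is not zero, and as \<open>B\<close> has no real eigenvalue, the operator
  \<open>v4 B + v5\<close> is invertible. So \<open>r\<close>, \<open>x\<close> and \<open>\<eta>\<close> can be read off from a point and its image, with
  bounds (\<open>h_group_proper_on_quadric\<close>); and they can be chosen such that the image has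
  \<open>v4^2 + v5^2 = 1\<close>, \<open>z = 0\<close> and \<open>(v1, v2) = (-v5, -v4)\<close>, which describes a circle
  (\<open>h_group_orbit_meets_circle\<close>).

  The rest is about isometries that normalize $H_B$ or carry it to another $H_{B'}$. The common
  eigenvectors of $H_B$ form the totally isotropic plane \<open>E\<close> spanned by the first two basis vectors
  (\<open>common_eigenvectors\<close>). An intertwining isometry therefore preserves \<open>E\<close> and its orthogonal
  complement; it induces a \<open>2\<close> by \<open>2\<close> matrix with rows \<open>(\<alpha>, \<beta>)\<close> and \<open>(\<gamma>, \<delta>)\<close> on \<open>E\<close>
  and an orthogonal transformation \<open>R\<close> of the middle coordinates. Comparing the first two rows \<open>x\<close>
  and \<open>B x\<close> of the unipotent elements gives \<open>B' (R (\<alpha> x + \<beta> B x)) = R (\<gamma> x + \<delta> B x)\<close>: up to \<open>R\<close>,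
  the operator \<open>B'\<close> is a fractional linear function of \<open>B\<close> (\<open>intertwine_unip\<close>).

  If $H_B$ is conjugate into $\mathrm{SU}(1,m)$, it commutes with an isometric complex structure \<open>J\<close>.
  For \<open>J\<close> the relation becomes \<open>x = R (\<alpha> x + \<beta> B x)\<close> with \<open>R^2 = -1\<close>, so that \<open>B = a + b R\<close>,
  which is the block form. Conversely a fractional linear change reduces \<open>a + b K\<close> to the
  orthogonal complex structure \<open>K\<close> itself, where $H_K$ is visibly complex linear in suitable
  coordinates. Its complex determinants are \<open>1\<close>, since the unipotent elements are commutators and a
  dilation is conjugate to its inverse by a complex-linear isometry (\<open>h_group_subset_SU1m\<close>).

  Finally, the operators $B_s$ with blocks $\begin{pmatrix} 0&s\cr -1/s&0\end{pmatrix}$ have square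
  \<open>-1\<close>, and the only fractional linear functions of $B_s$ with square \<open>-1\<close> are $B_s$ and its
  negative. So conjugacy of the groups preserves the operator norm, which is \<open>s\<close> for \<open>s \<ge> 1\<close>.
\<close>

section \<open>Coordinates and isometries\<close>

definition pt :: "real \<Rightarrow> real \<Rightarrow> real ^ 'n \<Rightarrow> real \<Rightarrow> real \<Rightarrow> 'n::finite vec2n" where
  "pt a b z c d = (\<chi> i. case i of First \<Rightarrow> a | Second \<Rightarrow> b | Mid k \<Rightarrow> z $ k | Penult \<Rightarrow> c | Last \<Rightarrow> d)"

definition mid :: "'n::finite vec2n \<Rightarrow> real ^ 'n" where
  "mid v = (\<chi> k. v $ Mid k)"

lemma pt_simps [simp]:
  "pt a b z c d $ First = a" "pt a b z c d $ Second = b" "pt a b z c d $ Mid k = z $ k"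
  "pt a b z c d $ Penult = c" "pt a b z c d $ Last = d" "mid (pt a b z c d) = z"
  by (simp_all add: pt_def mid_def)

lemma mid_simps [simp]:
  "mid (v + w) = mid v + mid w" "mid (v - w) = mid v - mid w" "mid (c *\<^sub>R v) = c *\<^sub>R mid v"
  "mid (- v) = - mid v" "mid 0 = 0"
  by (simp_all add: mid_def vec_eq_iff)

lemma vec2n_eqI:
  assumes "v $ First = w $ First" "v $ Second = w $ Second" "mid v = mid w"
    "v $ Penult = w $ Penult" "v $ Last = w $ Last"
  shows "v = w"
proof -
  have "v $ Mid k = w $ Mid k" for k
    using assms(3) by (simp add: mid_def vec_eq_iff)
  then have "v $ i = w $ i" for i
    using assms by (cases i) auto
  then show ?thesis by (simp add: vec_eq_iff)
qed

lemma quad_form_mid: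
  "quad_form v = 2 * v $ First * v $ Last + 2 * v $ Second * v $ Penult + mid v \<bullet> mid v"
  by (simp add: quad_form_def inner_vec_def mid_def power2_eq_square)

text \<open>
  Matrices are introduced below by their action on column vectors: identities between
  products then become identities between the five components of a vector.
\<close>

lemma matrix_vec:
  fixes f :: "real ^ 'i \<Rightarrow> real ^ 'j"
  shows "linear f \<Longrightarrow> matrix f *v v = f v"
  by (rule matrix_works) (simp add: linear_matrix_vector_mul_eq)

text \<open>
  The Gram matrix of the bilinear form whose quadratic form is \<open>quad_form\<close>.
\<close>

definition gram :: "'n::finite mat2n" where
  "gram = matrix (\<lambda>v. pt (v $ Last) (v $ Penult) (mid v) (v $ Second) (v $ First))"

lemma gram_vec: "gram *v v = pt (v $ Last) (v $ Penult) (mid v) (v $ Second) (v $ First)"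
  unfolding gram_def by (rule matrix_vec, rule linearI; rule vec2n_eqI) simp_all

lemma gram_gram: "gram ** gram = mat 1"
  unfolding matrix_eq by (auto simp: matrix_vector_mul_assoc[symmetric] gram_vec intro!: vec2n_eqI)

lemma inner_vec2n:
  "v \<bullet> w = v $ First * w $ First + v $ Second * w $ Second + mid v \<bullet> mid w
     + v $ Penult * w $ Penult + v $ Last * w $ Last"
  by (simp add: inner_vec_def sum_coord mid_def)

lemma quad_form_gram: "quad_form v = v \<bullet> (gram *v v)"
  by (simp add: inner_vec2n gram_vec quad_form_mid)

lemma inner_gram_sym: "v \<bullet> (gram *v w) = w \<bullet> (gram *v v)"
  by (simp add: inner_vec2n gram_vec inner_commute)

lemma isometry_gram:
  assumes "g \<in> carrier O2n"
  shows "(g *v v) \<bullet> (gram *v (g *v w)) = v \<bullet> (gram *v w)"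
proof -
  have q: "quad_form (g *v v) = quad_form v" for v
    using assms by (simp add: O2n_def)
  have polar: "quad_form (v + w) = quad_form v + quad_form w + 2 * (v \<bullet> (gram *v w))" for v w
    unfolding quad_form_gram
    by (simp add: matrix_vector_right_distrib inner_add inner_gram_sym[of w v])
  then show ?thesis
    using q[of v] q[of w] q[of "v + w"] polar[of v w] polar[of "g *v v" "g *v w"]
    by (simp add: matrix_vector_right_distrib)
qed

text \<open>
  An explicit inverse makes inversion linear on the isometry group, hence norm bounds
  for inverses immediate.
\<close>

lemma isometry_left_inverse:
  assumes "g \<in> carrier O2n"
  shows "(gram ** transpose g ** gram) ** g = mat 1"
proof -
  have "(transpose g ** gram ** g) *v w = gram *v w" for w
    by (rule vector_eq_ldot[THEN iffD1])
      (metis isometry_gram[OF assms] dot_lmul_matrix inner_commute matrix_vector_mul_assoc transpose_matrix_vector transpose_transpose)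
  then have "transpose g ** gram ** g = gram"
    by (simp add: matrix_eq)
  then show ?thesis
    by (simp add: matrix_mul_assoc[symmetric] gram_gram)
qed

lemma isometry_det_square:
  fixes g :: "'n::finite mat2n"
  assumes "g \<in> carrier O2n"
  shows "(det g)\<^sup>2 = 1"
proof -
  have 1: "det (gram :: 'n mat2n) * det (gram :: 'n mat2n) = 1"
    using arg_cong[OF gram_gram, of "det :: 'n mat2n \<Rightarrow> _"] by (simp add: det_mul)
  have "det (gram :: 'n mat2n) * det (gram :: 'n mat2n) * (det g * det g) = 1"
    using arg_cong[OF isometry_left_inverse[OF assms], of det]
    by (simp only: det_mul det_transpose det_I ac_simps)
  then show ?thesis unfolding 1 by (simp add: power2_eq_square)
qed

lemma O2n_simps [simp]: "mult O2n = (**)" "one O2n = mat 1"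
  by (simp_all add: O2n_def)

lemma SO2n_simps [simp]: "mult SO2n = (**)" "one SO2n = mat 1"
  by (simp_all add: SO2n_def O2n_def)

lemma SO1n_simps [simp]: "mult SO1n = (**)" "one SO1n = mat 1"
  by (simp_all add: SO1n_def SO2n_def O2n_def)

text \<open>
  The determinant of an isometry is \<open>\<plusminus>1\<close>. All the unipotent, diagonal and rotation matrices
  considered below have square roots of the same kind, so no determinant has to be expanded.
\<close>

lemma isometry_square_in_SO2n:
  assumes "g \<in> carrier O2n"
  shows "g ** g \<in> carrier SO2n"
proof -
  have "det (g ** g) = 1"
    using isometry_det_square[OF assms] by (simp add: det_mul power2_eq_square)
  then show ?thesis
    using assms by (simp add: SO2n_def O2n_def matrix_vector_mul_assoc[symmetric])
qed

section \<open>The elements of $H_B$\<close>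

text \<open>
  The exponential of the matrix with entries \<open>x\<close>, \<open>y\<close>, \<open>\<eta>\<close> in its first two rows and
  zero diagonal blocks; the terms of degree two in \<open>x\<close> and \<open>y\<close> come from the square of that matrix.
\<close>

definition unip :: "real ^ 'n \<Rightarrow> real ^ 'n \<Rightarrow> real \<Rightarrow> 'n::finite mat2n" where
  "unip x y \<eta> = matrix (\<lambda>v. pt
     (v $ First + x \<bullet> mid v + (\<eta> - (x \<bullet> y) / 2) * v $ Penult - (x \<bullet> x) / 2 * v $ Last)
     (v $ Second + y \<bullet> mid v - (y \<bullet> y) / 2 * v $ Penult - (\<eta> + (x \<bullet> y) / 2) * v $ Last)
     (mid v - (v $ Penult *\<^sub>R y + v $ Last *\<^sub>R x))
     (v $ Penult) (v $ Last))"

definition dil :: "real \<Rightarrow> 'n::finite mat2n" where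
  "dil r = matrix (\<lambda>v. pt (r * v $ First) (r * v $ Second) (mid v) (v $ Penult / r) (v $ Last / r))"

text \<open>
  The group $H_B$ in closed form. For linear \<open>B\<close>, it is proved below to be the group generated by the
  exponentials.
\<close>

definition h_group :: "(real ^ 'n \<Rightarrow> real ^ 'n) \<Rightarrow> 'n::finite mat2n set" where
  "h_group B = {unip x (B x) \<eta> ** dil r | x \<eta> r. r > 0}"

lemma unip_vec: "unip x y \<eta> *v v = pt
     (v $ First + x \<bullet> mid v + (\<eta> - (x \<bullet> y) / 2) * v $ Penult - (x \<bullet> x) / 2 * v $ Last)
     (v $ Second + y \<bullet> mid v - (y \<bullet> y) / 2 * v $ Penult - (\<eta> + (x \<bullet> y) / 2) * v $ Last)
     (mid v - (v $ Penult *\<^sub>R y + v $ Last *\<^sub>R x))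
     (v $ Penult) (v $ Last)"
  unfolding unip_def
  by (rule matrix_vec, rule linearI; rule vec2n_eqI) (simp_all add: algebra_simps inner_add add_divide_distrib)

lemma dil_vec:
  "dil r *v v = pt (r * v $ First) (r * v $ Second) (mid v) (v $ Penult / r) (v $ Last / r)"
  unfolding dil_def
  by (rule matrix_vec, rule linearI; rule vec2n_eqI) (simp_all add: algebra_simps add_divide_distrib)

lemma unip_0 [simp]: "unip 0 0 0 = mat 1"
  by (auto simp: matrix_eq unip_vec intro!: vec2n_eqI)

lemma dil_1 [simp]: "dil 1 = mat 1"
  by (auto simp: matrix_eq dil_vec intro!: vec2n_eqI)

text \<open>
  A Heisenberg-type law: \<open>\<eta>\<close> is the central coordinate. Along a fixed direction, that is for
  \<open>x'\<close> and \<open>y'\<close> the same multiples of \<open>x\<close> and \<open>y\<close>, the cocycle vanishes.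
\<close>

lemma unip_mult:
  "unip x y \<eta> ** unip x' y' \<eta>' = unip (x + x') (y + y') (\<eta> + \<eta>' + (x' \<bullet> y - x \<bullet> y') / 2)"
  unfolding matrix_eq matrix_vector_mul_assoc[symmetric] unip_vec
  by (auto intro!: vec2n_eqI simp: algebra_simps inner_add inner_diff add_divide_distrib
      diff_divide_distrib inner_commute[of x' x] inner_commute[of y' y] inner_commute[of y x']  inner_commute[of y x] inner_commute[of y' x] inner_commute[of y' x'])

lemma dil_mult: "dil r ** dil s = dil (r * s)"
  unfolding matrix_eq matrix_vector_mul_assoc[symmetric] dil_vec
  by (auto intro!: vec2n_eqI simp: field_simps)

lemma dil_unip:
  assumes "r \<noteq> 0"
  shows "dil r ** unip x y \<eta> = unip (r *\<^sub>R x) (r *\<^sub>R y) (r\<^sup>2 * \<eta>) ** dil r"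
  unfolding matrix_eq matrix_vector_mul_assoc[symmetric] unip_vec dil_vec using assms
  by (auto intro!: vec2n_eqI simp: algebra_simps power2_eq_square)

lemma unip_isometry: "unip x y \<eta> \<in> carrier O2n"
  by (simp add: O2n_def quad_form_mid unip_vec)
   (simp add: algebra_simps inner_add inner_diff inner_commute[of y x] inner_commute[of x "mid _"] inner_commute[of y "mid _"])

lemma dil_isometry: "r \<noteq> 0 \<Longrightarrow> dil r \<in> carrier O2n"
  by (simp add: O2n_def quad_form_mid dil_vec)

lemma unip_SO2n: "unip x y \<eta> \<in> carrier SO2n"
  using isometry_square_in_SO2n[OF unip_isometry, of "x /\<^sub>R 2" "y /\<^sub>R 2" "\<eta> / 2"]
  by (simp add: unip_mult scaleR_2[symmetric] mult_2[symmetric])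

lemma dil_SO2n: "r > 0 \<Longrightarrow> dil r \<in> carrier SO2n"
  using isometry_square_in_SO2n[OF dil_isometry, of "sqrt r"]
  by (simp add: dil_mult)

lemma h_groupI: "r > 0 \<Longrightarrow> y = B x \<Longrightarrow> unip x y \<eta> ** dil r \<in> h_group B"
  unfolding h_group_def by blast

lemma unip_in_h_group: "y = B x \<Longrightarrow> unip x y \<eta> \<in> h_group B"
  using h_groupI[of 1 y B x \<eta>] by simp

lemma dil_in_h_group: "linear B \<Longrightarrow> r > 0 \<Longrightarrow> dil r \<in> h_group B"
  using h_groupI[of r 0 B 0 0] by (simp add: linear_0)

lemma h_group_mult:
  assumes "linear B" "g \<in> h_group B" "h \<in> h_group B"
  shows "g ** h \<in> h_group B"
proof -
  obtain x \<eta> r x' \<eta>' r' where gh: "g = unip x (B x) \<eta> ** dil r" "h = unip x' (B x') \<eta>' ** dil r'"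
    "r > 0" "r' > 0" using assms unfolding h_group_def by blast
  have "g ** h = unip x (B x) \<eta> ** (dil r ** unip x' (B x') \<eta>') ** dil r'"
    by (simp add: gh matrix_mul_assoc)
  also have "\<dots> = (unip x (B x) \<eta> ** unip (r *\<^sub>R x') (r *\<^sub>R B x') (r\<^sup>2 * \<eta>')) ** (dil r ** dil r')"
    using gh by (simp add: dil_unip matrix_mul_assoc)
  also have "\<dots> \<in> h_group B"
    unfolding unip_mult dil_mult using gh assms(1)
    by (intro h_groupI) (auto simp: linear_add linear_scale)
  finally show ?thesis .
qed

lemma h_group_left_inverse:
  assumes "linear B" "g \<in> h_group B"
  obtains h where "h \<in> h_group B" "h ** g = mat 1"
proof -
  obtain x \<eta> r where g: "g = unip x (B x) \<eta> ** dil r" "r > 0"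
    using assms unfolding h_group_def by blast
  have "(dil (1 / r) ** unip (- x) (- B x) (- \<eta>)) ** g =
      dil (1 / r) ** (unip (- x) (- B x) (- \<eta>) ** unip x (B x) \<eta>) ** dil r"
    by (simp add: g matrix_mul_assoc)
  also have "\<dots> = mat 1"
    unfolding unip_mult using g(2) by (simp add: dil_mult)
  finally have "(dil (1 / r) ** unip (- x) (- B x) (- \<eta>)) ** g = mat 1" .
  moreover have "dil (1 / r) ** unip (- x) (- B x) (- \<eta>) \<in> h_group B"
    using assms g by (intro h_group_mult dil_in_h_group unip_in_h_group) (auto simp: linear_neg)
  ultimately show ?thesis by (rule that[rotated])
qed

lemma h_group_SO2n: "h_group B \<subseteq> carrier SO2n"
proof
  fix g assume "g \<in> h_group B"
  then obtain x \<eta> r where "g = unip x (B x) \<eta> ** dil r" "r > 0"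
    unfolding h_group_def by blast
  then show "g \<in> carrier SO2n"
    using group.is_monoid[OF group_SO2n, THEN monoid.m_closed, OF unip_SO2n dil_SO2n] by simp
qed

lemma subgroup_h_group:
  fixes B :: "real ^ 'n \<Rightarrow> real ^ 'n::finite"
  assumes "linear B"
  shows "subgroup (h_group B) SO2n"
proof -
  interpret group "SO2n :: 'n mat2n monoid" by (rule group_SO2n)
  show ?thesis
  proof (rule subgroupI)
    show "h_group B \<noteq> {}" using dil_in_h_group[OF assms, of 1] by auto
  next
    fix g assume g: "g \<in> h_group B"
    then obtain h where h: "h \<in> h_group B" "h ** g = mat 1"
      using h_group_left_inverse assms by blast
    have "inv\<^bsub>SO2n\<^esub> g = h"
      using g h h_group_SO2n by (intro inv_equality) auto
    then show "inv\<^bsub>SO2n\<^esub> g \<in> h_group B" using h by simp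
  qed (use h_group_SO2n h_group_mult[OF assms] in auto)
qed

section \<open>The exponential map on $\mathfrak{h}_B$\<close>

lemma an_vec: "an_matrix t1 t2 \<phi> x y \<eta> *v v = pt
    (t1 * v $ First + \<phi> * v $ Second + x \<bullet> mid v + \<eta> * v $ Penult)
    (t2 * v $ Second + y \<bullet> mid v - \<eta> * v $ Last)
    (- (v $ Penult *\<^sub>R y + v $ Last *\<^sub>R x))
    (- t2 * v $ Penult - \<phi> * v $ Last) (- t1 * v $ Last)"
  by (rule vec2n_eqI)
    (auto simp: an_matrix_def matrix_vector_mult_def sum_coord inner_vec_def mid_def vec_eq_iff
      algebra_simps)

text \<open>
  In finite dimension, convergence of a series of matrices may be tested on vectors.
\<close>

lemma matrix_sumsI:
  fixes f :: "nat \<Rightarrow> real ^ 'i::finite ^ 'j::finite"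
  assumes "\<And>v i. (\<lambda>k. (f k *v v) $ i) sums ((L *v v) $ i)"
  shows "f sums L"
proof -
  have "(\<lambda>k. f k $ i $ j) sums (L $ i $ j)" for i j
    using assms[of "axis j 1" i] by (simp add: matrix_vector_mult_basis column_def)
  then show ?thesis
    unfolding sums_def by (intro vec_tendstoI) (simp add: sum_component)
qed

lemma matrix_exp_nilpotent:
  "matrix_exp (an_matrix 0 0 0 x y \<eta>) = unip x y \<eta>"
proof -
  let ?A = "an_matrix 0 0 0 x y \<eta>"
  have cube: "?A ** (?A ** (?A ** M)) = 0" for M
    by (auto simp: matrix_eq matrix_vector_mul_assoc[symmetric] an_vec intro!: vec2n_eqI)
  have "((**) ?A ^^ k) (mat 1) = 0" if "k \<notin> {..<3}" for k
  proof -
    have "k = Suc (Suc (Suc (k - 3)))"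
      using that by auto
    then show ?thesis
      by (metis (no_types, lifting) cube funpow.simps(2) comp_apply)
  qed
  then have "matrix_exp ?A = (\<Sum>k<3. (1 / fact k) *\<^sub>R ((**) ?A ^^ k) (mat 1))"
    unfolding matrix_exp_def by (intro suminf_finite) auto
  also have "\<dots> = mat 1 + ?A + (1 / 2) *\<^sub>R (?A ** ?A)"
    by (simp add: numeral_3_eq_3)
  also have "\<dots> = unip x y \<eta>"
    unfolding matrix_eq matrix_vector_mult_add_rdistrib scaleR_matrix_vector_assoc[symmetric]
      matrix_vector_mul_assoc[symmetric] an_vec unip_vec
    by (auto intro!: vec2n_eqI simp: field_simps inner_add inner_diff inner_commute[of y x])
  finally show ?thesis .
qed

text \<open>
  Stated as a convergent series rather than as a value of \<open>matrix_exp\<close>, because conjugation is moved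
  through the series later.
\<close>

lemma sums_exp_diagonal:
  "(\<lambda>k. (1 / fact k) *\<^sub>R ((**) (an_matrix t t 0 0 0 0) ^^ k) (mat 1)) sums dil (exp t)"
proof (rule matrix_sumsI)
  fix v :: "'a vec2n" and i
  have e: "(\<lambda>k. (1 / fact k) * (s ^ k * a)) sums (exp s * a)" for s a :: real
    using sums_mult2[OF exp_converges[of s], of a] by (simp add: field_simps)
  have z: "(\<lambda>k. (1 / fact k) * (0 ^ k * a)) sums a" for a :: real
    using e[of 0 a] by simp
  have pow: "((**) (an_matrix t t 0 0 0 0) ^^ k) (mat 1) *v v = pt (t ^ k * v $ First) (t ^ k * v $ Second)
      (0 ^ k *\<^sub>R mid v) ((- t) ^ k * v $ Penult) ((- t) ^ k * v $ Last)" for k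
    by (induction k) (auto simp: an_vec matrix_vector_mul_assoc[symmetric] intro!: vec2n_eqI)
  have "(\<lambda>k. ((1 / fact k) *\<^sub>R pt (t ^ k * v $ First) (t ^ k * v $ Second) (0 ^ k *\<^sub>R mid v)
        ((- t) ^ k * v $ Penult) ((- t) ^ k * v $ Last)) $ i) sums
      (pt (exp t * v $ First) (exp t * v $ Second) (mid v) (v $ Penult / exp t) (v $ Last / exp t) $ i)"
  proof (cases i)
    case (Mid k)
    then show ?thesis using z[of "mid v $ k"] by simp
  qed (use e[of t "v $ First"] e[of t "v $ Second"] e[of "- t" "v $ Penult"] e[of "- t" "v $ Last"]
       in \<open>simp_all add: exp_minus divide_inverse mult.commute\<close>)
  then show "(\<lambda>k. ((1 / fact k) *\<^sub>R ((**) (an_matrix t t 0 0 0 0) ^^ k) (mat 1) *v v) $ i) sums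
     ((dil (exp t) *v v) $ i)"
    unfolding scaleR_matrix_vector_assoc[symmetric] pow dil_vec .
qed

lemma matrix_exp_conjugate:
  fixes P :: "real ^ 'k ^ 'k::finite"
  assumes QP: "Q ** P = mat 1" and s: "(\<lambda>k. (1 / fact k) *\<^sub>R ((**) A ^^ k) (mat 1)) sums L"
  shows "matrix_exp (P ** A ** Q) = P ** L ** Q"
proof -
  have PQ: "P ** Q = mat 1" using QP by (simp add: matrix_left_right_inverse)
  have pow: "((**) (P ** A ** Q) ^^ k) (mat 1) = P ** ((**) A ^^ k) (mat 1) ** Q" for k
  proof (induction k)
    case (Suc k)
    then have "((**) (P ** A ** Q) ^^ Suc k) (mat 1) = P ** A ** (Q ** P) ** ((**) A ^^ k) (mat 1) ** Q"
      by (simp add: matrix_mul_assoc)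
    then show ?case by (simp add: QP matrix_mul_assoc)
  qed (simp add: PQ)
  have "linear (\<lambda>M. P ** M ** Q)"
    by (rule linearI) (simp_all add: matrix_eq matrix_vector_mult_add_rdistrib
        matrix_vector_right_distrib matrix_vector_mul_assoc[symmetric]
        scaleR_matrix_vector_assoc[symmetric] matrix_vector_mult_scaleR)
  then have bl: "bounded_linear (\<lambda>M. P ** M ** Q)"
    by (simp add: linear_conv_bounded_linear)
  have "(\<lambda>k. P ** ((1 / fact k) *\<^sub>R ((**) A ^^ k) (mat 1)) ** Q) sums (P ** L ** Q)"
    by (rule bounded_linear.sums[OF bl s])
  then have "(\<lambda>k. (1 / fact k) *\<^sub>R ((**) (P ** A ** Q) ^^ k) (mat 1)) sums (P ** L ** Q)"
    by (simp add: pow matrix_scalar_ac scalar_matrix_assoc[symmetric])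
  then show ?thesis unfolding matrix_exp_def by (rule sums_unique[symmetric])
qed

text \<open>
  An element with \<open>t \<noteq> 0\<close> is conjugate, by a unipotent element of the group, to its diagonal part,
  since \<open>ad\<close> of the diagonal part is invertible on the coordinates \<open>x\<close> and \<open>\<eta>\<close>.
\<close>

lemma matrix_exp_h_alg:
  assumes "linear B" "A \<in> h_alg B"
  shows "matrix_exp A \<in> h_group B"
proof -
  obtain t x \<eta> where A: "A = an_matrix t t 0 x (B x) \<eta>"
    using assms unfolding h_alg_def by blast
  show ?thesis
  proof (cases "t = 0")
    case True
    then show ?thesis by (simp add: A matrix_exp_nilpotent unip_in_h_group)
  next
    case False
    \<comment> \<open>the diagonal part acts by \<open>ad\<close> with eigenvalue \<open>t\<close> on \<open>x\<close> and \<open>2 t\<close> on \<open>\<eta>\<close>, hence the two denominators\<close>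
    define x' where "x' = - (1 / t) *\<^sub>R x"
    define P where "P = unip x' (B x') (- \<eta> / (2 * t))"
    define Q where "Q = unip (- x') (B (- x')) (\<eta> / (2 * t))"
    have x: "x = - t *\<^sub>R x'" using False by (simp add: x'_def)
    have QP: "Q ** P = mat 1"
      by (simp add: P_def Q_def unip_mult linear_neg[OF assms(1)])
    have "A ** P = P ** an_matrix t t 0 0 0 0"
      unfolding matrix_eq matrix_vector_mul_assoc[symmetric] A P_def x
      unfolding an_vec unip_vec
      using False by (auto intro!: vec2n_eqI simp: linear_neg[OF assms(1)] linear_scale[OF assms(1)]
          field_simps inner_diff inner_add inner_commute[of "B x'" x'])
    then have "A ** (P ** Q) = P ** an_matrix t t 0 0 0 0 ** Q"
      by (simp add: matrix_mul_assoc)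
    moreover have "P ** Q = mat 1" using QP by (simp add: matrix_left_right_inverse)
    ultimately have "matrix_exp A = P ** dil (exp t) ** Q"
      using matrix_exp_conjugate[OF QP sums_exp_diagonal, of t] by simp
    then show ?thesis
      unfolding P_def Q_def using assms(1)
      by (auto intro!: h_group_mult unip_in_h_group dil_in_h_group)
  qed
qed

lemma H_sub_eq_h_group:
  assumes "linear B"
  shows "H_sub B = h_group B"
proof
  interpret group "SO2n :: 'n mat2n monoid" for dummy :: "'n::finite" by (rule group_SO2n)
  show "H_sub B \<subseteq> h_group B"
    unfolding H_sub_def using assms matrix_exp_h_alg
    by (intro group.generate_subgroup_incl[OF group_SO2n] subgroup_h_group) auto
  show "h_group B \<subseteq> H_sub B"
  proof
    fix g assume "g \<in> h_group B"
    then obtain x \<eta> r where g: "g = unip x (B x) \<eta> ** dil r" "r > 0"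
      unfolding h_group_def by blast
    have "unip x (B x) \<eta> = matrix_exp (an_matrix 0 0 0 x (B x) \<eta>)"
      by (simp add: matrix_exp_nilpotent)
    then have 1: "unip x (B x) \<eta> \<in> matrix_exp ` h_alg B"
      unfolding h_alg_def by blast
    have "dil r = matrix_exp (an_matrix (ln r) (ln r) 0 0 (B 0) 0)"
      using sums_unique[OF sums_exp_diagonal[of "ln r"]] g(2)
      by (simp add: matrix_exp_def linear_0[OF assms])
    then have 2: "dil r \<in> matrix_exp ` h_alg B"
      unfolding h_alg_def by blast
    show "g \<in> H_sub B"
      using generate.eng[OF generate.incl[OF 1] generate.incl[OF 2], of SO2n]
      by (simp add: H_sub_def g)
  qed
qed

section \<open>The action of $H_B$ on a quadric\<close>

text \<open>
  A rotation of the first two coordinates, together with the contragredient rotation of the last two.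
\<close>

definition rot :: "real \<Rightarrow> real \<Rightarrow> 'n::finite mat2n" where
  "rot c s = matrix (\<lambda>v. pt (c * v $ First - s * v $ Second) (s * v $ First + c * v $ Second) (mid v)
     (s * v $ Last + c * v $ Penult) (c * v $ Last - s * v $ Penult))"

lemma rot_vec: "rot c s *v v =
    pt (c * v $ First - s * v $ Second) (s * v $ First + c * v $ Second) (mid v)
     (s * v $ Last + c * v $ Penult) (c * v $ Last - s * v $ Penult)"
  unfolding rot_def
  by (rule matrix_vec, rule linearI; rule vec2n_eqI) (simp_all add: algebra_simps)

lemma rot_SO2n:
  assumes "c\<^sup>2 + s\<^sup>2 = 1"
  shows "(rot c s :: 'n::finite mat2n) \<in> carrier SO2n"
proof -
  obtain t where t: "c = cos t" "s = sin t"
    using sincos_total_2pi[OF assms] by metis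
  have iso: "(rot (cos a) (sin a) :: 'n mat2n) \<in> carrier O2n" for a
  proof -
    have q: "quad_form (rot c s *v v) =
        2 * (c\<^sup>2 + s\<^sup>2) * (v $ First * v $ Last + v $ Second * v $ Penult) + mid v \<bullet> mid v"
      for v :: "'n vec2n" and c s
      unfolding quad_form_mid rot_vec by (simp add: algebra_simps power2_eq_square)
    have "quad_form (rot (cos a) (sin a) *v v) = quad_form v" for v :: "'n vec2n"
      using q[of "cos a" "sin a" v] by (simp add: quad_form_mid)
    then show ?thesis by (simp add: O2n_def)
  qed
  have "rot (cos (t / 2)) (sin (t / 2)) ** rot (cos (t / 2)) (sin (t / 2)) =
      (rot (cos (t / 2 + t / 2)) (sin (t / 2 + t / 2)) :: 'n mat2n)"
    unfolding matrix_eq matrix_vector_mul_assoc[symmetric] rot_vec cos_add sin_add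
    by (auto intro!: vec2n_eqI simp: algebra_simps)
  then show ?thesis
    using isometry_square_in_SO2n[OF iso, of "t / 2"] t by simp
qed

abbreviation base_vec :: "'n::finite vec2n" where
  "base_vec \<equiv> axis Second 1 - axis Penult 1"

lemma base_vec_pt: "base_vec = pt 0 1 0 (- 1) 0"
  by (rule vec2n_eqI) (auto simp: axis_def mid_def vec_eq_iff)

lemma quad_form_base_vec: "quad_form base_vec = - 2"
  by (simp add: quad_form_mid base_vec_pt)

lemma rot_base_vec: "rot c s *v base_vec = pt (- s) c 0 (- c) s"
  by (simp add: rot_vec base_vec_pt)

text \<open>
  If \<open>c B + d\<close> has a kernel, then \<open>- d / c\<close> is a real eigenvalue of \<open>B\<close>.
\<close>

lemma pencil_nonzero:
  assumes "no_real_eigenvalue B" "(c, d) \<noteq> (0, 0)" "x \<noteq> 0"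
  shows "c *\<^sub>R B x + d *\<^sub>R x \<noteq> 0"
proof
  assume eq: "c *\<^sub>R B x + d *\<^sub>R x = 0"
  show False
  proof (cases "c = 0")
    case False
    have "B x = (1 / c) *\<^sub>R (c *\<^sub>R B x + d *\<^sub>R x) + (- d / c) *\<^sub>R x"
      using False by (simp add: algebra_simps)
    also have "\<dots> = (- d / c) *\<^sub>R x"
      by (simp add: eq)
    finally have "B x = (- d / c) *\<^sub>R x" .
    with assms show False unfolding no_real_eigenvalue_def by blast
  qed (use assms eq in auto)
qed

lemma linear_pencil: "linear B \<Longrightarrow> linear (\<lambda>x. c *\<^sub>R B x + d *\<^sub>R x)"
  by (rule linearI) (simp_all add: linear_add linear_scale algebra_simps)

lemma pencil_surj:
  fixes B :: "'v::euclidean_space \<Rightarrow> 'v"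
  assumes "linear B" "no_real_eigenvalue B" "(c, d) \<noteq> (0, 0)"
  obtains x where "c *\<^sub>R B x + d *\<^sub>R x = z"
proof -
  let ?P = "\<lambda>x. c *\<^sub>R B x + d *\<^sub>R x"
  have "linear ?P" by (rule linear_pencil[OF assms(1)])
  moreover have "inj ?P"
    using pencil_nonzero[OF assms(2,3)] linear_injective_0[OF \<open>linear ?P\<close>] by blast
  ultimately have "surj ?P" by (rule linear_injective_imp_surjective) (rule refl)
  from surjD[OF this, of z] show ?thesis using that by auto
qed

text \<open>
  By homogeneity in \<open>(c, d)\<close> and in \<open>x\<close>, the constant is a minimum over a product of two
  unit spheres.
\<close>

lemma pencil_bound:
  fixes B :: "'v::euclidean_space \<Rightarrow> 'v"
  assumes B: "linear B" "no_real_eigenvalue B"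
  obtains k where "k > 0" "\<And>c d x. k * sqrt (c\<^sup>2 + d\<^sup>2) * norm x \<le> norm (c *\<^sub>R B x + d *\<^sub>R x)"
proof -
  let ?S = "sphere (0 :: real \<times> real) 1 \<times> sphere (0 :: 'v) 1"
  let ?f = "\<lambda>p. norm (fst (fst p) *\<^sub>R B (snd p) + snd (fst p) *\<^sub>R snd p)"
  obtain u :: "real \<times> real" where "norm u = 1" by (rule vector_choose_size[OF zero_le_one])
  moreover obtain u' :: 'v where "norm u' = 1" by (rule vector_choose_size[OF zero_le_one])
  ultimately have "(u, u') \<in> ?S" by simp
  then have "?S \<noteq> {}" by blast
  moreover have "compact ?S" by (intro compact_Times) auto
  moreover have "continuous_on ?S ?f"
    using linear_continuous_on_compose[OF continuous_on_snd[OF continuous_on_id] B(1), of ?S]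
    by (intro continuous_intros) auto
  ultimately obtain p where p: "p \<in> ?S" "\<And>q. q \<in> ?S \<Longrightarrow> ?f p \<le> ?f q"
    using continuous_attains_inf[of ?S ?f] by blast
  define k where "k = ?f p"
  show ?thesis
  proof (rule that)
    show "k > 0"
    proof -
      have "snd p \<noteq> 0" "(fst (fst p), snd (fst p)) \<noteq> (0, 0)"
        using p(1) by (auto simp: zero_prod_def)
      then show ?thesis
        using pencil_nonzero[OF B(2), of "fst (fst p)" "snd (fst p)" "snd p"] by (simp add: k_def)
    qed
    fix c d x
    show "k * sqrt (c\<^sup>2 + d\<^sup>2) * norm x \<le> norm (c *\<^sub>R B x + d *\<^sub>R x)"
    proof (cases "(c, d) = (0, 0) \<or> x = 0")
      case True
      then show ?thesis by auto
    next
      case False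
      define \<sigma> where "\<sigma> = norm (c, d)"
      have \<sigma>: "\<sigma> > 0" "norm x > 0" using False by (auto simp: \<sigma>_def zero_prod_def)
      have "((1 / \<sigma>) *\<^sub>R (c, d), (1 / norm x) *\<^sub>R x) \<in> ?S"
        using \<sigma> by (simp add: mem_Times_iff \<sigma>_def del: scaleR_Pair)
      from p(2)[OF this] have "k \<le> norm ((c / \<sigma>) *\<^sub>R B ((1 / norm x) *\<^sub>R x) + (d / \<sigma>) *\<^sub>R (1 / norm x) *\<^sub>R x)"
        by (simp add: k_def)
      also have "(c / \<sigma>) *\<^sub>R B ((1 / norm x) *\<^sub>R x) + (d / \<sigma>) *\<^sub>R (1 / norm x) *\<^sub>R x =
          (1 / (\<sigma> * norm x)) *\<^sub>R (c *\<^sub>R B x + d *\<^sub>R x)"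
        by (simp add: linear_scale[OF B(1)] algebra_simps)
      also have "norm \<dots> = norm (c *\<^sub>R B x + d *\<^sub>R x) / (\<sigma> * norm x)"
        using \<sigma> by simp
      finally show ?thesis
        using \<sigma> by (simp add: field_simps \<sigma>_def norm_Pair)
    qed
  qed
qed

text \<open>
  Continuity of a matrix-valued map is inherited from its action on each vector, so that the
  explicit formulas for these actions suffice.
\<close>

lemma continuous_on_matrix:
  fixes f :: "'p::topological_space \<Rightarrow> real ^ 'i::finite ^ 'j::finite"
  assumes "\<And>v i. continuous_on S (\<lambda>p. (f p *v v) $ i)"
  shows "continuous_on S f"
proof -
  have "continuous_on S (\<lambda>p. f p $ i $ j)" for i j
    using assms[of "axis j 1" i] by (simp add: matrix_vector_mult_basis column_def)
  then have "continuous_on S (\<lambda>p. \<chi> i j. f p $ i $ j)"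
    by (intro continuous_on_vec_lambda)
  then show ?thesis by simp
qed

lemma bounded_rot: "bounded {rot c s :: 'n::finite mat2n | c s. c\<^sup>2 + s\<^sup>2 = 1}"
proof -
  let ?C = "sphere (0 :: real \<times> real) 1"
  have "continuous_on ?C (\<lambda>p. rot (fst p) (snd p) :: 'n mat2n)"
  proof (rule continuous_on_matrix)
    fix v :: "'n vec2n" and i
    show "continuous_on ?C (\<lambda>p. (rot (fst p) (snd p) *v v) $ i)"
      unfolding rot_vec by (cases i) (auto intro!: continuous_intros)
  qed
  then have "bounded ((\<lambda>p. rot (fst p) (snd p) :: 'n mat2n) ` ?C)"
    by (intro compact_imp_bounded compact_continuous_image) auto
  moreover have "{rot c s :: 'n mat2n | c s. c\<^sup>2 + s\<^sup>2 = 1} \<subseteq> (\<lambda>p. rot (fst p) (snd p)) ` ?C"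
  proof (clarify)
    fix c s :: real assume "c\<^sup>2 + s\<^sup>2 = 1"
    then have "(c, s) \<in> ?C" by (simp add: norm_Pair)
    then show "rot c s \<in> (\<lambda>p. rot (fst p) (snd p) :: 'n mat2n) ` ?C"
      by (rule rev_image_eqI) simp
  qed
  ultimately show ?thesis by (rule bounded_subset)
qed

text \<open>
  The dilation normalizes \<open>(v4, v5)\<close> to length one, then \<open>x\<close> clears the middle coordinates, and
  finally \<open>\<eta>\<close> moves \<open>(v1, v2)\<close> to the point of its line that is proportional to \<open>(v5, v4)\<close>.
\<close>

lemma h_group_orbit_meets_circle:
  assumes B: "linear B" "no_real_eigenvalue B" and v: "quad_form v = - 2"
  obtains h c s where "h \<in> h_group B" "c\<^sup>2 + s\<^sup>2 = 1" "h *v v = rot c s *v base_vec"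
proof -
  let ?\<sigma> = "sqrt ((v $ Penult)\<^sup>2 + (v $ Last)\<^sup>2)"
  have nz: "(v $ Penult)\<^sup>2 + (v $ Last)\<^sup>2 \<noteq> 0"
    using v inner_ge_zero[of "mid v"] by (auto simp: quad_form_mid simp del: inner_ge_zero)
  then have "(v $ Penult)\<^sup>2 + (v $ Last)\<^sup>2 > 0"
    by (metis add_nonneg_nonneg zero_le_power2 order_less_le)
  then have \<sigma>: "?\<sigma> > 0" by (rule real_sqrt_gt_zero)
  define c d where "c = v $ Penult / ?\<sigma>" and "d = v $ Last / ?\<sigma>"
  have cd: "c\<^sup>2 + d\<^sup>2 = 1"
    using nz \<sigma> by (simp add: c_def d_def power_divide add_divide_distrib[symmetric])
  then have "(c, d) \<noteq> (0, 0)" by auto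
  then obtain x where x: "c *\<^sub>R B x + d *\<^sub>R x = mid v"
    using pencil_surj[OF B] by metis
  define w where "w = (unip x (B x) 0 ** dil ?\<sigma>) *v v"
  have w: "w $ Penult = c" "w $ Last = d" "mid w = 0"
    using x by (simp_all add: w_def unip_vec dil_vec matrix_vector_mul_assoc[symmetric] c_def d_def)
  have h1: "unip x (B x) 0 ** dil ?\<sigma> \<in> h_group B" using \<sigma> by (intro h_groupI) auto
  have "quad_form w = - 2"
    using v h1 h_group_SO2n[of B] by (auto simp: w_def SO2n_def O2n_def)
  then have q: "w $ First * d + w $ Second * c = - 1"
    by (simp add: quad_form_mid w)
  \<comment> \<open>the component of \<open>(w1, w2)\<close> along the unit vector \<open>(c, -d)\<close>, with the opposite sign\<close>
  define \<eta> where "\<eta> = w $ Second * d - w $ First * c"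
  have e: "w $ First + \<eta> * c = - d" "w $ Second - \<eta> * d = - c"
    using q cd unfolding \<eta>_def by algebra+
  have "unip 0 0 \<eta> *v w = pt (- d) (- c) 0 c d"
    using e by (simp add: unip_vec w)
  also have "\<dots> = rot (- c) d *v base_vec" by (simp add: rot_base_vec)
  finally have "(unip 0 0 \<eta> ** (unip x (B x) 0 ** dil ?\<sigma>)) *v v = rot (- c) d *v base_vec"
    by (simp add: w_def matrix_vector_mul_assoc)
  moreover have "unip 0 0 \<eta> \<in> h_group B"
    by (rule unip_in_h_group) (simp add: linear_0[OF B(1)])
  ultimately show ?thesis
    using cd h_group_mult[OF B(1) _ h1] by (intro that) auto
qed

text \<open>
  On the quadric, \<open>v1 v5 + v2 v4 \<le> -1\<close>, so by Cauchy-Schwarz a bounded \<open>(v1, v2)\<close> keeps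
  \<open>(v4, v5)\<close> away from zero.
\<close>

lemma negative_vector_bound:
  assumes "quad_form v = - 2" "norm v \<le> R"
  shows "1 \<le> R * sqrt ((v $ Penult)\<^sup>2 + (v $ Last)\<^sup>2)"
proof -
  have R: "R \<ge> 0" using assms(2) norm_ge_zero order_trans by blast
  have "(norm v)\<^sup>2 = (v $ First)\<^sup>2 + (v $ Second)\<^sup>2 + mid v \<bullet> mid v + (v $ Penult)\<^sup>2 + (v $ Last)\<^sup>2"
    unfolding power2_norm_eq_inner inner_vec2n by (simp add: power2_eq_square)
  then have "(v $ First)\<^sup>2 + (v $ Second)\<^sup>2 \<le> (norm v)\<^sup>2"
    by simp
  also have "\<dots> \<le> R\<^sup>2" using assms(2) by (simp add: power_mono)
  finally have 1: "(v $ First)\<^sup>2 + (v $ Second)\<^sup>2 \<le> R\<^sup>2" .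
  have "1 \<le> - (v $ First * v $ Last + v $ Second * v $ Penult)"
    using assms(1) inner_ge_zero[of "mid v"] unfolding quad_form_mid mult.assoc by linarith
  then have "1 \<le> (v $ First * v $ Last + v $ Second * v $ Penult)\<^sup>2"
    by (metis one_le_power power2_minus)
  also have "\<dots> \<le> ((v $ First)\<^sup>2 + (v $ Second)\<^sup>2) * ((v $ Penult)\<^sup>2 + (v $ Last)\<^sup>2)"
    using zero_le_power2[of "v $ First * v $ Penult - v $ Second * v $ Last"]
    by (simp add: algebra_simps power2_eq_square)
  also have "\<dots> \<le> R\<^sup>2 * ((v $ Penult)\<^sup>2 + (v $ Last)\<^sup>2)"
    using 1 by (intro mult_right_mono) auto
  finally have "1 \<le> R\<^sup>2 * ((v $ Penult)\<^sup>2 + (v $ Last)\<^sup>2)" .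
  then have "sqrt 1 \<le> sqrt (R\<^sup>2 * ((v $ Penult)\<^sup>2 + (v $ Last)\<^sup>2))"
    by (rule real_sqrt_le_mono)
  then show ?thesis using R by (simp add: real_sqrt_mult)
qed

lemma vec2n_component_le:
  "\<bar>v $ i\<bar> \<le> norm v" "norm (mid v) \<le> norm v" "sqrt ((v $ Penult)\<^sup>2 + (v $ Last)\<^sup>2) \<le> norm v"
proof -
  have n: "(norm v)\<^sup>2 = (v $ First)\<^sup>2 + (v $ Second)\<^sup>2 + (norm (mid v))\<^sup>2 + ((v $ Penult)\<^sup>2 + (v $ Last)\<^sup>2)"
    unfolding power2_norm_eq_inner inner_vec2n by (simp add: power2_eq_square)
  show "\<bar>v $ i\<bar> \<le> norm v" by (rule component_le_norm_cart)
  show "norm (mid v) \<le> norm v" by (rule power2_le_imp_le) (simp_all add: n)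
  show "sqrt ((v $ Penult)\<^sup>2 + (v $ Last)\<^sup>2) \<le> norm v"
    by (rule real_le_lsqrt) (simp_all add: n)
qed

lemma bounded_h_group_parameters:
  fixes B :: "real ^ 'n \<Rightarrow> real ^ 'n::finite"
  assumes "linear B" "\<delta> > 0"
  shows "bounded {unip x (B x) \<eta> ** dil r | x \<eta> r. norm x \<le> X \<and> \<bar>\<eta>\<bar> \<le> E \<and> \<delta> \<le> r \<and> r \<le> \<rho>}"
proof -
  let ?P = "cball (0 :: real ^ 'n) X \<times> {- E..E} \<times> {\<delta>..\<rho>}"
  let ?f = "\<lambda>p. unip (fst p) (B (fst p)) (fst (snd p)) ** dil (snd (snd p))"
  have cB: "continuous_on ?P (\<lambda>p. B (fst p))"
    by (rule linear_continuous_on_compose[OF continuous_on_fst[OF continuous_on_id] assms(1)])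
  have "continuous_on ?P ?f"
  proof (rule continuous_on_matrix)
    fix v :: "'n vec2n" and i
    show "continuous_on ?P (\<lambda>p. (?f p *v v) $ i)"
      unfolding matrix_vector_mul_assoc[symmetric] unip_vec dil_vec using assms(2) cB
      by (cases i) (auto intro!: continuous_intros)
  qed
  then have "bounded (?f ` ?P)"
    by (intro compact_imp_bounded compact_continuous_image compact_Times) auto
  moreover have "{unip x (B x) \<eta> ** dil r | x \<eta> r. norm x \<le> X \<and> \<bar>\<eta>\<bar> \<le> E \<and> \<delta> \<le> r \<and> r \<le> \<rho>} \<subseteq> ?f ` ?P"
    by (force simp: abs_le_iff)
  ultimately show ?thesis by (rule bounded_subset)
qed

text \<open>
  For a point \<open>v\<close> and its image \<open>w\<close>, the quotient of the lengths of \<open>(v4, v5)\<close> and \<open>(w4, w5)\<close>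
  is \<open>r\<close>; the change of the middle coordinates is the pencil \<open>w4 B + w5\<close> at \<open>x\<close>, which bounds \<open>x\<close>; and
  then the first two coordinates bound \<open>\<eta> w4\<close> and \<open>\<eta> w5\<close>.
\<close>

lemma h_group_proper_on_quadric:
  fixes B :: "real ^ 'n \<Rightarrow> real ^ 'n::finite"
  assumes B: "linear B" "no_real_eigenvalue B"
  shows "bounded {h \<in> h_group B. \<exists>v. quad_form v = - 2 \<and> norm v \<le> R \<and> norm (h *v v) \<le> R}"
proof -
  obtain k where k: "k > 0" "\<And>c d x. k * sqrt (c\<^sup>2 + d\<^sup>2) * norm x \<le> norm (c *\<^sub>R B x + d *\<^sub>R x)"
    using pencil_bound[OF B] by blast
  obtain b where b: "b > 0" "\<And>x. norm (B x) \<le> b * norm x"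
    using linear_bounded_pos[OF B(1)] by auto
  define X where "X = 2 * R * R / k"
  \<comment> \<open>a common bound for \<open>x\<close> and \<open>B x\<close>\<close>
  define Y where "Y = X + b * X"
  define E where "E = R * (2 * (R + R * R * R + Y * R + Y * Y * R))"
  have "\<exists>x \<eta> r. h = unip x (B x) \<eta> ** dil r \<and> norm x \<le> X \<and> \<bar>\<eta>\<bar> \<le> E \<and> 1 / (R * R) \<le> r \<and> r \<le> R * R"
    if h: "h \<in> h_group B" and v: "quad_form v = - 2" "norm v \<le> R" "norm (h *v v) \<le> R" for h v
  proof -
    obtain x \<eta> r where hx: "h = unip x (B x) \<eta> ** dil r" "r > 0"
      using h unfolding h_group_def by blast
    define w where "w = h *v v"
    have w: "w $ First = r * v $ First + x \<bullet> mid v + (\<eta> - (x \<bullet> B x) / 2) * w $ Penult - (x \<bullet> x) / 2 * w $ Last"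
      "w $ Second = r * v $ Second + B x \<bullet> mid v - (B x \<bullet> B x) / 2 * w $ Penult - (\<eta> + (x \<bullet> B x) / 2) * w $ Last"
      "mid w = mid v - (w $ Penult *\<^sub>R B x + w $ Last *\<^sub>R x)"
      "w $ Penult = v $ Penult / r" "w $ Last = v $ Last / r"
      unfolding w_def hx matrix_vector_mul_assoc[symmetric] unip_vec dil_vec by simp_all
    define s t where "s = sqrt ((v $ Penult)\<^sup>2 + (v $ Last)\<^sup>2)" and "t = sqrt ((w $ Penult)\<^sup>2 + (w $ Last)\<^sup>2)"
    have "quad_form w = - 2"
      using v h h_group_SO2n[of B] by (auto simp: w_def SO2n_def O2n_def)
    have nw: "norm w \<le> R" using v(3) by (simp add: w_def)
    have bounds: "1 \<le> R * s" "1 \<le> R * t" "s \<le> R" "t \<le> R"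
      using negative_vector_bound[OF v(1,2)] negative_vector_bound[OF \<open>quad_form w = - 2\<close> nw]
        vec2n_component_le(3)[of v] vec2n_component_le(3)[of w] v(2) nw
      by (auto simp: s_def t_def)
    have "s \<ge> 0" "t \<ge> 0" by (auto simp: s_def t_def)
    then have R: "R > 0" "s > 0" "t > 0"
      using bounds(1,2) mult_nonpos_nonneg[of R s] by (cases "s = 0"; cases "t = 0"; force)+
    have "t = s / r"
      using hx(2) by (simp add: s_def t_def w power_divide add_divide_distrib[symmetric] real_sqrt_divide)
    then have r: "r = s / t" using hx(2) R by (simp add: field_simps)
    have "s * 1 \<le> R * (R * t)" by (rule mult_mono) (use bounds R in auto)
    then have r_le: "r \<le> R * R" unfolding r using R by (simp add: field_simps)
    have "t * 1 \<le> R * (R * s)" by (rule mult_mono) (use bounds R in auto)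
    then have r_ge: "1 / (R * R) \<le> r" unfolding r using R by (simp add: field_simps)
    have "k * t * norm x \<le> norm (mid v - mid w)"
      using k(2)[of "w $ Penult" "w $ Last" x] by (simp add: w(3) t_def)
    also have "\<dots> \<le> 2 * R"
      using norm_triangle_ineq4[of "mid v" "mid w"] vec2n_component_le(2)[of v] vec2n_component_le(2)[of w] v(2) nw
      by simp
    finally have "R * (k * t * norm x) \<le> R * (2 * R)" using R by simp
    moreover have "k * norm x * 1 \<le> k * norm x * (R * t)"
      using k(1) bounds(2) by (intro mult_left_mono) auto
    ultimately have "k * norm x \<le> 2 * R * R" by (simp add: algebra_simps)
    then have x: "norm x \<le> X" using k(1) by (simp add: X_def field_simps)
    then have X: "0 \<le> X" using norm_ge_zero order_trans by blast
    have Bx: "norm (B x) \<le> b * X"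
      using b(2)[of x] mult_left_mono[OF x less_imp_le[OF b(1)]] by (rule order.trans)
    have w4: "\<bar>w $ i\<bar> \<le> R" "\<bar>v $ i\<bar> \<le> R" for i
      using vec2n_component_le(1)[of w i] vec2n_component_le(1)[of v i] nw v(2) by auto
    have mv: "norm (mid v) \<le> R" using vec2n_component_le(2)[of v] v(2) by simp
    have Y: "norm x \<le> Y" "norm (B x) \<le> Y"
      using x Bx X mult_nonneg_nonneg[of b X] b(1) unfolding Y_def by linarith+
    have prod: "\<bar>p * q\<bar> \<le> P * Q" if "\<bar>p\<bar> \<le> P" "\<bar>q\<bar> \<le> Q" for p q P Q :: real
      unfolding abs_mult using that by (intro mult_mono) auto
    have inn: "\<bar>p \<bullet> q\<bar> \<le> P * Q" if "norm p \<le> P" "norm q \<le> Q" for p q :: "real ^ 'n" and P Q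
      using Cauchy_Schwarz_ineq2[of p q] mult_mono[OF that] norm_ge_zero[of p] norm_ge_zero[of q] that
      by linarith
    have r1: "\<bar>r * v $ i\<bar> \<le> R * R * R" for i
      using r_le hx(2) w4 by (intro prod) auto
    have quart: "\<bar>(p \<bullet> q) / 2 * w $ i\<bar> \<le> Y * Y * R / 2" if "norm p \<le> Y" "norm q \<le> Y"
      for p q :: "real ^ 'n" and i
      using prod[OF inn[OF that] w4(1)[of i]] by simp
    have tri: "\<bar>p1 - p2 - p3 + p4 + p5\<bar> \<le> q1 + q2 + q3 + (q4 / 2 + q4 / 2)"
      if "\<bar>p1\<bar> \<le> q1" "\<bar>p2\<bar> \<le> q2" "\<bar>p3\<bar> \<le> q3" "\<bar>p4\<bar> \<le> q4 / 2" "\<bar>p5\<bar> \<le> q4 / 2"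
      for p1 p2 p3 p4 p5 q1 q2 q3 q4 :: real
      using that unfolding abs_le_iff by linarith
    have eq1: "\<eta> * w $ Penult = w $ First - r * v $ First - x \<bullet> mid v
        + (x \<bullet> B x) / 2 * w $ Penult + (x \<bullet> x) / 2 * w $ Last"
      using w(1) by (simp add: left_diff_distrib)
    have e1: "\<bar>\<eta> * w $ Penult\<bar> \<le> R + R * R * R + Y * R + Y * Y * R"
      using tri[OF w4(1)[of First] r1[of First] inn[OF Y(1) mv] quart[OF Y(1) Y(2), of Penult]
          quart[OF Y(1) Y(1), of Last]]
      unfolding eq1[symmetric] field_sum_of_halves .
    have eq2: "- (\<eta> * w $ Last) = w $ Second - r * v $ Second - B x \<bullet> mid v
        + (B x \<bullet> B x) / 2 * w $ Penult + (x \<bullet> B x) / 2 * w $ Last"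
      using w(2) by (simp add: distrib_right)
    have e2: "\<bar>\<eta> * w $ Last\<bar> \<le> R + R * R * R + Y * R + Y * Y * R"
      using tri[OF w4(1)[of Second] r1[of Second] inn[OF Y(2) mv] quart[OF Y(2) Y(2), of Penult]
          quart[OF Y(1) Y(2), of Last]]
      unfolding eq2[symmetric] field_sum_of_halves abs_minus_cancel .
    have "\<bar>\<eta>\<bar> * t \<le> \<bar>\<eta>\<bar> * (\<bar>w $ Penult\<bar> + \<bar>w $ Last\<bar>)"
      unfolding t_def by (intro mult_left_mono sqrt_sum_squares_le_sum_abs) auto
    then have "\<bar>\<eta>\<bar> * t \<le> \<bar>\<eta> * w $ Penult\<bar> + \<bar>\<eta> * w $ Last\<bar>"
      by (simp only: abs_mult distrib_left)
    then have "\<bar>\<eta>\<bar> * t \<le> 2 * (R + R * R * R + Y * R + Y * Y * R)"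
      unfolding mult_2 using add_mono[OF e1 e2] by (rule order.trans)
    then have "R * (\<bar>\<eta>\<bar> * t) \<le> E"
      unfolding E_def using R by (intro mult_left_mono) auto
    moreover have "\<bar>\<eta>\<bar> * 1 \<le> \<bar>\<eta>\<bar> * (R * t)"
      using bounds(2) by (intro mult_left_mono) auto
    ultimately have "\<bar>\<eta>\<bar> \<le> E" by (simp add: algebra_simps)
    with hx x r_le r_ge show ?thesis by blast
  qed
  then have "{h \<in> h_group B. \<exists>v. quad_form v = - 2 \<and> norm v \<le> R \<and> norm (h *v v) \<le> R} \<subseteq>
      {unip x (B x) \<eta> ** dil r | x \<eta> r. norm x \<le> X \<and> \<bar>\<eta>\<bar> \<le> E \<and> 1 / (R * R) \<le> r \<and> r \<le> R * R}"
    by blast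
  moreover have "bounded \<dots>" if "R > 0"
    by (rule bounded_h_group_parameters) (use B that in auto)
  moreover have "R > 0" if "quad_form v = - 2" "norm v \<le> R" for v :: "'n vec2n"
    using that zero_less_norm_iff[of v] by (cases "v = 0") (simp add: quad_form_mid, linarith)
  ultimately show ?thesis
    by (cases "R > 0") (blast intro: bounded_subset, smt (verit) bounded_empty empty_Collect_eq)
qed

section \<open>Lattices and compact sets of cosets\<close>

lemma subgroup_SO1n: "subgroup (carrier SO1n) (SO2n :: 'n::finite mat2n monoid)"
proof -
  interpret group "SO2n :: 'n mat2n monoid" by (rule group_SO2n)
  show ?thesis
  proof (rule subgroupI)
    fix g :: "'n mat2n"
    assume "g \<in> carrier SO1n"
    then have g: "g \<in> carrier SO2n" "g *v base_vec = base_vec" by (auto simp: SO1n_def)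
    then have "inv\<^bsub>SO2n\<^esub> g *v base_vec = (inv\<^bsub>SO2n\<^esub> g ** g) *v base_vec"
      by (simp add: matrix_vector_mul_assoc[symmetric])
    with g l_inv[of g] show "inv\<^bsub>SO2n\<^esub> g \<in> carrier SO1n"
      by (simp add: SO1n_def)
  next
    have "mat 1 \<in> carrier (SO2n :: 'n mat2n monoid)" using one_closed by simp
    then show "carrier SO1n \<noteq> ({} :: 'n mat2n set)" by (auto simp: SO1n_def intro!: exI[of _ "mat 1"])
  next
    fix g h :: "'n mat2n"
    assume "g \<in> carrier SO1n" "h \<in> carrier SO1n"
    then show "g \<otimes>\<^bsub>SO2n\<^esub> h \<in> carrier SO1n"
      using m_closed[of g h] by (auto simp: SO1n_def matrix_vector_mul_assoc[symmetric])
  qed (auto simp: SO1n_def)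
qed

lemma SO1n_restrict: "SO1n = SO2n\<lparr>carrier := carrier SO1n\<rparr>"
  by (simp add: SO1n_def)

lemma group_SO1n: "group (SO1n :: 'n::finite mat2n monoid)"
  using subgroup.subgroup_is_group[OF subgroup_SO1n group_SO2n] SO1n_restrict by metis

lemma subgroup_SO1n_imp_SO2n: "subgroup \<Gamma> SO1n \<Longrightarrow> subgroup \<Gamma> SO2n"
  using group.incl_subgroup[OF group_SO2n subgroup_SO1n, of \<Gamma>] SO1n_restrict by metis

lemma matrix_mult_norm_bound:
  obtains K where "K > 0" "\<And>(A :: real ^ 'i ^ 'i::finite) (B :: real ^ 'i ^ 'i). norm (A ** B) \<le> K * norm A * norm B"
proof -
  have "bilinear ((**) :: real ^ 'i ^ 'i \<Rightarrow> real ^ 'i ^ 'i \<Rightarrow> _)"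
    unfolding bilinear_def
    by (auto intro!: linearI simp: matrix_eq matrix_vector_mult_add_rdistrib
        matrix_vector_right_distrib matrix_vector_mul_assoc[symmetric]
        scaleR_matrix_vector_assoc[symmetric] matrix_vector_mult_scaleR)
  from bilinear_bounded_pos[OF this] show ?thesis using that by blast
qed

lemma linear_matrix_vector_left: "linear (\<lambda>A :: real ^ 'i ^ 'j. A *v v)"
  by (rule linearI) (simp_all add: matrix_vector_mult_add_rdistrib scaleR_matrix_vector_assoc[symmetric])

lemma linear_matrix_mult_left: "linear (\<lambda>A :: real ^ 'i ^ 'j. A ** (M :: real ^ 'k ^ 'i))"
  by (auto intro!: linearI simp: matrix_eq matrix_vector_mult_add_rdistrib
        matrix_vector_mul_assoc[symmetric] scaleR_matrix_vector_assoc[symmetric])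

lemma closed_SO2n: "closed (carrier (SO2n :: 'n::finite mat2n monoid))"
proof -
  have c: "continuous_on UNIV (\<lambda>g. g *v v)" for v :: "'n vec2n"
    by (intro linear_continuous_on linear_conv_bounded_linear[THEN iffD1] linear_matrix_vector_left)
  have "continuous_on UNIV (\<lambda>g. gram *v (g *v v))" for v :: "'n vec2n"
    by (rule linear_continuous_on_compose[OF c]) simp
  then have "closed {g. quad_form (g *v v) = quad_form v}" for v :: "'n vec2n"
    unfolding quad_form_gram by (intro closed_Collect_eq continuous_intros c) auto
  then have "closed {g :: 'n mat2n. \<forall>v. quad_form (g *v v) = quad_form v}"
    by (rule closed_Collect_all)
  moreover have "closed {g :: 'n mat2n. det g = 1}"
    unfolding det_def by (intro closed_Collect_eq continuous_intros)
  ultimately have "closed ({g. \<forall>v. quad_form (g *v v) = quad_form v} \<inter> {g :: 'n mat2n. det g = 1})"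
    by (rule closed_Int)
  moreover have "carrier SO2n = {g. \<forall>v. quad_form (g *v v) = quad_form v} \<inter> {g :: 'n mat2n. det g = 1}"
    by (auto simp: SO2n_def O2n_def)
  ultimately show ?thesis by simp
qed

lemma SO2n_inverse:
  assumes "g \<in> carrier SO2n"
  shows "inv\<^bsub>SO2n\<^esub> g \<in> carrier SO2n" "inv\<^bsub>SO2n\<^esub> g ** g = mat 1" "g ** inv\<^bsub>SO2n\<^esub> g = mat 1"
    "inv\<^bsub>SO2n\<^esub> g = gram ** transpose g ** gram"
proof -
  interpret group "SO2n :: 'a mat2n monoid" by (rule group_SO2n)
  show 1: "inv\<^bsub>SO2n\<^esub> g \<in> carrier SO2n" "inv\<^bsub>SO2n\<^esub> g ** g = mat 1" and 2: "g ** inv\<^bsub>SO2n\<^esub> g = mat 1"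
    using assms l_inv[of g] r_inv[of g] by simp_all
  have "(gram ** transpose g ** gram) ** g = mat 1"
    using assms by (intro isometry_left_inverse) (simp add: SO2n_def)
  then have "(gram ** transpose g ** gram) ** (g ** inv\<^bsub>SO2n\<^esub> g) = inv\<^bsub>SO2n\<^esub> g"
    by (simp add: matrix_mul_assoc)
  then show "inv\<^bsub>SO2n\<^esub> g = gram ** transpose g ** gram"
    by (simp add: 2)
qed

lemma SO2n_inverse_bound:
  obtains b where "b > 0" "\<And>g :: 'n::finite mat2n. g \<in> carrier SO2n \<Longrightarrow> norm (inv\<^bsub>SO2n\<^esub> g) \<le> b * norm g"
proof -
  have "linear (\<lambda>g. gram ** transpose g ** (gram :: 'n mat2n))"
    by (rule linearI)
      (simp_all add: transpose_def vec_eq_iff matrix_matrix_mult_def algebra_simps sum.distrib sum_distrib_left)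
  from linear_bounded_pos[OF this] obtain b where
    b: "b > 0" "\<And>g :: 'n mat2n. norm (gram ** transpose g ** (gram :: 'n mat2n)) \<le> b * norm g" by blast
  show ?thesis
    by (rule that[OF b(1)]) (simp add: SO2n_inverse(4) b(2))
qed

lemma mult_SO2n: "g \<in> carrier SO2n \<Longrightarrow> h \<in> carrier SO2n \<Longrightarrow> g ** h \<in> carrier SO2n"
  using monoid.m_closed[OF group.is_monoid[OF group_SO2n], of g h] by simp

lemma left_coset_mult:
  assumes "group G" "subgroup H G" "x \<in> carrier G" "h \<in> H"
  shows "(x \<otimes>\<^bsub>G\<^esub> h) <#\<^bsub>G\<^esub> H = x <#\<^bsub>G\<^esub> H"
proof -
  interpret group G by fact
  have "h \<in> carrier G" "H \<subseteq> carrier G" using assms subgroup.subset by blast+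
  then show ?thesis
    using assms lcos_m_assoc[of H x h] coset_join3[of h H] by simp
qed

lemma topspace_left_coset_space:
  "topspace (left_coset_space G H) = (\<lambda>g. g <#\<^bsub>G\<^esub> H) ` carrier G"
  unfolding left_coset_space_def
  using quotient_imp_surjective_map[OF quotient_map_quotient_topology
      [of "top_of_set (carrier G)" "\<lambda>g. g <#\<^bsub>G\<^esub> H"]] by simp

text \<open>
  The projection to a coset space is open, so the images of the sets of group elements of norm
  less than \<open>k = 0, 1, 2, \<dots>\<close> form an increasing open cover of the coset space.
\<close>

lemma compactin_left_coset_space:
  fixes G :: "(real ^ 'i ^ 'i::finite) monoid"
  assumes "group G" and mult: "mult G = (**)" and H: "subgroup H G"
    and C: "compactin (left_coset_space G H) C"
  obtains k where "C \<subseteq> (\<lambda>g. g <#\<^bsub>G\<^esub> H) ` {g \<in> carrier G. norm g \<le> k}"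
proof -
  interpret group G by fact
  let ?\<pi> = "\<lambda>g. g <#\<^bsub>G\<^esub> H"
  define U where "U k = ?\<pi> ` {g \<in> carrier G. norm g < real k}" for k :: nat
  have HG: "H \<subseteq> carrier G" using H subgroup.subset by blast
  have "openin (left_coset_space G H) (U k)" for k
    unfolding left_coset_space_def openin_quotient_topology
  proof
    show "U k \<subseteq> ?\<pi> ` topspace (top_of_set (carrier G))" by (auto simp: U_def)
    have eq: "{x \<in> carrier G. ?\<pi> x \<in> U k} = (\<Union>h\<in>H. carrier G \<inter> {x. norm (x ** h) < k})"
    proof (intro equalityI subsetI)
      fix x assume "x \<in> {x \<in> carrier G. ?\<pi> x \<in> U k}"
      then obtain g where x: "x \<in> carrier G" and g: "g \<in> carrier G" "norm g < k" "?\<pi> x = ?\<pi> g"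
        by (auto simp: U_def)
      have "g \<otimes>\<^bsub>G\<^esub> \<one>\<^bsub>G\<^esub> \<in> ?\<pi> g"
        using H subgroup.one_closed unfolding l_coset_def by blast
      then have "g \<in> ?\<pi> x" using g by simp
      then obtain h where "h \<in> H" "g = x ** h" by (auto simp: l_coset_def mult)
      with x g show "x \<in> (\<Union>h\<in>H. carrier G \<inter> {x. norm (x ** h) < k})" by blast
    next
      fix x assume "x \<in> (\<Union>h\<in>H. carrier G \<inter> {x. norm (x ** h) < k})"
      then obtain h where x: "x \<in> carrier G" "h \<in> H" "norm (x ** h) < k" by blast
      then have "?\<pi> (x ** h) = ?\<pi> x" "x ** h \<in> carrier G"
        using left_coset_mult[OF assms(1) H, of x h] m_closed[of x h] HG by (auto simp: mult)
      with x show "x \<in> {x \<in> carrier G. ?\<pi> x \<in> U k}" by (auto simp: U_def)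
    qed
    have "openin (top_of_set (carrier G)) (carrier G \<inter> {x. norm (x ** h) < k})" for h
    proof (intro openin_open_Int open_Collect_less continuous_intros)
      show "continuous_on UNIV (\<lambda>x. x ** h)"
        by (intro linear_continuous_on linear_conv_bounded_linear[THEN iffD1] linear_matrix_mult_left)
    qed
    then have "openin (top_of_set (carrier G)) (\<Union>h\<in>H. carrier G \<inter> {x. norm (x ** h) < k})"
      by (intro openin_Union) blast
    then show "openin (top_of_set (carrier G)) {x \<in> topspace (top_of_set (carrier G)). ?\<pi> x \<in> U k}"
      unfolding topspace_euclidean_subtopology eq .
  qed
  moreover have "C \<subseteq> \<Union> (range U)"
  proof
    fix c assume "c \<in> C"
    then have "c \<in> topspace (left_coset_space G H)"
      using compactin_subset_topspace[OF C] by blast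
    then obtain g where g: "g \<in> carrier G" "c = ?\<pi> g"
      unfolding topspace_left_coset_space by blast
    obtain k :: nat where "norm g < k" using reals_Archimedean2 by blast
    with g show "c \<in> \<Union> (range U)" by (auto simp: U_def)
  qed
  ultimately obtain F where F: "finite F" "F \<subseteq> range U" "C \<subseteq> \<Union> F"
    using compactinD[OF C, of "range U"] by blast
  then obtain I where I: "finite I" "F = U ` I"
    using finite_subset_image by metis
  have "C \<subseteq> ?\<pi> ` {g \<in> carrier G. norm g \<le> real (Max (insert 0 I))}"
  proof
    fix c assume "c \<in> C"
    then obtain k g where kg: "k \<in> I" "g \<in> carrier G" "norm g < real k" "c = ?\<pi> g"
      using F I by (auto simp: U_def)
    then have "k \<le> Max (insert 0 I)" using I by (intro Max_ge) auto
    with kg show "c \<in> ?\<pi> ` {g \<in> carrier G. norm g \<le> real (Max (insert 0 I))}"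
      by (intro image_eqI) auto
  qed
  then show ?thesis by (rule that)
qed

text \<open>
  If no other element of \<open>\<Gamma>\<close> lies within \<open>e\<close> of the identity, then two elements of bounded norm
  are separated by a fixed multiple of \<open>e\<close>, because \<open>1 - inverse \<gamma> \<delta> = inverse \<gamma> (\<gamma> - \<delta>)\<close>.
\<close>

lemma discrete_subgroup_finite:
  fixes \<Gamma> :: "'n::finite mat2n set"
  assumes \<Gamma>: "subgroup \<Gamma> SO2n" "discrete \<Gamma>"
  shows "finite {\<gamma> \<in> \<Gamma>. norm \<gamma> \<le> k}"
proof (rule ccontr)
  let ?S = "{\<gamma> \<in> \<Gamma>. norm \<gamma> \<le> k}"
  assume inf: "infinite ?S"
  interpret \<Gamma>: subgroup \<Gamma> SO2n by fact
  have SO: "\<gamma> \<in> carrier SO2n" if "\<gamma> \<in> \<Gamma>" for \<gamma> using that \<Gamma>.subset by blast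
  obtain K where K: "K > 0" "\<And>(A :: 'n mat2n) (B :: 'n mat2n). norm (A ** B) \<le> K * norm A * norm B"
    using matrix_mult_norm_bound by blast
  obtain b where b: "b > 0" "\<And>g :: 'n mat2n. g \<in> carrier SO2n \<Longrightarrow> norm (inv\<^bsub>SO2n\<^esub> g) \<le> b * norm g"
    using SO2n_inverse_bound by blast
  have "(mat 1 :: 'n mat2n) \<in> \<Gamma>" using \<Gamma>.one_closed by simp
  then obtain e where e: "e > 0" "\<And>\<gamma>. \<gamma> \<in> \<Gamma> \<Longrightarrow> dist (mat 1) \<gamma> < e \<Longrightarrow> \<gamma> = mat 1"
    using \<Gamma>(2) unfolding discrete_def isolated_in_dist_Ex_iff by (metis dist_commute)
  have sep: "\<gamma> = \<delta>" if g: "\<gamma> \<in> ?S" "\<delta> \<in> ?S" and d: "dist \<delta> \<gamma> < e / (K * (b * (\<bar>k\<bar> + 1)))" for \<gamma> \<delta>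
  proof -
    let ?i = "inv\<^bsub>SO2n\<^esub> \<gamma>"
    have i: "?i \<in> \<Gamma>" "?i ** \<gamma> = mat 1" "\<gamma> ** ?i = mat 1"
      using g \<Gamma>.m_inv_closed SO2n_inverse[OF SO] by auto
    have "mat 1 - ?i ** \<delta> = ?i ** (\<gamma> - \<delta>)"
      unfolding i(2)[symmetric] by (simp add: matrix_eq matrix_vector_mult_diff_distrib matrix_vector_mult_diff_rdistrib
          matrix_vector_mul_assoc[symmetric])
    then have "dist (mat 1) (?i ** \<delta>) \<le> K * norm ?i * norm (\<gamma> - \<delta>)"
      using K(2) by (simp add: dist_norm)
    also have "\<dots> \<le> K * (b * (\<bar>k\<bar> + 1)) * norm (\<gamma> - \<delta>)"
    proof -
      have "norm ?i \<le> b * norm \<gamma>" using b(2) SO g by blast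
      also have "\<dots> \<le> b * (\<bar>k\<bar> + 1)" using b g by (intro mult_left_mono) auto
      finally show ?thesis using K by (intro mult_right_mono mult_left_mono) auto
    qed
    also have "\<dots> < e"
    proof -
      have "0 < K * (b * (\<bar>k\<bar> + 1))" using K(1) b(1) by (intro mult_pos_pos) auto
      from pos_less_divide_eq[OF this] show ?thesis
        using d by (simp only: dist_norm norm_minus_commute[of \<delta>] mult.commute)
    qed
    finally have "?i ** \<delta> = mat 1"
      using e(2) i g \<Gamma>.m_closed[of ?i \<delta>] by simp
    then have "\<gamma> ** (?i ** \<delta>) = \<gamma>" by simp
    then show ?thesis using i by (simp add: matrix_mul_assoc)
  qed
  have "bounded ?S" by (auto simp: bounded_iff)
  then obtain x where "x islimpt ?S" using bounded_infinite_imp_islimpt[OF subset_refl _ inf] by blast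
  moreover have "\<not> x islimpt ?S"
    by (rule discrete_imp_not_islimpt[of "e / (K * (b * (\<bar>k\<bar> + 1)))"]) (use e K b sep[symmetric] in auto)
  ultimately show False by simp
qed

lemma mult_bound:
  fixes K x y a b :: real
  assumes "0 < K" "0 \<le> x" "x \<le> a" "0 \<le> y" "y \<le> b"
  shows "K * x * y \<le> K * a * b"
proof -
  have "x * y \<le> a * b" using assms by (intro mult_mono) auto
  then show ?thesis using assms(1) by (simp add: mult.assoc)
qed

text \<open>
  If \<open>\<gamma> g1 = g2 h\<close> and \<open>\<gamma>\<close> fixes the base vector, then \<open>h\<close> moves one bounded point of the quadric
  to another.
\<close>

lemma lattice_acts_properly:
  fixes B :: "real ^ 'n \<Rightarrow> real ^ 'n::finite"
  assumes B: "linear B" "no_real_eigenvalue B" and \<Gamma>: "cocompact_lattice SO1n \<Gamma>"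
  shows "acts_properly \<Gamma> (\<lambda>\<gamma> c. \<gamma> <#\<^bsub>SO2n\<^esub> c) (left_coset_space SO2n (h_group B))"
  unfolding acts_properly_def
proof (intro allI impI)
  fix C assume C: "compactin (left_coset_space SO2n (h_group B)) C"
  have sub: "subgroup \<Gamma> SO1n" "discrete \<Gamma>" "subgroup \<Gamma> SO2n"
    using \<Gamma> subgroup_SO1n_imp_SO2n by (auto simp: cocompact_lattice_def)
  obtain k where k: "C \<subseteq> (\<lambda>g. g <#\<^bsub>SO2n\<^esub> h_group B) ` {g \<in> carrier SO2n. norm g \<le> k}"
    using compactin_left_coset_space[OF group_SO2n _ subgroup_h_group[OF B(1)] C] by auto
  obtain K where K: "K > 0" "\<And>(A :: 'n mat2n) (B :: 'n mat2n). norm (A ** B) \<le> K * norm A * norm B"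
    using matrix_mult_norm_bound by blast
  obtain b where b: "b > 0" "\<And>g :: 'n mat2n. g \<in> carrier SO2n \<Longrightarrow> norm (inv\<^bsub>SO2n\<^esub> g) \<le> b * norm g"
    using SO2n_inverse_bound by blast
  obtain a where a: "a > 0" "\<And>A :: 'n mat2n. norm (A *v base_vec) \<le> a * norm A"
    using linear_bounded_pos[OF linear_matrix_vector_left] by blast
  define R where "R = a * (b * k)"
  obtain M where M: "\<And>h v. h \<in> h_group B \<Longrightarrow> quad_form v = - 2 \<Longrightarrow> norm v \<le> R \<Longrightarrow> norm (h *v v) \<le> R \<Longrightarrow> norm h \<le> M"
    using h_group_proper_on_quadric[OF B, of R] unfolding bounded_iff by blast
  have "norm \<gamma> \<le> K * (K * k * M) * (b * k)" if \<gamma>: "\<gamma> \<in> \<Gamma>" "(\<lambda>c. \<gamma> <#\<^bsub>SO2n\<^esub> c) ` C \<inter> C \<noteq> {}" for \<gamma>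
  proof -
    have \<gamma>': "\<gamma> \<in> carrier SO2n" "\<gamma> *v base_vec = base_vec"
      using \<gamma>(1) subgroup.subset[OF sub(1)] by (auto simp: SO1n_def)
    obtain c where "c \<in> C" "\<gamma> <#\<^bsub>SO2n\<^esub> c \<in> C" using \<gamma>(2) by auto
    then obtain g1 g2 where g: "g1 \<in> carrier SO2n" "norm g1 \<le> k" "g2 \<in> carrier SO2n" "norm g2 \<le> k"
      and eq: "\<gamma> <#\<^bsub>SO2n\<^esub> (g1 <#\<^bsub>SO2n\<^esub> h_group B) = g2 <#\<^bsub>SO2n\<^esub> h_group B"
      using k by (smt (verit) imageE mem_Collect_eq subsetD)
    \<comment> \<open>turn the equality of cosets into an equation between group elements\<close>
    have "mat 1 \<in> h_group B" using dil_in_h_group[OF B(1), of 1] by simp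
    then have "\<gamma> ** (g1 ** mat 1) \<in> \<gamma> <#\<^bsub>SO2n\<^esub> (g1 <#\<^bsub>SO2n\<^esub> h_group B)"
      unfolding l_coset_def SO2n_simps by blast
    then obtain h where h: "h \<in> h_group B" "\<gamma> ** g1 = g2 ** h"
      unfolding eq by (auto simp: l_coset_def)
    let ?i1 = "inv\<^bsub>SO2n\<^esub> g1" and ?i2 = "inv\<^bsub>SO2n\<^esub> g2"
    note i1 = SO2n_inverse[OF g(1)] and i2 = SO2n_inverse[OF g(3)]
    have iw: "norm (inv\<^bsub>SO2n\<^esub> g *v base_vec) \<le> R" if "g \<in> carrier SO2n" "norm g \<le> k" for g :: "'n mat2n"
    proof -
      have "norm (inv\<^bsub>SO2n\<^esub> g) \<le> b * k"
        by (rule order.trans[OF b(2)[OF that(1)] mult_left_mono[OF that(2) less_imp_le[OF b(1)]]])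
      then show ?thesis
        unfolding R_def
        by (rule order.trans[OF a(2) mult_left_mono[OF _ less_imp_le[OF a(1)]]])
    qed
    have "h ** ?i1 = ?i2 ** (g2 ** h) ** ?i1" by (simp add: matrix_mul_assoc i2(2))
    also have "\<dots> = ?i2 ** \<gamma> ** (g1 ** ?i1)" by (simp add: h(2)[symmetric] matrix_mul_assoc)
    finally have "h ** ?i1 = ?i2 ** \<gamma>" by (simp add: i1(3))
    then have "h *v (?i1 *v base_vec) = ?i2 *v base_vec"
      by (metis matrix_vector_mul_assoc \<gamma>'(2))
    moreover have "quad_form (?i1 *v base_vec) = - 2"
      using i1(1) by (simp add: SO2n_def O2n_def quad_form_base_vec)
    ultimately have hM: "norm h \<le> M" using M[OF h(1)] iw g by simp
    have "\<gamma> = g2 ** h ** ?i1"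
      by (simp add: h(2)[symmetric] matrix_mul_assoc[symmetric] i1(3))
    then have "norm \<gamma> \<le> K * norm (g2 ** h) * norm ?i1" using K(2) by simp
    also have "\<dots> \<le> K * (K * k * M) * (b * k)"
    proof -
      have "norm (g2 ** h) \<le> K * norm g2 * norm h" by (rule K(2))
      also have "\<dots> \<le> K * k * M"
        using K(1) g(4) hM by (intro mult_bound) auto
      finally have 1: "norm (g2 ** h) \<le> K * k * M" .
      have 2: "norm ?i1 \<le> b * k"
        by (rule order.trans[OF b(2)[OF g(1)] mult_left_mono[OF g(2) less_imp_le[OF b(1)]]])
      show ?thesis
        using 1 2 K(1) by (intro mult_bound) auto
    qed
    finally show ?thesis .
  qed
  then have "{\<gamma> \<in> \<Gamma>. (\<lambda>c. \<gamma> <#\<^bsub>SO2n\<^esub> c) ` C \<inter> C \<noteq> {}} \<subseteq> {\<gamma> \<in> \<Gamma>. norm \<gamma> \<le> K * (K * k * M) * (b * k)}"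
    by blast
  then show "finite {\<gamma> \<in> \<Gamma>. (\<lambda>c. \<gamma> <#\<^bsub>SO2n\<^esub> c) ` C \<inter> C \<noteq> {}}"
    using discrete_subgroup_finite[OF sub(3,2)] finite_subset by blast
qed

lemma double_coset_subset:
  assumes "subgroup \<Gamma> SO2n" "subgroup H SO2n" "\<gamma> \<in> \<Gamma>" "h \<in> H"
  shows "\<Gamma> <#>\<^bsub>SO2n\<^esub> ((\<gamma> ** p ** h) <#\<^bsub>SO2n\<^esub> H) \<subseteq> \<Gamma> <#>\<^bsub>SO2n\<^esub> (p <#\<^bsub>SO2n\<^esub> H)"
proof
  fix y assume "y \<in> \<Gamma> <#>\<^bsub>SO2n\<^esub> ((\<gamma> ** p ** h) <#\<^bsub>SO2n\<^esub> H)"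
  then obtain g1 h1 where "g1 \<in> \<Gamma>" "h1 \<in> H" "y = g1 ** ((\<gamma> ** p ** h) ** h1)"
    by (auto simp: set_mult_def l_coset_def)
  then have "g1 ** \<gamma> \<in> \<Gamma>" "h ** h1 \<in> H" "y = (g1 ** \<gamma>) ** (p ** (h ** h1))"
    using subgroup.m_closed[OF assms(1), of g1 \<gamma>] subgroup.m_closed[OF assms(2), of h h1] assms
    by (simp_all add: matrix_mul_assoc)
  then show "y \<in> \<Gamma> <#>\<^bsub>SO2n\<^esub> (p <#\<^bsub>SO2n\<^esub> H)"
    by (auto simp: set_mult_def l_coset_def)
qed

lemma double_coset_eq:
  assumes "subgroup \<Gamma> SO2n" "subgroup H SO2n" "\<gamma> \<in> \<Gamma>" "h \<in> H"
  shows "\<Gamma> <#>\<^bsub>SO2n\<^esub> ((\<gamma> ** p ** h) <#\<^bsub>SO2n\<^esub> H) = \<Gamma> <#>\<^bsub>SO2n\<^esub> (p <#\<^bsub>SO2n\<^esub> H)"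
proof
  show "\<Gamma> <#>\<^bsub>SO2n\<^esub> (p <#\<^bsub>SO2n\<^esub> H) \<subseteq> \<Gamma> <#>\<^bsub>SO2n\<^esub> ((\<gamma> ** p ** h) <#\<^bsub>SO2n\<^esub> H)"
  proof -
    have "\<gamma> \<in> carrier SO2n" "h \<in> carrier SO2n"
      using assms subgroup.subset by blast+
    note i = SO2n_inverse[OF this(1)] SO2n_inverse[OF this(2)]
    have "inv\<^bsub>SO2n\<^esub> \<gamma> ** (\<gamma> ** p ** h) ** inv\<^bsub>SO2n\<^esub> h = (inv\<^bsub>SO2n\<^esub> \<gamma> ** \<gamma>) ** p ** (h ** inv\<^bsub>SO2n\<^esub> h)"
      by (simp only: matrix_mul_assoc)
    also have "\<dots> = p" unfolding i(2) i(7) by simp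
    finally show ?thesis
      using double_coset_subset[OF assms(1,2), of "inv\<^bsub>SO2n\<^esub> \<gamma>" "inv\<^bsub>SO2n\<^esub> h" "\<gamma> ** p ** h"]
        subgroup.m_inv_closed[OF assms(1,3)] subgroup.m_inv_closed[OF assms(2,4)] by simp
  qed
qed (rule double_coset_subset[OF assms])

text \<open>
  Given \<open>g\<close>, an element \<open>h\<close> of $H_B$ and a rotation \<open>r\<close> satisfy
  \<open>h (inverse g w) = r w\<close> for the base vector \<open>w\<close>. So \<open>l = inverse r h (inverse g)\<close> lies in
  $\mathrm{SO}(1,n)$, which is a bounded set times \<open>\<Gamma>\<close>. Hence \<open>g\<close> is equivalent to the
  product \<open>p\<close> of the inverses of two bounded elements.
\<close>

lemma lattice_double_cosets_compact:
  fixes B :: "real ^ 'n \<Rightarrow> real ^ 'n::finite"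
  assumes B: "linear B" "no_real_eigenvalue B" and \<Gamma>: "cocompact_lattice SO1n \<Gamma>"
  shows "compact_space (double_coset_space SO2n \<Gamma> (h_group B))"
proof -
  have sub: "subgroup \<Gamma> SO1n" "subgroup \<Gamma> SO2n" and co: "compact_space (left_coset_space SO1n \<Gamma>)"
    using \<Gamma> subgroup_SO1n_imp_SO2n by (auto simp: cocompact_lattice_def)
  note subH = subgroup_h_group[OF B(1)]
  obtain k where k: "topspace (left_coset_space SO1n \<Gamma>) \<subseteq> (\<lambda>g. g <#\<^bsub>SO1n\<^esub> \<Gamma>) ` {g \<in> carrier SO1n. norm g \<le> k}"
    using compactin_left_coset_space[OF group_SO1n SO1n_simps(1) sub(1), of "topspace (left_coset_space SO1n \<Gamma>)"]
      co unfolding compact_space_def by auto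
  obtain K where K: "K > 0" "\<And>(A :: 'n mat2n) (B :: 'n mat2n). norm (A ** B) \<le> K * norm A * norm B"
    using matrix_mult_norm_bound by blast
  obtain b where b: "b > 0" "\<And>g :: 'n mat2n. g \<in> carrier SO2n \<Longrightarrow> norm (inv\<^bsub>SO2n\<^esub> g) \<le> b * norm g"
    using SO2n_inverse_bound by blast
  obtain \<rho> where \<rho>: "\<And>c s. c\<^sup>2 + s\<^sup>2 = 1 \<Longrightarrow> norm (rot c s :: 'n mat2n) \<le> \<rho>"
    using bounded_rot unfolding bounded_iff by blast
  define M where "M = K * (b * k) * (b * \<rho>)"
  let ?\<pi> = "\<lambda>g. \<Gamma> <#>\<^bsub>SO2n\<^esub> (g <#\<^bsub>SO2n\<^esub> h_group B)"
  let ?X = "double_coset_space SO2n \<Gamma> (h_group B)"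
  let ?P = "{p :: 'n mat2n. p \<in> carrier SO2n \<and> norm p \<le> M}"
  have q: "quotient_map (top_of_set (carrier SO2n)) ?X ?\<pi>"
    unfolding double_coset_space_def by (rule quotient_map_quotient_topology)
  have rep: "?\<pi> g \<in> ?\<pi> ` ?P" if g: "g \<in> carrier SO2n" for g
  proof -
    let ?g' = "inv\<^bsub>SO2n\<^esub> g"
    note g' = SO2n_inverse[OF g]
    have "quad_form (?g' *v base_vec) = - 2"
      using g'(1) by (simp add: SO2n_def O2n_def quad_form_base_vec)
    then obtain h c s where h: "h \<in> h_group B" "c\<^sup>2 + s\<^sup>2 = 1" "h *v (?g' *v base_vec) = rot c s *v base_vec"
      using h_group_orbit_meets_circle[OF B] by blast
    let ?r = "rot c s :: 'n mat2n"
    let ?h' = "inv\<^bsub>SO2n\<^esub> h" and ?r' = "inv\<^bsub>SO2n\<^esub> ?r"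
    have hSO: "h \<in> carrier SO2n" using h(1) h_group_SO2n by blast
    note h' = SO2n_inverse[OF hSO] and r' = SO2n_inverse[OF rot_SO2n[OF h(2)]]
    define l where "l = ?r' ** h ** ?g'"
    have "l \<in> carrier SO2n"
      unfolding l_def using r'(1) hSO g'(1) by (intro mult_SO2n)
    moreover have "l *v base_vec = base_vec"
    proof -
      have "l *v base_vec = ?r' *v (h *v (?g' *v base_vec))"
        by (simp only: l_def matrix_vector_mul_assoc matrix_mul_assoc)
      also have "\<dots> = (?r' ** ?r) *v base_vec"
        unfolding h(3) by (rule matrix_vector_mul_assoc)
      also have "\<dots> = base_vec" by (simp add: r'(2))
      finally show ?thesis .
    qed
    ultimately have l: "l \<in> carrier SO1n" by (simp add: SO1n_def)
    then have "l <#\<^bsub>SO1n\<^esub> \<Gamma> \<in> topspace (left_coset_space SO1n \<Gamma>)"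
      unfolding topspace_left_coset_space by blast
    then obtain d where d: "d \<in> carrier SO1n" "norm d \<le> k" "l <#\<^bsub>SO1n\<^esub> \<Gamma> = d <#\<^bsub>SO1n\<^esub> \<Gamma>"
      using k by blast
    have "l ** mat 1 \<in> l <#\<^bsub>SO1n\<^esub> \<Gamma>"
      using subgroup.one_closed[OF sub(1)] unfolding l_coset_def by (auto intro!: bexI[of _ "mat 1"])
    then obtain \<gamma> where \<gamma>: "\<gamma> \<in> \<Gamma>" "l = d ** \<gamma>"
      unfolding d(3) by (auto simp: l_coset_def)
    have \<gamma>SO: "\<gamma> \<in> carrier SO2n" using \<gamma>(1) sub(2) subgroup.subset by blast
    have dSO: "d \<in> carrier SO2n" using d(1) by (simp add: SO1n_def)
    let ?d' = "inv\<^bsub>SO2n\<^esub> d" and ?\<gamma>' = "inv\<^bsub>SO2n\<^esub> \<gamma>"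
    note \<gamma>' = SO2n_inverse[OF \<gamma>SO] and d' = SO2n_inverse[OF dSO]
    define p where "p = ?d' ** ?r'"
    have "\<gamma> ** g = ?d' ** (d ** \<gamma>) ** g"
      by (simp add: matrix_mul_assoc d'(2))
    also have "\<dots> = ?d' ** ?r' ** h ** (?g' ** g)"
      unfolding \<gamma>(2)[symmetric] l_def by (simp only: matrix_mul_assoc)
    also have "\<dots> = p ** h" by (simp add: g'(2) p_def)
    finally have "?\<gamma>' ** (\<gamma> ** g) = ?\<gamma>' ** p ** h" by (simp add: matrix_mul_assoc)
    then have "g = ?\<gamma>' ** p ** h" by (simp add: matrix_mul_assoc \<gamma>'(2))
    then have "?\<pi> g = ?\<pi> p"
      using double_coset_eq[OF sub(2) subH subgroup.m_inv_closed[OF sub(2) \<gamma>(1)] h(1)] by simp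
    moreover have "p \<in> ?P"
    proof -
      have 1: "norm ?d' \<le> b * k"
        by (rule order.trans[OF b(2)[OF dSO] mult_left_mono[OF d(2) less_imp_le[OF b(1)]]])
      have 2: "norm ?r' \<le> b * \<rho>"
        by (rule order.trans[OF b(2)[OF rot_SO2n[OF h(2)]] mult_left_mono[OF \<rho>[OF h(2)] less_imp_le[OF b(1)]]])
      have "norm p \<le> K * norm ?d' * norm ?r'" unfolding p_def by (rule K(2))
      also have "\<dots> \<le> M"
        unfolding M_def using K(1) 1 2 by (intro mult_bound) auto
      finally show ?thesis
        unfolding p_def using mult_SO2n[OF d'(1) r'(1)] by simp
    qed
    ultimately show ?thesis by blast
  qed
  have "topspace ?X = ?\<pi> ` carrier SO2n"
    using quotient_imp_surjective_map[OF q] by simp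
  also have "\<dots> = ?\<pi> ` ?P"
  proof
    show "?\<pi> ` carrier SO2n \<subseteq> ?\<pi> ` ?P" using rep by (rule image_subsetI)
  qed (rule image_mono, simp)
  finally have "topspace ?X = ?\<pi> ` ?P" .
  moreover have "compactin ?X (?\<pi> ` ?P)"
  proof (rule image_compactin[OF _ quotient_imp_continuous_map[OF q]])
    have eq: "?P = carrier SO2n \<inter> cball 0 M" by auto
    have "compact (carrier SO2n \<inter> cball (0 :: 'n mat2n) M)"
      by (intro closed_Int_compact closed_SO2n compact_cball)
    then show "compactin (top_of_set (carrier SO2n)) ?P"
      unfolding eq by (simp add: compactin_subtopology)
  qed
  ultimately show ?thesis by (simp add: compact_space_def)
qed

section \<open>Isometries normalizing or intertwining the groups $H_B$\<close>

text \<open>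
  The totally isotropic plane spanned by the first two basis vectors, and below its orthogonal
  complement.
\<close>

definition null_plane :: "'n::finite vec2n set" where
  "null_plane = {v. mid v = 0 \<and> v $ Penult = 0 \<and> v $ Last = 0}"

definition null_plane_perp :: "'n::finite vec2n set" where
  "null_plane_perp = {v. v $ Penult = 0 \<and> v $ Last = 0}"

text \<open>
  A unipotent element fixes the last two coordinates, so if these do not vanish, the eigenvalue
  is \<open>1\<close> and the change \<open>v4 B x + v5 x\<close> of the middle coordinates is zero, which excludes \<open>x \<noteq> 0\<close>. If they vanish but
  the middle part \<open>z\<close> does not, the eigenvalue is again \<open>1\<close>, while \<open>x = z\<close> changes the first coordinate.
\<close>

lemma common_eigenvectors:
  fixes B :: "real ^ 'n \<Rightarrow> real ^ 'n::finite"
  assumes "linear B" "no_real_eigenvalue B"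
  shows "(\<forall>h \<in> h_group B. \<exists>c. h *v v = c *\<^sub>R v) \<longleftrightarrow> v \<in> null_plane"
proof
  assume ev: "\<forall>h \<in> h_group B. \<exists>c. h *v v = c *\<^sub>R v"
  have step: "\<exists>c. x \<bullet> mid v - (x \<bullet> B x) / 2 * v $ Penult - (x \<bullet> x) / 2 * v $ Last = (c - 1) * v $ First
     \<and> - (v $ Penult *\<^sub>R B x + v $ Last *\<^sub>R x) = (c - 1) *\<^sub>R mid v
     \<and> (c - 1) * v $ Penult = 0 \<and> (c - 1) * v $ Last = 0" for x
  proof -
    obtain c where c: "unip x (B x) 0 *v v = c *\<^sub>R v"
      using ev unip_in_h_group[of "B x" B x 0] by blast
    show ?thesis
      using arg_cong[OF c, of "\<lambda>u. u $ First"] arg_cong[OF c, of mid]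
        arg_cong[OF c, of "\<lambda>u. u $ Penult"] arg_cong[OF c, of "\<lambda>u. u $ Last"]
      by (intro exI[of _ c]) (simp add: unip_vec algebra_simps)
  qed
  have 1: "v $ Penult = 0 \<and> v $ Last = 0"
  proof (rule ccontr)
    assume n: "\<not> (v $ Penult = 0 \<and> v $ Last = 0)"
    define x :: "real ^ 'n" where "x = axis undefined 1"
    have "x \<noteq> 0" by (simp add: x_def axis_eq_0_iff)
    moreover have "v $ Penult *\<^sub>R B x + v $ Last *\<^sub>R x = 0"
    proof -
      obtain c where c: "- (v $ Penult *\<^sub>R B x + v $ Last *\<^sub>R x) = (c - 1) *\<^sub>R mid v"
        "(c - 1) * v $ Penult = 0" "(c - 1) * v $ Last = 0"
        using step[of x] by blast
      then have "c - 1 = 0" using n by auto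
      with c(1) show ?thesis by (simp only: scaleR_zero_left neg_equal_0_iff_equal)
    qed
    ultimately show False
      using pencil_nonzero[OF assms(2), of "v $ Penult" "v $ Last" x] n by auto
  qed
  have "mid v = 0"
    using step[of "mid v"] 1 by auto
  with 1 show "v \<in> null_plane" by (simp add: null_plane_def)
next
  assume v: "v \<in> null_plane"
  show "\<forall>h \<in> h_group B. \<exists>c. h *v v = c *\<^sub>R v"
  proof
    fix h assume "h \<in> h_group B"
    then obtain x \<eta> r where "h = unip x (B x) \<eta> ** dil r" unfolding h_group_def by blast
    then have "h *v v = r *\<^sub>R v"
      using v by (auto intro!: vec2n_eqI simp: null_plane_def matrix_vector_mul_assoc[symmetric] unip_vec dil_vec)
    then show "\<exists>c. h *v v = c *\<^sub>R v" by blast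
  qed
qed

lemma intertwiner_null_plane:
  assumes B: "linear B" "no_real_eigenvalue B" "linear B'" "no_real_eigenvalue B'"
    and g: "\<And>h'. h' \<in> h_group B' \<Longrightarrow> \<exists>h \<in> h_group B. g ** h = h' ** g"
    and v: "v \<in> null_plane"
  shows "g *v v \<in> null_plane"
proof -
  have "\<exists>c. h' *v (g *v v) = c *\<^sub>R (g *v v)" if "h' \<in> h_group B'" for h'
  proof -
    obtain h where h: "h \<in> h_group B" "g ** h = h' ** g" using g \<open>h' \<in> h_group B'\<close> by blast
    obtain c where "h *v v = c *\<^sub>R v" using common_eigenvectors[OF B(1,2)] v h(1) by blast
    then have "h' *v (g *v v) = c *\<^sub>R (g *v v)"
      by (simp add: matrix_vector_mul_assoc h(2)[symmetric])
        (simp add: matrix_vector_mul_assoc[symmetric] matrix_vector_mult_scaleR)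
    then show ?thesis by blast
  qed
  then show ?thesis using common_eigenvectors[OF B(3,4)] by blast
qed

text \<open>
  The inverse of \<open>g\<close> intertwines the two groups in the other direction, so it preserves the null plane;
  an isometry preserves orthogonality.
\<close>

lemma intertwiner_null_plane_perp:
  assumes B: "linear B" "no_real_eigenvalue B" "linear B'" "no_real_eigenvalue B'"
    and g: "g \<in> carrier O2n" "k ** g = mat 1"
      "\<And>h. h \<in> h_group B \<Longrightarrow> \<exists>h' \<in> h_group B'. g ** h = h' ** g"
    and v: "v \<in> null_plane_perp"
  shows "g *v v \<in> null_plane_perp"
proof -
  have gk: "g ** k = mat 1" using g(2) by (simp add: matrix_left_right_inverse)
  have k: "\<exists>h' \<in> h_group B'. k ** h' = h ** k" if h: "h \<in> h_group B" for h
  proof -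
    obtain h' where h': "h' \<in> h_group B'" "g ** h = h' ** g" using g(3)[OF h] by blast
    have "k ** h' = k ** (h' ** g) ** k" by (simp add: matrix_mul_assoc[symmetric] gk)
    also have "\<dots> = (k ** g) ** h ** k" by (simp only: h'(2)[symmetric] matrix_mul_assoc)
    also have "\<dots> = h ** k" by (simp add: g(2))
    finally show ?thesis using h'(1) by blast
  qed
  have "(g *v v) \<bullet> (gram *v w) = 0" if "w \<in> null_plane" for w
  proof -
    have "k *v w \<in> null_plane"
      by (rule intertwiner_null_plane[OF B(3,4) B(1,2) _ that]) (use k in blast)
    then have "v \<bullet> (gram *v (k *v w)) = 0"
      using v by (simp add: inner_vec2n gram_vec null_plane_def null_plane_perp_def)
    then have "(g *v v) \<bullet> (gram *v (g *v (k *v w))) = 0"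
      by (simp add: isometry_gram[OF g(1)])
    moreover have "g *v (k *v w) = w" by (simp add: matrix_vector_mul_assoc gk)
    ultimately show ?thesis by simp
  qed
  from this[of "pt 1 0 0 0 0"] this[of "pt 0 1 0 0 0"] show ?thesis
    by (simp add: null_plane_def null_plane_perp_def inner_vec2n gram_vec)
qed

text \<open>
  For a matrix that preserves the null plane and its orthogonal complement, this is the map that it
  induces on their quotient.
\<close>

definition mid_part :: "'n::finite mat2n \<Rightarrow> real ^ 'n \<Rightarrow> real ^ 'n" where
  "mid_part g z = mid (g *v pt 0 0 z 0 0)"

lemma pt_add: "pt a b z c d + pt a' b' z' c' d' = pt (a + a') (b + b') (z + z') (c + c') (d + d')"
  by (rule vec2n_eqI) auto

lemma pt_scaleR: "r *\<^sub>R pt a b z c d = pt (r * a) (r * b) (r *\<^sub>R z) (r * c) (r * d)"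
  by (rule vec2n_eqI) auto

lemma linear_mid_part: "linear (mid_part g)"
proof (rule linearI)
  fix z z' :: "real ^ 'a" and r :: real
  have "pt 0 0 (z + z') 0 0 = pt 0 0 z 0 0 + pt 0 0 z' 0 0" by (simp add: pt_add)
  then show "mid_part g (z + z') = mid_part g z + mid_part g z'"
    by (simp add: mid_part_def matrix_vector_right_distrib)
  have "pt 0 0 (r *\<^sub>R z) 0 0 = r *\<^sub>R pt 0 0 z 0 0" by (simp add: pt_scaleR)
  then show "mid_part g (r *\<^sub>R z) = r *\<^sub>R mid_part g z"
    by (simp add: mid_part_def matrix_vector_mult_scaleR)
qed

lemma mid_part_null_plane_perp:
  assumes "\<And>v. v \<in> null_plane \<Longrightarrow> g *v v \<in> null_plane" "v \<in> null_plane_perp"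
  shows "mid (g *v v) = mid_part g (mid v)"
proof -
  have "v = pt (v $ First) (v $ Second) 0 0 0 + pt 0 0 (mid v) 0 0"
    using assms(2) by (auto intro!: vec2n_eqI simp: null_plane_perp_def)
  then have "g *v v = g *v pt (v $ First) (v $ Second) 0 0 0 + g *v pt 0 0 (mid v) 0 0"
    by (metis matrix_vector_right_distrib)
  moreover have "g *v pt (v $ First) (v $ Second) 0 0 0 \<in> null_plane"
    by (rule assms(1)) (simp add: null_plane_def)
  ultimately show ?thesis by (simp add: mid_part_def null_plane_def)
qed

lemma mid_part_orthogonal:
  assumes "g \<in> carrier O2n" "\<And>v. v \<in> null_plane_perp \<Longrightarrow> g *v v \<in> null_plane_perp"
  shows "orthogonal_transformation (mid_part g)"
  unfolding orthogonal_transformation_def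
proof (intro conjI allI linear_mid_part)
  fix u z
  have "g *v pt 0 0 u 0 0 \<in> null_plane_perp" "g *v pt 0 0 z 0 0 \<in> null_plane_perp"
    by (rule assms(2); simp add: null_plane_perp_def)+
  then show "mid_part g u \<bullet> mid_part g z = u \<bullet> z"
    using isometry_gram[OF assms(1), of "pt 0 0 u 0 0" "pt 0 0 z 0 0"]
    by (simp add: mid_part_def inner_vec2n gram_vec null_plane_perp_def)
qed

text \<open>
  Both sides are compared on the orthogonal complement of the null plane, where \<open>unip x y \<eta>\<close> adds
  \<open>(x \<bullet> z, y \<bullet> z)\<close> to the first two coordinates. With the \<open>2\<close> by \<open>2\<close> matrix with columns \<open>u1\<close> and
  \<open>u2\<close> for the action of \<open>g\<close> on the null plane, this reads
  \<open>(x \<bullet> z) u1 + (y \<bullet> z) u2 = (x' \<bullet> R z, y' \<bullet> R z)\<close>.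
\<close>

lemma intertwine_unip:
  fixes g :: "'n::finite mat2n"
  assumes g: "g \<in> carrier O2n" "\<And>v. v \<in> null_plane \<Longrightarrow> g *v v \<in> null_plane" "\<And>v. v \<in> null_plane_perp \<Longrightarrow> g *v v \<in> null_plane_perp"
    and eq: "g ** unip x y \<eta> = (unip x' y' \<eta>' ** dil r) ** g"
  defines "u1 \<equiv> g *v pt 1 0 0 0 0" and "u2 \<equiv> g *v pt 0 1 0 0 0"
  shows "x' = mid_part g (u1 $ First *\<^sub>R x + u2 $ First *\<^sub>R y)"
    "y' = mid_part g (u1 $ Second *\<^sub>R x + u2 $ Second *\<^sub>R y)"
proof -
  let ?R = "mid_part g"
  have R: "orthogonal_transformation ?R" by (rule mid_part_orthogonal[OF g(1,3)])
  have ev: "g *v (unip x y \<eta> *v v) = unip x' y' \<eta>' *v (dil r *v (g *v v))" for v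
    using arg_cong[OF eq, of "\<lambda>A. A *v v"] by (simp add: matrix_vector_mul_assoc matrix_mul_assoc)
  have u: "u1 \<in> null_plane" "u2 \<in> null_plane"
    unfolding u1_def u2_def by (rule g(2); simp add: null_plane_def)+
  have "u1 \<noteq> 0"
  proof
    assume "u1 = 0"
    then have "(gram ** transpose g ** gram) *v (g *v pt 1 0 0 0 0) = 0"
      by (simp add: u1_def)
    then have "(pt 1 0 0 0 0 :: 'n vec2n) = 0"
      unfolding matrix_vector_mul_assoc isometry_left_inverse[OF g(1)] by simp
    then show False by (metis pt_simps(1) zero_index zero_neq_one)
  qed
  have "unip x y \<eta> *v pt 1 0 0 0 0 = pt 1 0 0 0 0" by (simp add: unip_vec)
  then have "u1 = unip x' y' \<eta>' *v (dil r *v u1)"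
    using ev[of "pt 1 0 0 0 0"] by (simp add: u1_def)
  also have "\<dots> = r *\<^sub>R u1"
    using u(1) by (auto simp: unip_vec dil_vec null_plane_def intro!: vec2n_eqI)
  finally have r: "r = 1" using \<open>u1 \<noteq> 0\<close> by (metis scaleR_cancel_right scaleR_one)
  have key: "(x \<bullet> z) *\<^sub>R u1 + (y \<bullet> z) *\<^sub>R u2 = pt (x' \<bullet> ?R z) (y' \<bullet> ?R z) 0 0 0" for z
  proof -
    let ?p = "pt 0 0 z 0 0 :: 'n vec2n"
    have p: "g *v ?p \<in> null_plane_perp" by (rule g(3)) (simp add: null_plane_perp_def)
    have "unip x y \<eta> *v ?p = ?p + ((x \<bullet> z) *\<^sub>R pt 1 0 0 0 0 + (y \<bullet> z) *\<^sub>R pt 0 1 0 0 0)"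
      by (simp add: unip_vec pt_add pt_scaleR)
    then have "g *v (unip x y \<eta> *v ?p) = g *v ?p + ((x \<bullet> z) *\<^sub>R u1 + (y \<bullet> z) *\<^sub>R u2)"
      by (simp add: matrix_vector_right_distrib matrix_vector_mult_scaleR u1_def u2_def)
    moreover have "unip x' y' \<eta>' *v (dil r *v (g *v ?p)) = g *v ?p + pt (x' \<bullet> ?R z) (y' \<bullet> ?R z) 0 0 0"
      using p unfolding r by (auto simp: unip_vec null_plane_perp_def mid_part_def intro!: vec2n_eqI)
    ultimately show ?thesis using ev[of ?p] by simp
  qed
  have proj: "w = ?R q" if "\<And>z. q \<bullet> z = w \<bullet> ?R z" for w q
  proof -
    have "(w - ?R q) \<bullet> ?R z = 0" for z
      using that[of z] R by (simp add: inner_diff orthogonal_transformation_def)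
    moreover obtain z where "w - ?R q = ?R z"
      using orthogonal_transformation_surj[OF R] by (metis surjD)
    ultimately have "(w - ?R q) \<bullet> (w - ?R q) = 0" by metis
    then show ?thesis by simp
  qed
  show "x' = ?R (u1 $ First *\<^sub>R x + u2 $ First *\<^sub>R y)"
    by (rule proj) (use arg_cong[OF key, of "\<lambda>v. v $ First"] in \<open>simp add: inner_add algebra_simps\<close>)
  show "y' = ?R (u1 $ Second *\<^sub>R x + u2 $ Second *\<^sub>R y)"
    by (rule proj) (use arg_cong[OF key, of "\<lambda>v. v $ Second"] in \<open>simp add: inner_add algebra_simps\<close>)
qed

section \<open>Uncountably many conjugacy classes\<close>

lemma square_minus_one_no_eigenvalue:
  assumes "linear B" "\<And>x. B (B x) = - x"
  shows "no_real_eigenvalue B"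
  unfolding no_real_eigenvalue_def
proof clarify
  fix c v assume "v \<noteq> 0" "B v = c *\<^sub>R v"
  then have "(c * c + 1) *\<^sub>R v = 0"
    using assms(2)[of v] by (simp add: linear_scale[OF assms(1)] scaleR_add_left)
  with \<open>v \<noteq> 0\<close> have "c * c + 1 = 0" by simp
  then show False using zero_le_square[of c] by linarith
qed

text \<open>
  The intertwining relation expresses \<open>B'\<close>, transported by \<open>R\<close>, as
  \<open>(\<gamma> + \<delta> B) / (\<alpha> + \<beta> B)\<close>. Since \<open>B^2 = -1\<close>, the real algebra generated by \<open>B\<close> is a copy of the complex
  numbers, so this quotient is \<open>p + q B\<close>; its square is \<open>-1\<close> only for \<open>p = 0\<close> and \<open>q = \<plusminus>1\<close>.
\<close>

lemma conjugate_complex_structures: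
  fixes B B' :: "real ^ 'n \<Rightarrow> real ^ 'n::finite"
  assumes B: "linear B" "\<And>x. B (B x) = - x" and B': "linear B'" "\<And>x. B' (B' x) = - x"
    and g: "g \<in> carrier SO2n" "conjugate_by SO2n g (h_group B) = h_group B'"
  obtains R where "orthogonal_transformation R" "\<And>x. norm (B' (R x)) = norm (B x)"
proof -
  let ?k = "inv\<^bsub>SO2n\<^esub> g"
  note k = SO2n_inverse[OF g(1)]
  have nB: "no_real_eigenvalue B" "no_real_eigenvalue B'"
    using square_minus_one_no_eigenvalue B B' by blast+
  have gO: "g \<in> carrier O2n" using g(1) by (simp add: SO2n_def)
  have conj: "g ** h = (g ** h ** ?k) ** g" for h
    by (simp add: matrix_mul_assoc[symmetric] k(2))
  have im: "h_group B' = (\<lambda>h. g ** h ** ?k) ` h_group B"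
    using g(2) by (simp add: conjugate_by_def)
  have into: "\<exists>h' \<in> h_group B'. g ** h = h' ** g" if "h \<in> h_group B" for h
    using conj[of h] that unfolding im by blast
  have onto: "\<exists>h \<in> h_group B. g ** h = h' ** g" if "h' \<in> h_group B'" for h'
    using conj that unfolding im by blast
  have pl: "g *v v \<in> null_plane" if "v \<in> null_plane" for v
    by (rule intertwiner_null_plane[OF B(1) nB(1) B'(1) nB(2) onto that])
  have cpl: "g *v v \<in> null_plane_perp" if "v \<in> null_plane_perp" for v
    by (rule intertwiner_null_plane_perp[OF B(1) nB(1) B'(1) nB(2) gO k(2) into that])
  let ?R = "mid_part g"
  have R: "orthogonal_transformation ?R" by (rule mid_part_orthogonal[OF gO cpl])
  then have lR: "linear ?R" and injR: "inj ?R"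
    using orthogonal_transformation_linear orthogonal_transformation_inj by blast+
  let ?u1 = "g *v pt 1 0 0 0 0" and ?u2 = "g *v pt 0 1 0 0 0"
  define \<alpha> \<beta> \<gamma> \<delta> where "\<alpha> = ?u1 $ First" and "\<beta> = ?u2 $ First" and "\<gamma> = ?u1 $ Second" and "\<delta> = ?u2 $ Second"
  have rel: "B' (?R (\<alpha> *\<^sub>R x + \<beta> *\<^sub>R B x)) = ?R (\<gamma> *\<^sub>R x + \<delta> *\<^sub>R B x)" for x
  proof -
    obtain h' where "h' \<in> h_group B'" "g ** unip x (B x) 0 = h' ** g"
      using into[OF unip_in_h_group[of "B x" B x 0]] by blast
    then obtain x' \<eta>' r where "g ** unip x (B x) 0 = (unip x' (B' x') \<eta>' ** dil r) ** g"
      unfolding h_group_def by blast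
    from intertwine_unip[OF gO pl cpl this] show ?thesis
      by (simp add: \<alpha>_def \<beta>_def \<gamma>_def \<delta>_def)
  qed
  obtain x0 :: "real ^ 'n" where x0: "x0 \<noteq> 0"
    using axis_eq_0_iff by (metis zero_neq_one)
  have nz: "(\<beta>, \<alpha>) \<noteq> (0, 0)"
  proof
    assume ab: "(\<beta>, \<alpha>) = (0, 0)"
    then have "?R (\<delta> *\<^sub>R B x0 + \<gamma> *\<^sub>R x0) = ?R 0"
      using rel[of x0] linear_0[OF lR] linear_0[OF B'(1)] by (simp add: add.commute)
    then have "\<delta> *\<^sub>R B x0 + \<gamma> *\<^sub>R x0 = 0" using injR by (simp add: inj_eq)
    then have "(\<delta>, \<gamma>) = (0, 0)" using pencil_nonzero[OF nB(1) _ x0] by blast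
    moreover have "?u1 \<in> null_plane" by (rule pl) (simp add: null_plane_def)
    ultimately have "?u1 = 0"
      using ab by (intro vec2n_eqI) (auto simp: null_plane_def \<alpha>_def \<gamma>_def)
    then have "?k *v ?u1 = 0" by simp
    then have "(pt 1 0 0 0 0 :: 'n vec2n) = 0"
      unfolding matrix_vector_mul_assoc k(2) by simp
    then show False by (metis pt_simps(1) zero_index zero_neq_one)
  qed
  \<comment> \<open>\<open>p + q B = (\<gamma> + \<delta> B) (\<alpha> - \<beta> B) / (\<alpha>^2 + \<beta>^2)\<close>, as for complex numbers\<close>
  define D where "D = \<alpha>\<^sup>2 + \<beta>\<^sup>2"
  have D: "D \<noteq> 0" using nz by (auto simp: D_def)
  define p q where "p = (\<gamma> * \<alpha> + \<delta> * \<beta>) / D" and "q = (\<delta> * \<alpha> - \<gamma> * \<beta>) / D"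
  have Dpq: "D * p = \<gamma> * \<alpha> + \<delta> * \<beta>" "D * q = \<delta> * \<alpha> - \<gamma> * \<beta>"
    using D by (simp_all add: p_def q_def)
  have "D *\<^sub>R B' (?R x) = D *\<^sub>R ?R (p *\<^sub>R x + q *\<^sub>R B x)" for x
  proof -
    let ?y = "\<alpha> *\<^sub>R x - \<beta> *\<^sub>R B x"
    have By: "B ?y = \<alpha> *\<^sub>R B x + \<beta> *\<^sub>R x"
      by (simp add: linear_diff[OF B(1)] linear_scale[OF B(1)] B(2))
    have "\<alpha> *\<^sub>R ?y + \<beta> *\<^sub>R B ?y = D *\<^sub>R x"
      unfolding By D_def by (simp add: algebra_simps power2_eq_square)
    then have "D *\<^sub>R B' (?R x) = B' (?R (\<alpha> *\<^sub>R ?y + \<beta> *\<^sub>R B ?y))"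
      by (simp add: linear_scale[OF B'(1)] linear_scale[OF lR])
    also have "\<dots> = ?R (\<gamma> *\<^sub>R ?y + \<delta> *\<^sub>R B ?y)" by (rule rel)
    also have "\<gamma> *\<^sub>R ?y + \<delta> *\<^sub>R B ?y = (D * p) *\<^sub>R x + (D * q) *\<^sub>R B x"
      unfolding By Dpq by (simp add: algebra_simps)
    also have "\<dots> = D *\<^sub>R (p *\<^sub>R x + q *\<^sub>R B x)" by (simp add: scaleR_add_right)
    finally show ?thesis by (simp only: linear_scale[OF lR])
  qed
  then have pq: "B' (?R x) = ?R (p *\<^sub>R x + q *\<^sub>R B x)" for x
    using D by simp
  have "?R (- x0) = ?R (p *\<^sub>R (p *\<^sub>R x0 + q *\<^sub>R B x0) + q *\<^sub>R B (p *\<^sub>R x0 + q *\<^sub>R B x0))"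
    using B'(2)[of "?R x0"] by (simp only: pq linear_neg[OF lR])
  then have "- x0 = p *\<^sub>R (p *\<^sub>R x0 + q *\<^sub>R B x0) + q *\<^sub>R B (p *\<^sub>R x0 + q *\<^sub>R B x0)"
    using injR by (simp only: inj_eq)
  moreover have "(p * q + q * p) *\<^sub>R B x0 + (p * p - q * q + 1) *\<^sub>R x0 =
      (p *\<^sub>R (p *\<^sub>R x0 + q *\<^sub>R B x0) + q *\<^sub>R B (p *\<^sub>R x0 + q *\<^sub>R B x0)) + x0"
    by (simp add: linear_add[OF B(1)] linear_scale[OF B(1)] B(2) scaleR_add_left scaleR_diff_left
        scaleR_add_right scaleR_diff_right) (simp add: scaleR_add_left[symmetric] mult.commute)
  ultimately have "(p * q + q * p) *\<^sub>R B x0 + (p * p - q * q + 1) *\<^sub>R x0 = 0"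
    by (metis add.left_inverse)
  then have "(p * q + q * p, p * p - q * q + 1) = (0, 0)"
    using pencil_nonzero[OF nB(1) _ x0] by blast
  then have pq0: "p * q = 0" "q * q = p * p + 1" by auto
  have "p = 0"
  proof (rule ccontr)
    assume "p \<noteq> 0"
    then show False using pq0 zero_le_square[of p] by simp
  qed
  then have "\<bar>q\<bar> = 1" using pq0(2) abs_square_eq_1[of q] by (simp add: power2_eq_square)
  with \<open>p = 0\<close> have "norm (B' (?R x)) = norm (B x)" for x
    using R by (simp add: pq orthogonal_transformation_norm)
  with R show ?thesis by (rule that)
qed

lemma sum_pairs: "(\<Sum>i<2 * p. f i) = (\<Sum>j<p. f (2 * j) + f (2 * j + 1 :: nat))"
  for f :: "nat \<Rightarrow> 'b::comm_monoid_add"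
  by (induction p) (simp_all add: add.assoc)

lemma orthonormal_expand:
  fixes e :: "nat \<Rightarrow> 'v::euclidean_space"
  assumes "orthonormal_basis d e"
  shows "z = (\<Sum>i<d. (z \<bullet> e i) *\<^sub>R e i)" "z \<bullet> w = (\<Sum>i<d. (z \<bullet> e i) * (w \<bullet> e i))"
proof -
  have on: "e i \<bullet> e j = (if i = j then 1 else 0)" if "i < d" "j < d" for i j
    using assms that by (simp add: orthonormal_basis_def)
  define u where "u = z - (\<Sum>i<d. (z \<bullet> e i) *\<^sub>R e i)"
  have "u \<bullet> e j = 0" if "j < d" for j
    using that by (simp add: u_def inner_diff_left inner_sum_left on if_distrib[of "(*) _"] cong: if_cong)
  then have "orthogonal u w" if "w \<in> e ` {..<d}" for w
    using that by (auto simp: orthogonal_def)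
  then have "orthogonal u u"
    using orthogonal_to_span[of u "e ` {..<d}" u] assms by (auto simp: orthonormal_basis_def)
  then show z: "z = (\<Sum>i<d. (z \<bullet> e i) *\<^sub>R e i)" by (simp add: u_def orthogonal_def)
  have "z \<bullet> w = (\<Sum>i<d. (z \<bullet> e i) *\<^sub>R e i) \<bullet> w" using z by (rule arg_cong)
  also have "\<dots> = (\<Sum>i<d. (z \<bullet> e i) * (w \<bullet> e i))"
    by (simp add: inner_sum_left inner_commute[of "e _" w])
  finally show "z \<bullet> w = (\<Sum>i<d. (z \<bullet> e i) * (w \<bullet> e i))" .
qed

lemma coordinate_basis_exists:
  assumes "CARD('n::finite) = d"
  obtains e :: "nat \<Rightarrow> real ^ 'n" where "orthonormal_basis d e"
proof -
  obtain f :: "nat \<Rightarrow> 'n" where f: "bij_betw f {..<d} UNIV"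
    using finite_same_card_bij[of "{..<d}" "UNIV :: 'n set"] assms by auto
  have "(\<lambda>i. axis (f i) (1 :: real)) ` {..<d} = (\<lambda>k. axis k 1) ` f ` {..<d}"
    by (simp only: image_image)
  also have "\<dots> = Basis"
    unfolding bij_betw_imp_surj_on[OF f] by (auto simp: Basis_vec_def)
  finally have "(\<lambda>i. axis (f i) (1 :: real)) ` {..<d} = Basis" .
  then have "orthonormal_basis d (\<lambda>i. axis (f i) (1 :: real))"
    unfolding orthonormal_basis_def using bij_betw_imp_inj_on[OF f]
    by (simp add: inner_axis_axis inj_on_eq_iff)
  then show ?thesis by (rule that)
qed

text \<open>
  In the basis \<open>e\<close>, the block diagonal operator with \<open>p\<close> blocks
  $\begin{pmatrix} 0&s\cr -1/s&0\end{pmatrix}$.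
\<close>

definition stretched_rotation :: "nat \<Rightarrow> (nat \<Rightarrow> 'v::euclidean_space) \<Rightarrow> real \<Rightarrow> 'v \<Rightarrow> 'v" where
  "stretched_rotation p e s x =
     (\<Sum>j<p. (s * (x \<bullet> e (2 * j + 1))) *\<^sub>R e (2 * j) - ((x \<bullet> e (2 * j)) / s) *\<^sub>R e (2 * j + 1))"

lemma stretched_rotation_coords:
  fixes e :: "nat \<Rightarrow> 'v::euclidean_space"
  assumes e: "orthonormal_basis (2 * p) e" and "j < p"
  shows "stretched_rotation p e s x \<bullet> e (2 * j) = s * (x \<bullet> e (2 * j + 1))"
    "stretched_rotation p e s x \<bullet> e (2 * j + 1) = - (x \<bullet> e (2 * j)) / s"
proof -
  let ?B = "stretched_rotation p e s"
  have on: "e i \<bullet> e j = (if i = j then 1 else 0)" if "i < 2 * p" "j < 2 * p" for i j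
    using e that by (simp add: orthonormal_basis_def)
  have ne: "2 * i \<noteq> 2 * j + 1" "2 * j \<noteq> 2 * i + 1" for i :: nat by presburger+
  have "?B x \<bullet> e (2 * j) = (\<Sum>i<p. if i = j then s * (x \<bullet> e (2 * j + 1)) else 0)"
    unfolding stretched_rotation_def inner_sum_left using assms(2) ne
    by (intro sum.cong) (auto simp: inner_diff_left on)
  then show "?B x \<bullet> e (2 * j) = s * (x \<bullet> e (2 * j + 1))" using assms(2) by simp
  have "?B x \<bullet> e (2 * j + 1) = (\<Sum>i<p. if i = j then - (x \<bullet> e (2 * j)) / s else 0)"
    unfolding stretched_rotation_def inner_sum_left using assms(2) ne
    by (intro sum.cong) (auto simp: inner_diff_left on)
  then show "?B x \<bullet> e (2 * j + 1) = - (x \<bullet> e (2 * j)) / s" using assms(2) by simp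
qed

lemma stretched_rotation:
  fixes e :: "nat \<Rightarrow> 'v::euclidean_space"
  assumes e: "orthonormal_basis (2 * p) e" and s: "s \<ge> 1"
  shows "linear (stretched_rotation p e s)"
    "stretched_rotation p e s (stretched_rotation p e s x) = - x"
    "norm (stretched_rotation p e s x) \<le> s * norm x"
    "p > 0 \<Longrightarrow> norm (stretched_rotation p e s (e 1)) = s"
proof -
  let ?B = "stretched_rotation p e s"
  show lin: "linear ?B"
    unfolding stretched_rotation_def
    by (rule linearI) (simp_all add: inner_add_left algebra_simps sum.distrib sum_subtractf scaleR_sum_right add_divide_distrib)
  note coords = stretched_rotation_coords[OF e]
  have "?B (?B x) = (\<Sum>j<p. - ((x \<bullet> e (2 * j)) *\<^sub>R e (2 * j) + (x \<bullet> e (2 * j + 1)) *\<^sub>R e (2 * j + 1)))"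
    unfolding stretched_rotation_def[of p e s "?B x"]
    using s by (intro sum.cong refl) (simp add: coords[simplified])
  also have "\<dots> = - (\<Sum>i<2 * p. (x \<bullet> e i) *\<^sub>R e i)"
    by (simp only: sum_pairs sum_negf)
  also have "\<dots> = - x"
    using orthonormal_expand(1)[OF e, of x] by simp
  finally show "?B (?B x) = - x" .
  have n2: "(norm (?B x))\<^sup>2 = (\<Sum>j<p. s\<^sup>2 * (x \<bullet> e (2 * j + 1))\<^sup>2 + (x \<bullet> e (2 * j))\<^sup>2 / s\<^sup>2)" for x
    unfolding power2_norm_eq_inner orthonormal_expand(2)[OF e, of "?B x" "?B x"] sum_pairs
    using s by (intro sum.cong refl) (simp add: coords[simplified] power2_eq_square)
  have "(norm (?B x))\<^sup>2 \<le> (\<Sum>j<p. s\<^sup>2 * ((x \<bullet> e (2 * j))\<^sup>2 + (x \<bullet> e (2 * j + 1))\<^sup>2))"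
    unfolding n2
  proof (intro sum_mono)
    fix j
    have s1: "1 \<le> s\<^sup>2 * s\<^sup>2" using s by (simp add: mult_ge1_I)
    have "(x \<bullet> e (2 * j))\<^sup>2 * 1 \<le> (x \<bullet> e (2 * j))\<^sup>2 * (s\<^sup>2 * s\<^sup>2)"
      using s1 by (intro mult_left_mono) auto
    then have "(x \<bullet> e (2 * j))\<^sup>2 / s\<^sup>2 \<le> s\<^sup>2 * (x \<bullet> e (2 * j))\<^sup>2"
      using s by (simp add: divide_le_eq algebra_simps)
    then show "s\<^sup>2 * (x \<bullet> e (2 * j + 1))\<^sup>2 + (x \<bullet> e (2 * j))\<^sup>2 / s\<^sup>2 \<le> s\<^sup>2 * ((x \<bullet> e (2 * j))\<^sup>2 + (x \<bullet> e (2 * j + 1))\<^sup>2)"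
      by (simp add: distrib_left)
  qed
  also have "\<dots> = (s * norm x)\<^sup>2"
    unfolding power_mult_distrib power2_norm_eq_inner orthonormal_expand(2)[OF e, of x x] sum_pairs
    by (simp add: sum_distrib_left power2_eq_square)
  finally show "norm (?B x) \<le> s * norm x"
    by (rule power2_le_imp_le) (use s in auto)
  assume "p > 0"
  have "(norm (?B (e 1)))\<^sup>2 = (\<Sum>j<p. if j = 0 then s\<^sup>2 else 0)"
    unfolding n2 using \<open>p > 0\<close> by (intro sum.cong refl) (use e in \<open>auto simp: orthonormal_basis_def\<close>)
  also have "\<dots> = s\<^sup>2" using \<open>p > 0\<close> by simp
  finally show "norm (?B (e 1)) = s" using s by (simp add: power2_eq_iff_nonneg)
qed

text \<open>
  Conjugacy forces the operator norms \<open>s\<close> and \<open>t\<close> to agree; both are attained at \<open>e 1\<close>.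
\<close>

lemma stretched_rotation_conjugate_imp_eq:
  fixes e :: "nat \<Rightarrow> real ^ 'n::finite"
  assumes e: "orthonormal_basis (2 * p) e" "p > 0" and st: "s \<ge> 1" "t \<ge> 1"
    and conj: "g \<in> carrier SO2n"
      "conjugate_by SO2n g (h_group (stretched_rotation p e s)) = h_group (stretched_rotation p e t)"
  shows "s = t"
proof -
  note S = stretched_rotation[OF e(1) st(1)] and T = stretched_rotation[OF e(1) st(2)]
  obtain R where R: "orthogonal_transformation R"
    "\<And>x. norm (stretched_rotation p e t (R x)) = norm (stretched_rotation p e s x)"
    using conjugate_complex_structures[OF S(1,2) T(1,2) conj] by blast
  have 1: "norm (e 1) = 1" using e by (simp add: orthonormal_basis_def norm_eq_1)
  have "s \<le> t"
    using R(2)[of "e 1"] S(4)[OF e(2)] T(3)[of "R (e 1)"] orthogonal_transformation_norm[OF R(1)] 1 by simp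
  moreover obtain x where x: "e 1 = R x"
    using orthogonal_transformation_surj[OF R(1)] by (metis surjD)
  then have "norm x = 1" using orthogonal_transformation_norm[OF R(1), of x] 1 by simp
  then have "t \<le> s"
    using R(2)[of x] T(4)[OF e(2)] S(3)[of x] x by simp
  ultimately show ?thesis by simp
qed

lemma uncountably_many_classes:
  assumes "CARD('n::finite) = 2 * p" "p > 0"
  shows "\<exists>\<H>. \<H> \<subseteq> {H_sub B | B :: real ^ 'n \<Rightarrow> real ^ 'n. linear B \<and> no_real_eigenvalue B} \<and>
        uncountable \<H> \<and> pairwise (\<lambda>H K. \<not> conjugate_in SO2n H K) \<H>"
proof -
  obtain e :: "nat \<Rightarrow> real ^ 'n" where e: "orthonormal_basis (2 * p) e"
    using coordinate_basis_exists[OF assms(1)] .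
  let ?B = "stretched_rotation p e"
  have eq: "s = t" if "s \<in> {1..2}" "t \<in> {1..2}" "conjugate_in SO2n (h_group (?B s)) (h_group (?B t))" for s t
    using stretched_rotation_conjugate_imp_eq[OF e assms(2)] that unfolding conjugate_in_def by fastforce
  have refl: "conjugate_in SO2n (h_group (?B s)) (h_group (?B s))" for s
  proof -
    interpret group "SO2n :: 'n mat2n monoid" by (rule group_SO2n)
    have "conjugate_by SO2n \<one>\<^bsub>SO2n\<^esub> (h_group (?B s)) = h_group (?B s)"
      unfolding conjugate_by_def inv_one by (simp add: image_def)
    then show ?thesis unfolding conjugate_in_def using one_closed by blast
  qed
  let ?H = "(\<lambda>s. h_group (?B s)) ` {1..2}"
  have "inj_on (\<lambda>s. h_group (?B s)) {1..2}"
    using eq refl by (intro inj_onI) metis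
  then have "uncountable ?H"
    using uncountable_closed_interval[of 1 "2 :: real"] countable_image_inj_on by force
  moreover have "?H \<subseteq> {H_sub B | B :: real ^ 'n \<Rightarrow> real ^ 'n. linear B \<and> no_real_eigenvalue B}"
  proof clarify
    fix s :: real assume "s \<in> {1..2}"
    then have "s \<ge> 1" by simp
    note S = stretched_rotation[OF e this]
    show "\<exists>B. h_group (?B s) = H_sub B \<and> linear B \<and> no_real_eigenvalue B"
      using S(1) square_minus_one_no_eigenvalue[OF S(1,2)] H_sub_eq_h_group[OF S(1)] by metis
  qed
  moreover have "pairwise (\<lambda>H K. \<not> conjugate_in SO2n H K) ?H"
  proof (rule pairwiseI)
    fix H K assume "H \<in> ?H" "K \<in> ?H" "H \<noteq> K"
    then obtain s t where st: "s \<in> {1..2}" "t \<in> {1..2}" "H = h_group (?B s)" "K = h_group (?B t)"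
      by blast
    show "\<not> conjugate_in SO2n H K"
    proof
      assume "conjugate_in SO2n H K"
      then have "s = t" using eq[of s t] st by simp
      with st \<open>H \<noteq> K\<close> show False by simp
    qed
  qed
  ultimately show ?thesis by blast
qed

section \<open>Complex structures and $\mathrm{SU}(1,m)$\<close>

lemma herm_form_linear:
  "herm_form (z + z') w = herm_form z w + herm_form z' w"
  "herm_form z (w + w') = herm_form z w + herm_form z w'"
  "herm_form (c *s z) w = c * herm_form z w"
  "herm_form z (c *s w) = cnj c * herm_form z w"
  by (simp_all add: herm_form_def algebra_simps sum.distrib sum_distrib_left)

text \<open>
  The difference \<open>D\<close> of the two sides is sesquilinear and vanishes on the diagonal; expanding it at
  \<open>z + w\<close> and at \<open>z + \<i> w\<close> shows that \<open>D z w\<close> is both minus and plus \<open>D w z\<close>.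
\<close>

lemma herm_form_polarization:
  assumes "\<And>z. herm_form (U *v z) (U *v z) = herm_form z z"
  shows "herm_form (U *v z) (U *v w) = herm_form z w"
proof -
  define D where "D z w = herm_form (U *v z) (U *v w) - herm_form z w" for z w
  have diag: "D z z = 0" for z by (simp add: D_def assms)
  have add: "D (z + z') w = D z w + D z' w" "D z (w + w') = D z w + D z w'" for z z' w w'
    by (simp_all add: D_def matrix_vector_right_distrib herm_form_linear)
  have scale: "D (c *s z) w = c * D z w" "D z (c *s w) = cnj c * D z w" for c z w
    by (simp_all add: D_def vector_scalar_commute herm_form_linear algebra_simps)
  have 1: "D z w + D w z = 0"
    using diag[of "z + w"] diag[of z] diag[of w] by (simp add: add add.commute)
  have "cnj \<i> * D z w + \<i> * D w z = 0"
    using diag[of "z + \<i> *s w"] diag[of z] diag[of w] by (simp add: add scale)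
  then have "\<i> * (D w z - D z w) = 0" by (simp add: algebra_simps)
  then have "D w z = D z w" by simp
  with 1 have "D z w = 0" by simp
  then show ?thesis by (simp add: D_def)
qed

lemma scaleR_as_complex: "r *\<^sub>R (z :: complex ^ 'i) = complex_of_real r *s z"
  by (simp add: vec_eq_iff scaleR_conv_of_real[where 'a=complex])

lemma complex_decompose: "c *s (z :: complex ^ 'i) = Re c *\<^sub>R z + Im c *\<^sub>R (\<i> *s z)"
proof -
  have "c * x = complex_of_real (Re c) * x + complex_of_real (Im c) * (\<i> * x)" for x
    by (simp add: complex_eq_iff)
  then show ?thesis by (simp add: scaleR_as_complex vec_eq_iff)
qed

text \<open>
  The map that a real matrix induces on complex coordinates. It is meaningful when that map is
  complex linear, that is, when the matrix commutes with the multiplication by \<open>\<i>\<close>.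
\<close>

definition complex_matrix :: "('n::finite vec2n \<Rightarrow> complex ^ 'k::finite option) \<Rightarrow> 'n mat2n \<Rightarrow> complex ^ 'k option ^ 'k option" where
  "complex_matrix \<Phi> h = matrix (\<lambda>z. \<Phi> (h *v inv_into UNIV \<Phi> z))"

lemma complex_matrix:
  fixes \<Phi> :: "'n::finite vec2n \<Rightarrow> complex ^ 'k::finite option"
  assumes \<Phi>: "hermitian_identification \<Phi>" and J: "\<And>v. \<Phi> (J *v v) = \<i> *s \<Phi> v"
    and h: "h ** J = J ** h"
  shows "\<Phi> (h *v v) = complex_matrix \<Phi> h *v \<Phi> v"
proof -
  have lin: "linear \<Phi>" and bij: "bij \<Phi>" using \<Phi> by (auto simp: hermitian_identification_def)
  have inv: "inv_into UNIV \<Phi> (\<Phi> v) = v" for v using bij by (simp add: bij_is_inj)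
  have surj: "\<exists>v. z = \<Phi> v" for z using bij by (metis bij_pointE)
  let ?T = "\<lambda>z. \<Phi> (h *v inv_into UNIV \<Phi> z)"
  have T: "?T (\<Phi> v) = \<Phi> (h *v v)" for v by (simp add: inv)
  have hJ: "h *v (J *v v) = J *v (h *v v)" for v by (simp add: matrix_vector_mul_assoc h)
  have add: "?T (z + w) = ?T z + ?T w" for z w
  proof -
    obtain u v where "z = \<Phi> u" "w = \<Phi> v" using surj by blast
    moreover have "?T (\<Phi> u + \<Phi> v) = ?T (\<Phi> (u + v))" by (simp add: linear_add[OF lin])
    ultimately show ?thesis by (simp only: T) (simp add: matrix_vector_right_distrib linear_add[OF lin])
  qed
  have scale: "?T (c *s z) = c *s ?T z" for c z
  proof -
    obtain v where z: "z = \<Phi> v" using surj by blast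
    have "c *s z = \<Phi> (Re c *\<^sub>R v + Im c *\<^sub>R (J *v v))"
      unfolding complex_decompose[of c] z by (simp add: linear_add[OF lin] linear_scale[OF lin] J)
    then have "?T (c *s z) = \<Phi> (h *v (Re c *\<^sub>R v + Im c *\<^sub>R (J *v v)))" by (simp only: T)
    also have "\<dots> = Re c *\<^sub>R \<Phi> (h *v v) + Im c *\<^sub>R \<Phi> (h *v (J *v v))"
      by (simp add: matrix_vector_right_distrib matrix_vector_mult_scaleR linear_add[OF lin] linear_scale[OF lin])
    also have "\<dots> = c *s ?T z"
      unfolding complex_decompose[of c] z T hJ J ..
    finally show ?thesis .
  qed
  have "Vector_Spaces.linear (*s) (*s) ?T"
    unfolding Vector_Spaces.linear_iff using add scale vec.vector_space_axioms by blast
  from matrix_works[OF this] show ?thesis by (simp add: complex_matrix_def inv)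
qed

lemma complex_matrix_herm:
  fixes \<Phi> :: "'n::finite vec2n \<Rightarrow> complex ^ 'k::finite option"
  assumes \<Phi>: "hermitian_identification \<Phi>" and J: "\<And>v. \<Phi> (J *v v) = \<i> *s \<Phi> v"
    and h: "h ** J = J ** h" "h \<in> carrier O2n"
  shows "herm_form (complex_matrix \<Phi> h *v z) (complex_matrix \<Phi> h *v w) = herm_form z w"
proof (rule herm_form_polarization)
  fix z
  obtain v where z: "z = \<Phi> v" using \<Phi> by (metis bij_pointE hermitian_identification_def)
  show "herm_form (complex_matrix \<Phi> h *v z) (complex_matrix \<Phi> h *v z) = herm_form z z"
    unfolding z complex_matrix[OF \<Phi> J h(1), symmetric]
    using \<Phi> h(2) by (simp add: hermitian_identification_def O2n_def)
qed

lemma commuting_mult: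
  assumes "A ** J = J ** A" "B ** J = J ** B"
  shows "(A ** B) ** J = J ** (A ** (B :: 'a::semiring_1 ^ 'i ^ 'i))"
proof -
  have "(A ** B) ** J = A ** (J ** B)" by (simp only: matrix_mul_assoc[symmetric] assms(2))
  also have "\<dots> = J ** (A ** B)" by (simp only: matrix_mul_assoc assms(1))
  finally show ?thesis .
qed

lemma complex_matrix_mult:
  fixes \<Phi> :: "'n::finite vec2n \<Rightarrow> complex ^ 'k::finite option"
  assumes \<Phi>: "hermitian_identification \<Phi>" and J: "\<And>v. \<Phi> (J *v v) = \<i> *s \<Phi> v"
    and h: "h ** J = J ** h" "h' ** J = J ** h'"
  shows "complex_matrix \<Phi> (h ** h') = complex_matrix \<Phi> h ** complex_matrix \<Phi> h'"
proof -
  have hh: "(h ** h') ** J = J ** (h ** h')" by (rule commuting_mult[OF h])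
  have "complex_matrix \<Phi> (h ** h') *v z = (complex_matrix \<Phi> h ** complex_matrix \<Phi> h') *v z" for z
  proof -
    obtain v where z: "z = \<Phi> v" using \<Phi> by (metis bij_pointE hermitian_identification_def)
    have "complex_matrix \<Phi> (h ** h') *v \<Phi> v = \<Phi> ((h ** h') *v v)"
      by (rule complex_matrix[OF \<Phi> J hh, symmetric])
    also have "\<dots> = \<Phi> (h *v (h' *v v))" by (simp add: matrix_vector_mul_assoc)
    also have "\<dots> = complex_matrix \<Phi> h *v (complex_matrix \<Phi> h' *v \<Phi> v)"
      by (simp only: complex_matrix[OF \<Phi> J h(1)] complex_matrix[OF \<Phi> J h(2)])
    finally show ?thesis by (simp add: z matrix_vector_mul_assoc)
  qed
  then show ?thesis by (simp add: matrix_eq)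
qed

lemma complex_matrix_one:
  fixes \<Phi> :: "'n::finite vec2n \<Rightarrow> complex ^ 'k::finite option"
  assumes \<Phi>: "hermitian_identification \<Phi>"
  shows "complex_matrix \<Phi> (mat 1) = mat 1"
proof -
  have "\<Phi> (inv_into UNIV \<Phi> z) = z" for z
    using \<Phi> by (simp add: hermitian_identification_def bij_is_surj surj_f_inv_f)
  then show ?thesis unfolding complex_matrix_def
    by (simp add: matrix_id_mat_1[unfolded id_def])
qed

text \<open>
  The complex structure with holomorphic coordinates \<open>v1 + \<i> v2\<close> and \<open>v5 + \<i> v4\<close>, and with \<open>K\<close> on the
  middle coordinates.
\<close>

definition flag_structure :: "(real ^ 'n \<Rightarrow> real ^ 'n) \<Rightarrow> 'n::finite mat2n" where
  "flag_structure K = matrix (\<lambda>v. pt (- v $ Second) (v $ First) (K (mid v)) (v $ Last) (- v $ Penult))"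

lemma flag_structure_vec:
  assumes "linear K"
  shows "flag_structure K *v v = pt (- v $ Second) (v $ First) (K (mid v)) (v $ Last) (- v $ Penult)"
  unfolding flag_structure_def
  by (rule matrix_vec, rule linearI; rule vec2n_eqI) (simp_all add: linear_add[OF assms] linear_scale[OF assms])

lemma flag_structure_commute:
  assumes K: "linear K" "\<And>x. K (K x) = - x" "\<And>x y. K x \<bullet> y = - (x \<bullet> K y)"
  shows "unip x (K x) \<eta> ** flag_structure K = flag_structure K ** unip x (K x) \<eta>"
    "dil r ** flag_structure K = flag_structure K ** dil r"
    "gram ** flag_structure K = flag_structure K ** gram"
proof -
  have "x \<bullet> K x = 0" using K(3)[of x x] by (simp add: inner_commute)
  moreover have "K x \<bullet> K x = x \<bullet> x" by (simp add: K(2,3))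
  moreover have "K x \<bullet> K z = x \<bullet> z" for z by (simp add: K(2,3))
  moreover have "x \<bullet> K z = - (K x \<bullet> z)" for z using K(3)[of x z] by simp
  ultimately show "unip x (K x) \<eta> ** flag_structure K = flag_structure K ** unip x (K x) \<eta>"
    unfolding matrix_eq matrix_vector_mul_assoc[symmetric] unip_vec flag_structure_vec[OF K(1)]
    by (auto intro!: vec2n_eqI simp: linear_diff[OF K(1)] linear_add[OF K(1)] linear_scale[OF K(1)] K(2) algebra_simps)
  show "dil r ** flag_structure K = flag_structure K ** dil r" "gram ** flag_structure K = flag_structure K ** gram"
    unfolding matrix_eq matrix_vector_mul_assoc[symmetric] dil_vec gram_vec flag_structure_vec[OF K(1)]
    by (auto intro!: vec2n_eqI)
qed

text \<open>
  The complex determinant is multiplicative on matrices that commute with the complex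
  structure. The matrix \<open>gram\<close> is one of them, is an involution, and conjugates a dilation to
  its inverse; so the determinant of a dilation has square \<open>1\<close>, and dilations are squares of
  dilations. The commutator of \<open>dil 2\<close> with \<open>unip x (K x) \<eta>\<close> is \<open>unip x (K x) (3 \<eta>)\<close>, which
  accounts for the unipotent elements.
\<close>

lemma h_group_subset_SU1m:
  fixes \<Phi> :: "'n::finite vec2n \<Rightarrow> complex ^ 'k::finite option"
  assumes K: "linear K" "\<And>x. K (K x) = - x" "\<And>x y. K x \<bullet> y = - (x \<bullet> K y)"
    and \<Phi>: "hermitian_identification \<Phi>" and J: "\<And>v. \<Phi> (flag_structure K *v v) = \<i> *s \<Phi> v"
  shows "h_group K \<subseteq> SU1m \<Phi>"
proof -
  let ?J = "flag_structure K"
  let ?d = "\<lambda>h. det (complex_matrix \<Phi> h)"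
  note com = flag_structure_commute[OF K]
  have mult: "?d (h ** h') = ?d h * ?d h'" if "h ** ?J = ?J ** h" "h' ** ?J = ?J ** h'" for h h'
    using complex_matrix_mult[OF \<Phi> J that] by (simp add: det_mul)
  have one: "?d (mat 1) = 1" by (simp add: complex_matrix_one[OF \<Phi>])
  have com2: "(gram ** dil r) ** ?J = ?J ** (gram ** dil r)" for r
    by (rule commuting_mult[OF com(3,2)])
  have sq: "?d (dil r) * ?d (dil r) = 1" if "r > 0" for r
  proof -
    have g: "?d gram * ?d gram = 1"
      using mult[OF com(3) com(3)] one by (simp add: gram_gram)
    have "gram ** dil r ** gram = dil (1 / r)"
      unfolding matrix_eq matrix_vector_mul_assoc[symmetric] gram_vec dil_vec
      by (auto intro!: vec2n_eqI)
    then have "?d (dil (1 / r)) = ?d (gram ** dil r) * ?d gram"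
      using mult[OF com2 com(3)] by metis
    also have "\<dots> = ?d gram * ?d gram * ?d (dil r)"
      using mult[OF com(3) com(2)] by simp
    finally have "?d (dil (1 / r)) = ?d (dil r)" by (simp add: g)
    moreover have "?d (dil r) * ?d (dil (1 / r)) = 1"
      using mult[OF com(2) com(2), of r "1 / r"] that one by (simp add: dil_mult)
    ultimately show ?thesis by simp
  qed
  have dil: "?d (dil r) = 1" if "r > 0" for r
    using sq[of "sqrt r"] mult[OF com(2) com(2), of "sqrt r" "sqrt r"] that by (simp add: dil_mult)
  have unip: "?d (unip x (K x) \<eta>) = 1" for x \<eta>
  proof -
    let ?u = "unip x (K x) (\<eta> / 3)"
    have c2: "unip (2 *\<^sub>R x) (2 *\<^sub>R K x) \<zeta> ** ?J = ?J ** unip (2 *\<^sub>R x) (2 *\<^sub>R K x) \<zeta>" for \<zeta>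
      using com(1)[of "2 *\<^sub>R x"] by (simp add: linear_scale[OF K(1)])
    have "dil 2 ** ?u = unip (2 *\<^sub>R x) (2 *\<^sub>R K x) (4 * (\<eta> / 3)) ** dil 2"
      by (simp add: dil_unip)
    then have "?d (dil 2) * ?d ?u = ?d (unip (2 *\<^sub>R x) (2 *\<^sub>R K x) (4 * (\<eta> / 3))) * ?d (dil 2)"
      using mult[OF com(2) com(1)] mult[OF c2 com(2)] by metis
    then have "?d ?u = ?d (unip (2 *\<^sub>R x) (2 *\<^sub>R K x) (4 * (\<eta> / 3)))" by (simp add: dil)
    also have "unip (2 *\<^sub>R x) (2 *\<^sub>R K x) (4 * (\<eta> / 3)) = ?u ** unip x (K x) \<eta>"
      by (simp add: unip_mult scaleR_2)
    also have "?d \<dots> = ?d ?u * ?d (unip x (K x) \<eta>)" by (rule mult[OF com(1) com(1)])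
    finally have "?d ?u = ?d ?u * ?d (unip x (K x) \<eta>)" .
    moreover have "?d ?u * ?d (unip (- x) (K (- x)) (- (\<eta> / 3))) = 1"
      using mult[OF com(1) com(1), of x "\<eta> / 3" "- x" "- (\<eta> / 3)"] one
      by (simp add: unip_mult linear_neg[OF K(1)])
    then have "?d ?u \<noteq> 0" by auto
    ultimately show ?thesis by simp
  qed
  show ?thesis
  proof
    fix h assume "h \<in> h_group K"
    then obtain x \<eta> r where h: "h = unip x (K x) \<eta> ** dil r" "r > 0"
      unfolding h_group_def by blast
    have hJ: "h ** ?J = ?J ** h" unfolding h by (rule commuting_mult[OF com(1,2)])
    have hO: "h \<in> carrier O2n"
      using h_group_SO2n[of K] \<open>h \<in> h_group K\<close> by (auto simp: SO2n_def)
    have "?d h = 1" unfolding h using mult[OF com(1) com(2)] by (simp add: unip dil h(2))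
    then show "h \<in> SU1m \<Phi>"
      unfolding SU1m_def
      using complex_matrix_herm[OF \<Phi> J hJ hO] complex_matrix[OF \<Phi> J hJ] by blast
  qed
qed

text \<open>
  Since all identifications have the same standard Hermitian space as target, comparing two of them
  takes the place of a classification of Hermitian forms. Bijectivity of \<open>\<Phi>0\<close> is part of the
  conclusion, because isometries are invertible.
\<close>

lemma identifications_differ_by_isometry:
  fixes \<Phi> \<Phi>0 :: "'n::finite vec2n \<Rightarrow> complex ^ 'k::finite option"
  assumes \<Phi>: "hermitian_identification \<Phi>"
    and \<Phi>0: "linear \<Phi>0" "\<And>v. herm_form (\<Phi>0 v) (\<Phi>0 v) = of_real (quad_form v)"
  obtains f where "f \<in> carrier O2n" "\<And>v. \<Phi> (f *v v) = \<Phi>0 v" "hermitian_identification \<Phi>0"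
proof -
  have lin: "linear \<Phi>" and bij: "bij \<Phi>" using \<Phi> by (auto simp: hermitian_identification_def)
  have "linear (inv_into UNIV \<Phi>)"
  proof (rule linearI)
    fix z w and c :: real
    show "inv_into UNIV \<Phi> (z + w) = inv_into UNIV \<Phi> z + inv_into UNIV \<Phi> w"
      by (rule inv_f_eq[OF bij_is_inj[OF bij]])
        (simp add: linear_add[OF lin] surj_f_inv_f[OF bij_is_surj[OF bij]])
    show "inv_into UNIV \<Phi> (c *\<^sub>R z) = c *\<^sub>R inv_into UNIV \<Phi> z"
      by (rule inv_f_eq[OF bij_is_inj[OF bij]])
        (simp add: linear_scale[OF lin] surj_f_inv_f[OF bij_is_surj[OF bij]])
  qed
  then have "linear (\<lambda>v. inv_into UNIV \<Phi> (\<Phi>0 v))"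
    using linear_compose[OF \<Phi>0(1), of "inv_into UNIV \<Phi>"] by (simp add: o_def)
  then have f: "matrix (\<lambda>v. inv_into UNIV \<Phi> (\<Phi>0 v)) *v v = inv_into UNIV \<Phi> (\<Phi>0 v)" for v
    by (rule matrix_vec)
  define f where "f = matrix (\<lambda>v. inv_into UNIV \<Phi> (\<Phi>0 v))"
  have \<Phi>f: "\<Phi> (f *v v) = \<Phi>0 v" for v
    using f by (simp add: f_def surj_f_inv_f[OF bij_is_surj[OF bij]])
  have q: "quad_form (f *v v) = quad_form v" for v
  proof -
    have "complex_of_real (quad_form (f *v v)) = herm_form (\<Phi>0 v) (\<Phi>0 v)"
      using \<Phi> by (simp add: hermitian_identification_def flip: \<Phi>f)
    then show ?thesis by (simp add: \<Phi>0(2))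
  qed
  then have fO: "f \<in> carrier O2n" by (simp add: O2n_def)
  have "bij ((*v) f)"
    using isometry_invertible[OF q] by (simp add: invertible_eq_bij)
  then have "bij (\<Phi> \<circ> (*v) f)" using bij by (rule bij_comp)
  moreover have "\<Phi> \<circ> (*v) f = \<Phi>0" by (simp add: fun_eq_iff \<Phi>f)
  ultimately have "hermitian_identification \<Phi>0"
    using \<Phi>0 by (simp add: hermitian_identification_def)
  with fO \<Phi>f show ?thesis by (rule that)
qed

text \<open>
  With \<open>\<zeta> = v1 + \<i> v2\<close> and \<open>\<omega> = v5 + \<i> v4\<close>, the quadratic form is \<open>2 Re (\<zeta> cnj \<omega>)\<close> plus the
  square norm of the middle part. So the negative coordinate is \<open>(\<zeta> - \<omega>) / sqrt 2\<close>, and \<open>k0\<close> indexes the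
  positive coordinate \<open>(\<zeta> + \<omega>) / sqrt 2\<close>. The minus sign in the other coordinates makes
  \<open>stretched_rotation p e 1\<close> act as multiplication by \<open>\<i>\<close>.
\<close>

definition herm_coords ::
    "'k \<Rightarrow> ('k \<Rightarrow> nat) \<Rightarrow> (nat \<Rightarrow> real ^ 'n) \<Rightarrow> 'n::finite vec2n \<Rightarrow> complex ^ 'k::finite option" where
  "herm_coords k0 \<sigma> e v = (\<chi> j. case j of
      None \<Rightarrow> Complex ((v $ First - v $ Last) / sqrt 2) ((v $ Second - v $ Penult) / sqrt 2)
    | Some k \<Rightarrow> if k = k0 then Complex ((v $ First + v $ Last) / sqrt 2) ((v $ Second + v $ Penult) / sqrt 2)
        else Complex (mid v \<bullet> e (2 * \<sigma> k)) (- (mid v \<bullet> e (2 * \<sigma> k + 1))))"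

lemma linear_herm_coords: "linear (herm_coords k0 \<sigma> e)"
  by (rule linearI)
    (auto simp: herm_coords_def vec_eq_iff complex_eq_iff inner_add_left algebra_simps
      add_divide_distrib diff_divide_distrib split: option.split)

lemma herm_coords_quad_form:
  assumes e: "orthonormal_basis (2 * p) e" and \<sigma>: "bij_betw \<sigma> (UNIV - {k0}) {..<p}"
  shows "herm_form (herm_coords k0 \<sigma> e v) (herm_coords k0 \<sigma> e v) = of_real (quad_form v)"
proof -
  let ?z = "herm_coords k0 \<sigma> e v"
  have sq: "Complex a b * cnj (Complex a b) = of_real (a\<^sup>2 + b\<^sup>2)" for a b
    by (simp add: complex_mult_cnj)
  have "(\<Sum>k\<in>UNIV - {k0}. ?z $ Some k * cnj (?z $ Some k)) =
      of_real (\<Sum>k\<in>UNIV - {k0}. (mid v \<bullet> e (2 * \<sigma> k))\<^sup>2 + (mid v \<bullet> e (2 * \<sigma> k + 1))\<^sup>2)"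
    unfolding of_real_sum by (rule sum.cong) (auto simp: herm_coords_def sq simp del: complex_cnj)
  also have "\<dots> = of_real (\<Sum>j<p. (mid v \<bullet> e (2 * j))\<^sup>2 + (mid v \<bullet> e (2 * j + 1))\<^sup>2)"
    using sum.reindex_bij_betw[OF \<sigma>, of "\<lambda>j. (mid v \<bullet> e (2 * j))\<^sup>2 + (mid v \<bullet> e (2 * j + 1))\<^sup>2"] by simp
  also have "\<dots> = of_real (mid v \<bullet> mid v)"
    unfolding orthonormal_expand(2)[OF e, of "mid v" "mid v"] sum_pairs by (simp add: power2_eq_square)
  finally have rest: "(\<Sum>k\<in>UNIV - {k0}. ?z $ Some k * cnj (?z $ Some k)) = of_real (mid v \<bullet> mid v)" .
  have k0: "?z $ Some k0 * cnj (?z $ Some k0) =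
      of_real (((v $ First + v $ Last) / sqrt 2)\<^sup>2 + ((v $ Second + v $ Penult) / sqrt 2)\<^sup>2)"
    by (simp add: herm_coords_def sq del: complex_cnj)
  have none: "?z $ None * cnj (?z $ None) =
      of_real (((v $ First - v $ Last) / sqrt 2)\<^sup>2 + ((v $ Second - v $ Penult) / sqrt 2)\<^sup>2)"
    by (simp add: herm_coords_def sq del: complex_cnj)
  have "herm_form ?z ?z = - (?z $ None * cnj (?z $ None))
      + (?z $ Some k0 * cnj (?z $ Some k0) + (\<Sum>k\<in>UNIV - {k0}. ?z $ Some k * cnj (?z $ Some k)))"
    unfolding herm_form_def by (subst sum.remove[of UNIV k0]) auto
  also have "\<dots> = of_real (quad_form v)"
    unfolding rest k0 none of_real_add[symmetric] of_real_minus[symmetric] of_real_eq_iff quad_form_mid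
    by (simp add: power_divide power2_eq_square field_simps)
  finally show ?thesis .
qed

lemma herm_coords_flag_structure:
  assumes e: "orthonormal_basis (2 * p) e" and \<sigma>: "bij_betw \<sigma> (UNIV - {k0}) {..<p}"
  shows "herm_coords k0 \<sigma> e (flag_structure (stretched_rotation p e 1) *v v) = \<i> *s herm_coords k0 \<sigma> e v"
proof -
  have "\<sigma> k < p" if "k \<noteq> k0" for k using bij_betwE[OF \<sigma>] that by auto
  note c = stretched_rotation_coords[OF e this, simplified]
  show ?thesis
    unfolding flag_structure_vec[OF stretched_rotation(1)[OF e order_refl]]
    by (auto simp: herm_coords_def vec_eq_iff complex_eq_iff c add_divide_distrib diff_divide_distrib split: option.split)
qed

section \<open>Orthogonal complex structures and block form\<close>

lemma block_diagonal_column: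
  fixes e :: "nat \<Rightarrow> 'v::real_vector"
  assumes "j < p"
  shows "(\<Sum>i<2 * p. block_diagonal P i (2 * j) *\<^sub>R e i) = P 0 0 *\<^sub>R e (2 * j) + P 1 0 *\<^sub>R e (2 * j + 1)"
    "(\<Sum>i<2 * p. block_diagonal P i (2 * j + 1) *\<^sub>R e i) = P 0 1 *\<^sub>R e (2 * j) + P 1 1 *\<^sub>R e (2 * j + 1)"
proof -
  have "(\<Sum>i<2 * p. block_diagonal P i (2 * j) *\<^sub>R e i) =
      (\<Sum>l<p. if l = j then P 0 0 *\<^sub>R e (2 * j) + P 1 0 *\<^sub>R e (2 * j + 1) else 0)"
    unfolding sum_pairs by (intro sum.cong refl) (simp add: block_diagonal_def)
  then show "(\<Sum>i<2 * p. block_diagonal P i (2 * j) *\<^sub>R e i) = P 0 0 *\<^sub>R e (2 * j) + P 1 0 *\<^sub>R e (2 * j + 1)"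
    using assms by simp
  have "(\<Sum>i<2 * p. block_diagonal P i (2 * j + 1) *\<^sub>R e i) =
      (\<Sum>l<p. if l = j then P 0 1 *\<^sub>R e (2 * j) + P 1 1 *\<^sub>R e (2 * j + 1) else 0)"
    unfolding sum_pairs by (intro sum.cong refl) (simp add: block_diagonal_def)
  then show "(\<Sum>i<2 * p. block_diagonal P i (2 * j + 1) *\<^sub>R e i) = P 0 1 *\<^sub>R e (2 * j) + P 1 1 *\<^sub>R e (2 * j + 1)"
    using assms by simp
qed

lemma matrix_wrt_basis_rot_block:
  "matrix_wrt_basis (2 * p) e B (block_diagonal (rot_block a b)) \<longleftrightarrow>
     (\<forall>j<p. B (e (2 * j)) = a *\<^sub>R e (2 * j) - b *\<^sub>R e (2 * j + 1) \<and>
        B (e (2 * j + 1)) = b *\<^sub>R e (2 * j) + a *\<^sub>R e (2 * j + 1))"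
  (is "?L \<longleftrightarrow> ?R")
proof
  assume L: ?L
  show ?R
  proof (intro allI impI)
    fix j assume j: "j < p"
    show "B (e (2 * j)) = a *\<^sub>R e (2 * j) - b *\<^sub>R e (2 * j + 1) \<and>
        B (e (2 * j + 1)) = b *\<^sub>R e (2 * j) + a *\<^sub>R e (2 * j + 1)"
      using L[unfolded matrix_wrt_basis_def, rule_format, of "2 * j"]
        L[unfolded matrix_wrt_basis_def, rule_format, of "2 * j + 1"] j
      unfolding block_diagonal_column[OF j] by (simp add: rot_block_def)
  qed
next
  assume R: ?R
  show ?L
    unfolding matrix_wrt_basis_def
  proof (intro allI impI)
    fix i assume "i < 2 * p"
    then have j: "i div 2 < p" by auto
    consider "i = 2 * (i div 2)" | "i = 2 * (i div 2) + 1" by linarith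
    then show "B (e i) = (\<Sum>l<2 * p. block_diagonal (rot_block a b) l i *\<^sub>R e l)"
    proof cases
      case 1
      show ?thesis
        by (subst (1 2) 1, unfold block_diagonal_column[OF j]) (use R j in \<open>simp add: rot_block_def\<close>)
    next
      case 2
      show ?thesis
        by (subst (1 2) 2, unfold block_diagonal_column[OF j]) (use R j in \<open>simp add: rot_block_def\<close>)
    qed
  qed
qed

lemma stretched_rotation_basis:
  assumes e: "orthonormal_basis (2 * p) e" and j: "j < p"
  shows "stretched_rotation p e 1 (e (2 * j)) = - e (2 * j + 1)"
    "stretched_rotation p e 1 (e (2 * j + 1)) = e (2 * j)"
proof -
  have on: "e i \<bullet> e j = (if i = j then 1 else 0)" if "i < 2 * p" "j < 2 * p" for i j
    using e that by (simp add: orthonormal_basis_def)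
  have ne: "2 * i \<noteq> 2 * j + 1" "2 * j \<noteq> 2 * i + 1" for i :: nat by presburger+
  have "stretched_rotation p e 1 (e (2 * j)) = (\<Sum>i<p. if i = j then - e (2 * j + 1) else 0)"
    unfolding stretched_rotation_def using j ne by (intro sum.cong) (auto simp: on)
  then show "stretched_rotation p e 1 (e (2 * j)) = - e (2 * j + 1)" using j by simp
  have "stretched_rotation p e 1 (e (2 * j + 1)) = (\<Sum>i<p. if i = j then e (2 * j) else 0)"
    unfolding stretched_rotation_def using j ne by (intro sum.cong) (auto simp: on)
  then show "stretched_rotation p e 1 (e (2 * j + 1)) = e (2 * j)" using j by simp
qed

text \<open>
  The block form says \<open>B = a + b K\<close>, where \<open>K\<close> has the blocks with \<open>a = 0\<close> and \<open>b = 1\<close>.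
\<close>

lemma block_form_stretched_rotation:
  assumes e: "orthonormal_basis (2 * p) e" and B: "linear B"
    and M: "matrix_wrt_basis (2 * p) e B (block_diagonal (rot_block a b))"
  shows "B x = a *\<^sub>R x + b *\<^sub>R stretched_rotation p e 1 x"
proof (rule linear_eq_on_span[of B "\<lambda>x. a *\<^sub>R x + b *\<^sub>R stretched_rotation p e 1 x" "e ` {..<2 * p}"])
  show "linear (\<lambda>x. a *\<^sub>R x + b *\<^sub>R stretched_rotation p e 1 x)"
    using linear_pencil[OF stretched_rotation(1)[OF e order_refl], of b a] by (simp add: add.commute)
  fix y assume "y \<in> e ` {..<2 * p}"
  then obtain i where i: "i < 2 * p" "y = e i" by auto
  then have j: "i div 2 < p" by auto
  note r = M[unfolded matrix_wrt_basis_rot_block, rule_format, OF j]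
  consider "i = 2 * (i div 2)" | "i = 2 * (i div 2) + 1" by linarith
  then show "B y = a *\<^sub>R y + b *\<^sub>R stretched_rotation p e 1 y"
  proof cases
    case 1
    then show ?thesis using r stretched_rotation_basis(1)[OF e j] i(2) by simp
  next
    case 2
    then have "y = e (2 * (i div 2) + 1)" using i(2) by simp
    then show ?thesis using r stretched_rotation_basis(2)[OF e j] by (simp add: add.commute)
  qed
qed (use B e in \<open>auto simp: orthonormal_basis_def\<close>)

lemma stretched_rotation_skew:
  assumes e: "orthonormal_basis (2 * p) e"
  shows "stretched_rotation p e 1 x \<bullet> y = - (x \<bullet> stretched_rotation p e 1 y)"
  unfolding orthonormal_expand(2)[OF e, of "stretched_rotation p e 1 x" y]
    orthonormal_expand(2)[OF e, of x "stretched_rotation p e 1 y"] sum_pairs sum_negf[symmetric]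
  by (intro sum.cong refl) (simp add: stretched_rotation_coords[OF e, simplified])

text \<open>
  Orthonormal vectors are chosen in pairs: a unit vector \<open>v\<close> orthogonal to the previous pairs, and
  \<open>- K v\<close>. As \<open>K\<close> is skew, the new pair is orthogonal to the previous ones, whose span is
  invariant under \<open>K\<close>.
\<close>

lemma complex_structure_basis:
  fixes K :: "'v::euclidean_space \<Rightarrow> 'v"
  assumes K: "orthogonal_transformation K" "\<And>x. K (K x) = - x" and d: "DIM('v) = 2 * p"
  obtains e where "orthonormal_basis (2 * p) e" "\<And>j. j < p \<Longrightarrow> K (e (2 * j)) = - e (2 * j + 1)"
    "\<And>j. j < p \<Longrightarrow> K (e (2 * j + 1)) = e (2 * j)"
proof -
  have lK: "linear K" and inK: "\<And>x y. K x \<bullet> K y = x \<bullet> y"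
    using K(1) by (auto simp: orthogonal_transformation_def)
  have skew: "K x \<bullet> y = - (x \<bullet> K y)" for x y
    using inK[of x "K y"] by (simp add: K(2))
  have "\<exists>e. (\<forall>i<2 * q. \<forall>j<2 * q. e i \<bullet> e j = (if i = j then 1 else 0)) \<and>
      (\<forall>j<q. K (e (2 * j)) = - e (2 * j + 1) \<and> K (e (2 * j + 1)) = e (2 * j))" if "q \<le> p" for q
    using that
  proof (induction q)
    case (Suc q)
    then obtain e where on: "\<And>i j. i < 2 * q \<Longrightarrow> j < 2 * q \<Longrightarrow> e i \<bullet> e j = (if i = j then 1 else 0)"
      and Ke: "\<And>j. j < q \<Longrightarrow> K (e (2 * j)) = - e (2 * j + 1)" "\<And>j. j < q \<Longrightarrow> K (e (2 * j + 1)) = e (2 * j)"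
      by (metis Suc_leD)
    have "dim (e ` {..<2 * q}) \<le> card (e ` {..<2 * q})" by (rule dim_le_card') simp
    also have "\<dots> \<le> 2 * q" using card_image_le[of "{..<2 * q}" e] by simp
    also have "\<dots> < DIM('v)" using Suc.prems d by simp
    finally obtain x where x: "x \<noteq> 0" "\<And>y. y \<in> span (e ` {..<2 * q}) \<Longrightarrow> orthogonal x y"
      using orthogonal_to_subspace_exists by blast
    define v where "v = x /\<^sub>R norm x"
    have vv: "v \<bullet> v = 1" using x(1) by (simp add: v_def dot_square_norm power2_eq_square)
    have ve: "v \<bullet> e i = 0" if "i < 2 * q" for i
      using x(2)[of "e i"] that by (simp add: v_def orthogonal_def span_base)
    have Kve: "K v \<bullet> e i = 0" if i: "i < 2 * q" for i
    proof -
      have j: "i div 2 < q" using i by auto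
      consider "i = 2 * (i div 2)" | "i = 2 * (i div 2) + 1" by linarith
      then show ?thesis
      proof cases
        case 1
        then have "K (e i) = - e (2 * (i div 2) + 1)" using Ke(1)[OF j] by simp
        then show ?thesis using ve[of "2 * (i div 2) + 1"] j by (simp add: skew)
      next
        case 2
        then have "K (e i) = e (2 * (i div 2))" using Ke(2)[OF j] by simp
        then show ?thesis using ve[of "2 * (i div 2)"] j by (simp add: skew)
      qed
    qed
    have vK: "v \<bullet> K v = 0" and Kv: "K v \<bullet> v = 0"
      using skew[of v v] by (simp_all add: inner_commute)
    have ev: "e i \<bullet> v = 0" "e i \<bullet> K v = 0" if "i < 2 * q" for i
      using ve[OF that] Kve[OF that] by (simp_all add: inner_commute)
    define e' where "e' = e(2 * q := v, 2 * q + 1 := - K v)"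
    have e': "e' i = e i" if "i < 2 * q" for i using that by (simp add: e'_def)
    have top: "e' (2 * q) = v" "e' (2 * q + 1) = - K v" by (simp_all add: e'_def)
    have "e' i \<bullet> e' j = (if i = j then 1 else 0)" if "i < 2 * Suc q" "j < 2 * Suc q" for i j
    proof -
      have "i < 2 * q \<or> i = 2 * q \<or> i = 2 * q + 1" "j < 2 * q \<or> j = 2 * q \<or> j = 2 * q + 1"
        using that by auto
      then show ?thesis
        using on ve Kve ev vv inK[of v v]
        by (elim disjE) (simp_all add: e' top[simplified] vK Kv)
    qed
    moreover have "K (e' (2 * j)) = - e' (2 * j + 1) \<and> K (e' (2 * j + 1)) = e' (2 * j)" if "j < Suc q" for j
    proof (cases "j = q")
      case True
      then show ?thesis by (simp add: top[simplified] linear_neg[OF lK] K(2))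
    next
      case False
      then have "j < q" using that by simp
      then show ?thesis using Ke[of j] e'[of "2 * j"] e'[of "2 * j + 1"] by simp
    qed
    ultimately show ?case by blast
  qed simp
  then obtain e where on: "\<And>i j. i < 2 * p \<Longrightarrow> j < 2 * p \<Longrightarrow> e i \<bullet> e j = (if i = j then 1 else 0)"
    and Ke: "\<And>j. j < p \<Longrightarrow> K (e (2 * j)) = - e (2 * j + 1)" "\<And>j. j < p \<Longrightarrow> K (e (2 * j + 1)) = e (2 * j)"
    by (metis order_refl)
  let ?S = "e ` {..<2 * p}"
  have inj: "inj_on e {..<2 * p}"
  proof (rule inj_onI)
    fix i j assume "i \<in> {..<2 * p}" "j \<in> {..<2 * p}" "e i = e j"
    then show "i = j" using on[of i j] on[of i i] by (auto split: if_splits)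
  qed
  have "pairwise orthogonal ?S"
  proof (rule pairwiseI)
    fix x y assume "x \<in> ?S" "y \<in> ?S" "x \<noteq> y"
    then obtain i j where "i < 2 * p" "j < 2 * p" "x = e i" "y = e j" by auto
    with \<open>x \<noteq> y\<close> show "orthogonal x y" using on[of i j] by (auto simp: orthogonal_def)
  qed
  moreover have "0 \<notin> ?S"
  proof
    assume "0 \<in> ?S"
    then obtain i where "i < 2 * p" "e i = 0" by force
    then show False using on[of i i] by simp
  qed
  ultimately have "independent ?S" by (rule pairwise_orthogonal_independent)
  then have "dim ?S = 2 * p" by (simp add: dim_eq_card_independent card_image[OF inj])
  then have "span ?S = UNIV" using dim_eq_full d by metis
  then have "orthonormal_basis (2 * p) e" using on by (simp add: orthonormal_basis_def)
  then show ?thesis using Ke by (rule that)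
qed

section \<open>Conjugation into $\mathrm{SU}(1,m)$\<close>

lemma O2n_inverse:
  assumes "g \<in> carrier O2n"
  shows "inv\<^bsub>O2n\<^esub> g \<in> carrier O2n" "inv\<^bsub>O2n\<^esub> g ** g = mat 1" "g ** inv\<^bsub>O2n\<^esub> g = mat 1"
proof -
  interpret group "O2n :: 'a mat2n monoid" by (rule group_O2n)
  show "inv\<^bsub>O2n\<^esub> g \<in> carrier O2n" "inv\<^bsub>O2n\<^esub> g ** g = mat 1" "g ** inv\<^bsub>O2n\<^esub> g = mat 1"
    using assms l_inv[of g] r_inv[of g] by simp_all
qed

lemma matrix_vec_minus:
  fixes A :: "real ^ 'i ^ 'j"
  shows "(- A) *v v = - (A *v v)" "A *v (- v) = - (A *v v)"
  by (simp_all add: matrix_vector_mult_def vec_eq_iff sum_negf)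

text \<open>
  \<open>J\<close> is the multiplication by \<open>\<i>\<close>, transported to the real space.
\<close>

lemma identification_structure:
  fixes \<Phi> :: "'n::finite vec2n \<Rightarrow> complex ^ 'k::finite option"
  assumes \<Phi>: "hermitian_identification \<Phi>"
  obtains J where "J \<in> carrier O2n" "\<And>v. \<Phi> (J *v v) = \<i> *s \<Phi> v" "J ** J = - mat 1"
    "\<forall>u \<in> SU1m \<Phi>. u ** J = J ** u"
proof -
  have lin: "linear \<Phi>" and inj: "inj \<Phi>" using \<Phi> by (auto simp: hermitian_identification_def bij_is_inj)
  have "linear (\<lambda>v. \<i> *s \<Phi> v)"
    by (rule linearI) (simp_all add: linear_add[OF lin] linear_scale[OF lin] scaleR_as_complex vec_eq_iff algebra_simps)
  moreover have "herm_form (\<i> *s \<Phi> v) (\<i> *s \<Phi> v) = of_real (quad_form v)" for v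
    using \<Phi> by (simp add: herm_form_linear hermitian_identification_def)
  ultimately obtain J where J: "J \<in> carrier O2n" "\<And>v. \<Phi> (J *v v) = \<i> *s \<Phi> v"
    using identifications_differ_by_isometry[OF \<Phi>] by blast
  have "\<Phi> ((J ** J) *v v) = \<Phi> (- v)" for v
    by (simp add: J(2) matrix_vector_mul_assoc[symmetric] linear_neg[OF lin] vec_eq_iff)
  then have JJ: "J ** J = - mat 1"
    using inj by (simp add: matrix_eq inj_eq matrix_vec_minus)
  have "u ** J = J ** u" if u: "u \<in> SU1m \<Phi>" for u
  proof -
    obtain U where U: "\<And>v. \<Phi> (u *v v) = U *v \<Phi> v" using u unfolding SU1m_def by blast
    have "\<Phi> ((u ** J) *v v) = \<Phi> ((J ** u) *v v)" for v
      by (simp add: J(2) U matrix_vector_mul_assoc[symmetric] vector_scalar_commute)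
    then show ?thesis using inj by (simp add: matrix_eq inj_eq)
  qed
  with J JJ show ?thesis by (intro that) auto
qed

text \<open>
  The isometry \<open>s\<close> acts on the null plane by the matrix that turns the rows \<open>x\<close> and \<open>a x + b K x\<close>
  into \<open>x\<close> and \<open>K x\<close>, and contragrediently on the last two coordinates; it conjugates $H_B$ to
  $H_K$. The isometry \<open>f\<close> then passes from the coordinates adapted to \<open>K\<close> to the given \<open>\<Phi>\<close>.
\<close>

lemma block_form_imp_conjugate:
  fixes B :: "real ^ 'n \<Rightarrow> real ^ 'n::finite" and \<Phi> :: "'n vec2n \<Rightarrow> complex ^ 'k::finite option"
  assumes B: "linear B" and \<Phi>: "hermitian_identification \<Phi>" and card: "CARD('k) = p + 1"
    and b: "b \<noteq> 0" and e: "orthonormal_basis (2 * p) e"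
    and M: "matrix_wrt_basis (2 * p) e B (block_diagonal (rot_block a b))"
  obtains g where "g \<in> carrier O2n" "conjugate_by O2n g (h_group B) \<subseteq> SU1m \<Phi>"
proof -
  define K where "K = stretched_rotation p e 1"
  have K: "linear K" "\<And>x. K (K x) = - x" "\<And>x y. K x \<bullet> y = - (x \<bullet> K y)"
    unfolding K_def using stretched_rotation(1,2)[OF e order_refl] stretched_rotation_skew[OF e] by blast+
  have BK: "B x = a *\<^sub>R x + b *\<^sub>R K x" for x
    unfolding K_def by (rule block_form_stretched_rotation[OF e B M])
  obtain k0 :: 'k where True by simp
  have "card (UNIV - {k0}) = card {..<p}" using card by (simp add: card_Diff_singleton)
  then obtain \<sigma> where \<sigma>: "bij_betw \<sigma> (UNIV - {k0}) {..<p}"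
    using finite_same_card_bij[of "UNIV - {k0}" "{..<p}"] by auto
  let ?\<Phi>0 = "herm_coords k0 \<sigma> e :: 'n vec2n \<Rightarrow> _"
  obtain f where f: "f \<in> carrier O2n" "\<And>v. \<Phi> (f *v v) = ?\<Phi>0 v" "hermitian_identification ?\<Phi>0"
    using identifications_differ_by_isometry[OF \<Phi> linear_herm_coords herm_coords_quad_form[OF e \<sigma>]] by blast
  have sub: "h_group K \<subseteq> SU1m ?\<Phi>0"
    by (rule h_group_subset_SU1m[OF K f(3)]) (simp add: K_def herm_coords_flag_structure[OF e \<sigma>])
  define s :: "'n mat2n" where "s = matrix (\<lambda>v. pt (v $ First) ((v $ Second - a * v $ First) / b) (mid v)
      (b * v $ Penult) (v $ Last + a * v $ Penult))"
  have s_vec: "s *v v = pt (v $ First) ((v $ Second - a * v $ First) / b) (mid v)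
      (b * v $ Penult) (v $ Last + a * v $ Penult)" for v
    unfolding s_def
    by (rule matrix_vec, rule linearI; rule vec2n_eqI) (simp_all add: algebra_simps add_divide_distrib diff_divide_distrib)
  have sO: "s \<in> carrier O2n"
    using b by (simp add: O2n_def quad_form_mid s_vec) (simp add: algebra_simps)
  have "s ** unip x (B x) \<eta> = unip x (K x) (\<eta> / b) ** s" for x \<eta>
  proof -
    have "x \<bullet> K x = 0" using K(3)[of x x] by (simp add: inner_commute)
    moreover have "K x \<bullet> K x = x \<bullet> x" by (simp add: K(2,3))
    ultimately show ?thesis
      unfolding matrix_eq matrix_vector_mul_assoc[symmetric] unip_vec s_vec BK using b
      by (auto intro!: vec2n_eqI simp: field_simps inner_add inner_commute[of "K x" x])
  qed
  moreover have "s ** dil r = dil r ** s" for r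
    unfolding matrix_eq matrix_vector_mul_assoc[symmetric] dil_vec s_vec
    by (auto intro!: vec2n_eqI simp: field_simps add_divide_distrib)
  ultimately have conj: "s ** (unip x (B x) \<eta> ** dil r) = (unip x (K x) (\<eta> / b) ** dil r) ** s" for x \<eta> r
    by (metis matrix_mul_assoc)
  have fs: "f ** s \<in> carrier O2n"
    using f(1) sO by (simp add: O2n_def matrix_vector_mul_assoc[symmetric])
  note i = O2n_inverse[OF fs]
  have "(f ** s) ** h ** inv\<^bsub>O2n\<^esub> (f ** s) \<in> SU1m \<Phi>" if hB: "h \<in> h_group B" for h
  proof -
    obtain x \<eta> r where h: "h = unip x (B x) \<eta> ** dil r" "r > 0"
      using hB unfolding h_group_def by blast
    let ?h' = "unip x (K x) (\<eta> / b) ** dil r"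
    have "?h' \<in> SU1m ?\<Phi>0" using sub h_groupI[of r "K x" K x "\<eta> / b"] h(2) by blast
    then obtain U where U: "\<forall>z w. herm_form (U *v z) (U *v w) = herm_form z w" "det U = 1"
      "\<And>v. ?\<Phi>0 (?h' *v v) = U *v ?\<Phi>0 v" by (auto simp: SU1m_def)
    have "\<Phi> (((f ** s) ** h ** inv\<^bsub>O2n\<^esub> (f ** s)) *v v) = U *v \<Phi> v" for v
    proof -
      let ?w = "inv\<^bsub>O2n\<^esub> (f ** s) *v v"
      have "((f ** s) ** h ** inv\<^bsub>O2n\<^esub> (f ** s)) *v v = f *v ((s ** h) *v ?w)"
        by (simp only: matrix_vector_mul_assoc matrix_mul_assoc)
      also have "\<dots> = f *v (?h' *v (s *v ?w))"
        unfolding h(1) conj by (simp only: matrix_vector_mul_assoc matrix_mul_assoc)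
      finally have "\<Phi> (((f ** s) ** h ** inv\<^bsub>O2n\<^esub> (f ** s)) *v v) = U *v ?\<Phi>0 (s *v ?w)"
        by (simp only: f(2) U(3))
      also have "?\<Phi>0 (s *v ?w) = \<Phi> ((f ** s ** inv\<^bsub>O2n\<^esub> (f ** s)) *v v)"
        unfolding f(2)[symmetric] by (simp only: matrix_vector_mul_assoc matrix_mul_assoc)
      finally show ?thesis by (simp only: i(3) matrix_vector_mul_lid)
    qed
    with U(1,2) show ?thesis unfolding SU1m_def by blast
  qed
  then have "conjugate_by O2n (f ** s) (h_group B) \<subseteq> SU1m \<Phi>"
    by (auto simp: conjugate_by_def)
  with fs show ?thesis by (rule that)
qed

text \<open>
  The complex structure \<open>J\<close> obtained from $\mathrm{SU}(1,m)$ commutes with every element of $H_B$, so it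
  intertwines \<open>unip x (B x) 0\<close> with itself. This is stronger than normalizing $H_B$: the vector \<open>x'\<close> in
  \<open>intertwine_unip\<close> is \<open>x\<close>, and the inverse of \<open>R\<close> is \<open>\<alpha> + \<beta> B\<close>.
\<close>

lemma conjugate_imp_block_form:
  fixes B :: "real ^ 'n \<Rightarrow> real ^ 'n::finite" and \<Phi> :: "'n vec2n \<Rightarrow> complex ^ 'k::finite option"
  assumes B: "linear B" "no_real_eigenvalue B" and \<Phi>: "hermitian_identification \<Phi>"
    and card: "CARD('n) = 2 * p"
    and g: "g \<in> carrier O2n" "conjugate_by O2n g (h_group B) \<subseteq> SU1m \<Phi>"
  obtains a b e where "b \<noteq> 0" "orthonormal_basis (2 * p) e"
    "matrix_wrt_basis (2 * p) e B (block_diagonal (rot_block a b))"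
proof -
  let ?k = "inv\<^bsub>O2n\<^esub> g"
  note k = O2n_inverse[OF g(1)]
  obtain J0 where J0: "J0 \<in> carrier O2n" "\<And>v. \<Phi> (J0 *v v) = \<i> *s \<Phi> v" "J0 ** J0 = - mat 1"
    "\<forall>u \<in> SU1m \<Phi>. u ** J0 = J0 ** u"
    by (rule identification_structure[OF \<Phi>], rule that, assumption+)
  define J where "J = ?k ** J0 ** g"
  have JO: "J \<in> carrier O2n"
    using k(1) J0(1) g(1) by (simp add: J_def O2n_def matrix_vector_mul_assoc[symmetric])
  have "J ** J = ?k ** J0 ** (g ** ?k) ** J0 ** g" by (simp add: J_def matrix_mul_assoc)
  also have "\<dots> = ?k ** (J0 ** J0) ** g" by (simp add: k(3) matrix_mul_assoc)
  also have "\<dots> = - mat 1"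
    unfolding J0(3) by (simp add: matrix_eq matrix_vector_mul_assoc[symmetric] matrix_vec_minus)
      (simp add: matrix_vector_mul_assoc k(2) matrix_vec_minus)
  finally have JJ: "J *v (J *v v) = - v" for v
    by (simp add: matrix_vector_mul_assoc matrix_vec_minus)
  have com: "J ** h = h ** J" if "h \<in> h_group B" for h
  proof -
    have "g ** h ** ?k \<in> SU1m \<Phi>" using g(2) that by (auto simp: conjugate_by_def)
    from J0(4)[rule_format, OF this] have "?k ** (J0 ** (g ** h ** ?k)) ** g = ?k ** ((g ** h ** ?k) ** J0) ** g" by simp
    then have "(?k ** J0 ** g) ** h ** (?k ** g) = (?k ** g) ** h ** (?k ** J0 ** g)"
      by (simp only: matrix_mul_assoc)
    then show ?thesis by (simp add: k(2) J_def)
  qed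
  then have ex: "\<exists>h'\<in>h_group B. J ** h' = h ** J" "\<exists>h'\<in>h_group B. J ** h = h' ** J" if "h \<in> h_group B" for h
    using that by blast+
  have pl: "J *v v \<in> null_plane" if "v \<in> null_plane" for v
    by (rule intertwiner_null_plane[OF B B ex(1) that])
  have cpl: "J *v v \<in> null_plane_perp" if "v \<in> null_plane_perp" for v
    by (rule intertwiner_null_plane_perp[OF B B JO isometry_left_inverse[OF JO] ex(2) that])
  define R where "R = mid_part J"
  have R: "orthogonal_transformation R" unfolding R_def by (rule mid_part_orthogonal[OF JO cpl])
  then have lR: "linear R" by (rule orthogonal_transformation_linear)
  have RR: "R (R z) = - z" for z
  proof -
    have "J *v pt 0 0 z 0 0 \<in> null_plane_perp" by (rule cpl) (simp add: null_plane_perp_def)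
    from mid_part_null_plane_perp[OF pl this] show ?thesis
      by (simp add: R_def JJ) (simp add: mid_part_def)
  qed
  define \<alpha> \<beta> where "\<alpha> = (J *v pt 1 0 0 0 0) $ First" and "\<beta> = (J *v pt 0 1 0 0 0) $ First"
  have rel: "x = R (\<alpha> *\<^sub>R x + \<beta> *\<^sub>R B x)" for x
  proof -
    have "J ** unip x (B x) 0 = (unip x (B x) 0 ** dil 1) ** J"
      using com[OF unip_in_h_group[of "B x" B x 0]] by simp
    from intertwine_unip(1)[OF JO pl cpl this] show ?thesis by (simp add: \<alpha>_def \<beta>_def R_def)
  qed
  have Rx: "R x = - (\<alpha> *\<^sub>R x + \<beta> *\<^sub>R B x)" for x
    using arg_cong[OF rel[of x], of R] by (simp only: RR)
  have "\<beta> \<noteq> 0"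
  proof
    assume "\<beta> = 0"
    then have R\<alpha>: "R x = (- \<alpha>) *\<^sub>R x" for x using Rx by simp
    obtain x0 :: "real ^ 'n" where "x0 \<noteq> 0" using axis_eq_0_iff by (metis zero_neq_one)
    moreover have "no_real_eigenvalue R" by (rule square_minus_one_no_eigenvalue[OF lR RR])
    ultimately show False using R\<alpha> unfolding no_real_eigenvalue_def by blast
  qed
  then have BR: "B x = (- \<alpha> / \<beta>) *\<^sub>R x + (- 1 / \<beta>) *\<^sub>R R x" for x
    by (simp add: Rx scaleR_diff_right)
  have "DIM(real ^ 'n) = 2 * p" using card by simp
  then obtain e where e: "orthonormal_basis (2 * p) e" "\<And>j. j < p \<Longrightarrow> R (e (2 * j)) = - e (2 * j + 1)"
    "\<And>j. j < p \<Longrightarrow> R (e (2 * j + 1)) = e (2 * j)"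
    using complex_structure_basis[OF R RR] by blast
  have "matrix_wrt_basis (2 * p) e B (block_diagonal (rot_block (- \<alpha> / \<beta>) (- 1 / \<beta>)))"
    unfolding matrix_wrt_basis_rot_block
  proof (intro allI impI conjI)
    fix j assume j: "j < p"
    show "B (e (2 * j)) = (- \<alpha> / \<beta>) *\<^sub>R e (2 * j) - (- 1 / \<beta>) *\<^sub>R e (2 * j + 1)"
      unfolding BR e(2)[OF j] by simp
    show "B (e (2 * j + 1)) = (- 1 / \<beta>) *\<^sub>R e (2 * j) + (- \<alpha> / \<beta>) *\<^sub>R e (2 * j + 1)"
      unfolding BR e(3)[OF j] by simp
  qed
  with e(1) \<open>\<beta> \<noteq> 0\<close> show ?thesis by (intro that[of "- 1 / \<beta>"]) auto
qed

theorem theorem1p5: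
  fixes m :: nat
  assumes "m \<ge> 2"
    and "CARD('n::finite) = 2 * m - 2"
    and "CARD('k::finite) = m"
  shows
    "(\<forall>B :: real ^ 'n \<Rightarrow> real ^ 'n. linear B \<and> no_real_eigenvalue B \<longrightarrow>
        (\<forall>\<Gamma>. cocompact_lattice SO1n \<Gamma> \<longrightarrow>
            acts_properly \<Gamma> (\<lambda>\<gamma> c. \<gamma> <#\<^bsub>SO2n\<^esub> c) (left_coset_space SO2n (H_sub B)) \<and>
            compact_space (double_coset_space SO2n \<Gamma> (H_sub B))) \<and>
        (\<forall>\<Phi> :: 'n vec2n \<Rightarrow> complex ^ 'k option. hermitian_identification \<Phi> \<longrightarrow>
            ((\<exists>g \<in> carrier O2n. conjugate_by O2n g (H_sub B) \<subseteq> SU1m \<Phi>) \<longleftrightarrow>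
             (\<exists>a b e. b \<noteq> 0 \<and> orthonormal_basis (2 * m - 2) e \<and>
                matrix_wrt_basis (2 * m - 2) e B (block_diagonal (rot_block a b)))))) \<and>
     (\<exists>\<H>. \<H> \<subseteq> {H_sub B | B :: real ^ 'n \<Rightarrow> real ^ 'n. linear B \<and> no_real_eigenvalue B} \<and>
        uncountable \<H> \<and> pairwise (\<lambda>H K. \<not> conjugate_in SO2n H K) \<H>)"
proof -
  define p where "p = m - 1"
  have p: "2 * m - 2 = 2 * p" "CARD('n) = 2 * p" "CARD('k) = p + 1" "p > 0"
    using assms by (auto simp: p_def)
  show ?thesis
    unfolding p(1)
  proof (intro conjI allI impI)
    fix B :: "real ^ 'n \<Rightarrow> real ^ 'n"
    assume "linear B \<and> no_real_eigenvalue B"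
    then have B: "linear B" "no_real_eigenvalue B" by auto
    note H = H_sub_eq_h_group[OF B(1)]
    show "acts_properly \<Gamma> (\<lambda>\<gamma> c. \<gamma> <#\<^bsub>SO2n\<^esub> c) (left_coset_space SO2n (H_sub B))"
      if "cocompact_lattice SO1n \<Gamma>" for \<Gamma>
      unfolding H by (rule lattice_acts_properly[OF B that])
    show "compact_space (double_coset_space SO2n \<Gamma> (H_sub B))" if "cocompact_lattice SO1n \<Gamma>" for \<Gamma>
      unfolding H by (rule lattice_double_cosets_compact[OF B that])
    fix \<Phi> :: "'n vec2n \<Rightarrow> complex ^ 'k option"
    assume \<Phi>: "hermitian_identification \<Phi>"
    show "(\<exists>g \<in> carrier O2n. conjugate_by O2n g (H_sub B) \<subseteq> SU1m \<Phi>) \<longleftrightarrow>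
        (\<exists>a b e. b \<noteq> 0 \<and> orthonormal_basis (2 * p) e \<and>
          matrix_wrt_basis (2 * p) e B (block_diagonal (rot_block a b)))"
      unfolding H
      using block_form_imp_conjugate[OF B(1) \<Phi> p(3)] conjugate_imp_block_form[OF B \<Phi> p(2)] by metis
  qed (rule uncountably_many_classes[OF p(2,4)])
qed

end
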